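(* Let $(X,d,\mu,\mathcal E,\mathcal F)$ be a sub-Gaussian Dirichlet space with parameters $d_H,d_W$ that satisfies $wBE(\kappa)$ with $\kappa=d_W-\lambda_1^\#$. There exist constants $c,C>0$ such that for every $f\in BV(X)$, $$c\,\mathbf{Var}(f)\le\|f\|_{1,1-\frac{\kappa}{d_W}}\le C\,\mathbf{Var}(f).$$ Consequently there is $C>0$ such that for every $f\in BV(X)$, $$\sup_{r>0}\int_X\mathcal M_rf(y)\,d\mu(y)\le C\liminf_{r\to0^+}\int_X\mathcal M_rf(y)\,d\mu(y),$$ and the two Korevaar-Schoen spaces $KS^{\lambda,1}(X)$ and $\mathcal{KS}^{\lambda,1}(X)$ have equivalent norms (i.e. comparable seminorms $\|\cdot\|_{KS^{\lambda,1}(X)}$ and $\|\cdot\|_{\mathcal{KS}^{\lambda,1}(X)}$) for $\lambda=d_W-\kappa$.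
   Context: A sub-Gaussian Dirichlet space $(X,d,\mu,\mathcal E,\mathcal F)$ with parameters $d_H,d_W$ means: $(X,d,\mu)$ is a locally compact metric measure space, $\mu$ is a Radon measure with support $X$, $(\mathcal E,\mathcal F)$ is a Dirichlet form on $L^2(X,\mu)$, and (i) every ball $B(x,r)=\{y: d(x,y)<r\}$, $x\in X$, $0<r<\infty$, has compact closure; (ii) $\mu$ is Ahlfors $d_H$-regular: there are $c_1,c_2,d_H\in(0,\infty)$ with $c_1r^{d_H}\le\mu(B(x,r))\le c_2r^{d_H}$ for all $x\in X$, $r\in[0,\infty)$; (iii) $\mathcal E$ is regular and strongly local (i.e. $\mathcal E(u,v)=0$ for $u,v\in\mathcal F$ with compact supports such that $u$ is constant in a neighborhood of the support of $v$); (iv) the heat semigroup $\{P_t\}$ of $(\mathcal E,\mathcal F)$ has a continuous heat kernel $p_t(x,y)$ (so $P_tg(x)=\int_Xp_t(x,y)g(y)\,d\mu(y)$) satisfying, for some $c_3,c_4,c_5,c_6\in(0,\infty)$ and $d_W\in(2,\infty)$, $$c_5t^{-d_H/d_W}\exp\Big(-c_6\Big(\tfrac{d(x,y)^{d_W}}{t}\Big)^{\frac1{d_W-1}}\Big)\le p_t(x,y)\le c_3t^{-d_H/d_W}\exp\Big(-c_4\Big(\tfrac{d(x,y)^{d_W}}{t}\Big)^{\frac1{d_W-1}}\Big)$$ for $\mu\times\mu$-a.e. $(x,y)$ and all $t>0$. In this setting $P_t1=1$. $X$ satisfies $wBE(\kappa)$ if $0<\kappa<d_W$ and there is $C>0$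 such that $|P_tg(x)-P_tg(y)|\le C\frac{d(x,y)^\kappa}{t^{\kappa/d_W}}\|g\|_{L^\infty(X,\mu)}$ for all $t>0$, $g\in L^\infty(X,\mu)$, $x,y\in X$. Let $\Delta_r=\{(x,y)\in X\times X: d(x,y)<r\}$. For $\lambda>0$, $KS^{\lambda,1}(X)$ (resp. $\mathcal{KS}^{\lambda,1}(X)$) is the set of $f\in L^1(X,\mu)$ such that $$\|f\|_{KS^{\lambda,1}(X)}:=\limsup_{r\to0^+}\iint_{\Delta_r}\frac{|f(y)-f(x)|}{r^\lambda\mu(B(x,r))}\,d\mu(y)\,d\mu(x)<\infty$$ (resp. $\|f\|_{\mathcal{KS}^{\lambda,1}(X)}<\infty$, defined by the same expression with $\sup_{r>0}$ in place of $\limsup_{r\to0^+}$). Set $\lambda_1^\#=\sup\{\lambda>0: KS^{\lambda,1}(X)\text{ contains non-constant functions}\}$, $BV(X)=KS^{\lambda_1^\#,1}(X)$, and $$\mathbf{Var}(f)=\liminf_{r\to0^+}\iint_{\Delta_r}\frac{|f(y)-f(x)|}{r^{\lambda_1^\#}\mu(B(x,r))}\,d\mu(y)\,d\mu(x).$$ For $f\in L^1(X,\mu)$, $\mathcal M_rf(x)=\frac{1}{r^{d_W-\kappa}\mu(B(x,r))}\int_{B(x,r)}|f(x)-f(y)|\,d\mu(y)$, so that (with $\kappa=d_W-\lambda_1^\#$) $\mathbf{Var}(f)=\liminf_{r\to0^+}\int_X\mathcal M_rf\,d\mu$. For $\alpha\ge0$, $\|f\|_{1,\alpha}=\sup_{t>0}t^{-\alpha}\int_X\int_X|f(x)-f(y)|p_t(x,y)\,d\mu(x)\,d\mu(y)$.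 *)

theory Defs
  imports "HOL-Analysis.Analysis" "HOL-Probability.Essential_Supremum"
begin

text \<open>
  The underlying space is the whole type, and \<open>M\<close> is a Borel measure on it. Elements of the
  Lebesgue spaces are represented by Borel functions, so notions that belong to classes modulo
  null sets (domains of forms, supports, being constant) are stated up to \<open>M\<close>-null sets.
\<close>

section \<open>Radon measures and Lebesgue spaces\<close>

definition radon_measure :: "'a::t2_space measure \<Rightarrow> bool" where
  "radon_measure M \<longleftrightarrow>
     sets M = sets borel \<and>
     (\<forall>K. compact K \<longrightarrow> emeasure M K < \<infinity>) \<and>
     (\<forall>A\<in>sets M. emeasure M A = (INF U\<in>{U. open U \<and> A \<subseteq> U}. emeasure M U)) \<and>
     (\<forall>U. open U \<longrightarrow> emeasure M U = (SUP K\<in>{K. compact K \<and> K \<subseteq> U}. emeasure M K))"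

definition measure_support :: "'a::topological_space measure \<Rightarrow> 'a set" where
  "measure_support M = {x. \<forall>U. open U \<longrightarrow> x \<in> U \<longrightarrow> emeasure M U > 0}"

definition L1_space :: "'a measure \<Rightarrow> ('a \<Rightarrow> real) set" where
  "L1_space M = {f. integrable M f}"

definition L2_space :: "'a measure \<Rightarrow> ('a \<Rightarrow> real) set" where
  "L2_space M = {f \<in> borel_measurable M. integrable M (\<lambda>x. (f x)\<^sup>2)}"

definition L2_inner :: "'a measure \<Rightarrow> ('a \<Rightarrow> real) \<Rightarrow> ('a \<Rightarrow> real) \<Rightarrow> real" where
  "L2_inner M f g = (\<integral>x. f x * g x \<partial>M)"

definition L2_norm :: "'a measure \<Rightarrow> ('a \<Rightarrow> real) \<Rightarrow> real" where
  "L2_norm M f = sqrt (L2_inner M f f)"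

definition Linf_norm :: "'a measure \<Rightarrow> ('a \<Rightarrow> real) \<Rightarrow> ennreal" where
  "Linf_norm M g = esssup M (\<lambda>x. ennreal \<bar>g x\<bar>)"

definition Linf_space :: "'a measure \<Rightarrow> ('a \<Rightarrow> real) set" where
  "Linf_space M = {g \<in> borel_measurable M. Linf_norm M g < \<infinity>}"

text \<open>The support of the class of \<open>u\<close>: the complement of the largest open set on which \<open>u\<close>
  vanishes almost everywhere (for second countable spaces).\<close>

definition ess_support :: "'a::topological_space measure \<Rightarrow> ('a \<Rightarrow> real) \<Rightarrow> 'a set" where
  "ess_support M u = {x. \<forall>U. open U \<longrightarrow> x \<in> U \<longrightarrow> \<not> (AE y in M. y \<in> U \<longrightarrow> u y = 0)}"

definition Cc_space :: "('a::topological_space \<Rightarrow> real) set" where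
  "Cc_space = {f. continuous_on UNIV f \<and> compact (closure {x. f x \<noteq> 0})}"

section \<open>Dirichlet forms and their heat semigroups\<close>

definition form_plus_L2 ::
  "'a measure \<Rightarrow> (('a \<Rightarrow> real) \<Rightarrow> ('a \<Rightarrow> real) \<Rightarrow> real) \<Rightarrow> ('a \<Rightarrow> real) \<Rightarrow> ('a \<Rightarrow> real) \<Rightarrow> real" where
  "form_plus_L2 M E u v = E u v + L2_inner M u v"

locale dirichlet_form =
  fixes M :: "'a measure"
    and E :: "('a \<Rightarrow> real) \<Rightarrow> ('a \<Rightarrow> real) \<Rightarrow> real"
    and F :: "('a \<Rightarrow> real) set"
  assumes domain_L2: "F \<subseteq> L2_space M"
    and domain_cong: "\<lbrakk>u \<in> F; v \<in> borel_measurable M; AE x in M. u x = v x\<rbrakk> \<Longrightarrow> v \<in> F"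
    and form_cong: "\<lbrakk>u \<in> F; u' \<in> F; v \<in> F; AE x in M. u x = u' x\<rbrakk> \<Longrightarrow> E u v = E u' v"
    and domain_zero: "(\<lambda>x. 0) \<in> F"
    and domain_lincomb: "\<lbrakk>u \<in> F; v \<in> F\<rbrakk> \<Longrightarrow> (\<lambda>x. a * u x + b * v x) \<in> F"
    and domain_dense: "\<lbrakk>f \<in> L2_space M; e > 0\<rbrakk> \<Longrightarrow> \<exists>u\<in>F. L2_norm M (\<lambda>x. f x - u x) < e"
    and form_sym: "\<lbrakk>u \<in> F; v \<in> F\<rbrakk> \<Longrightarrow> E u v = E v u"
    and form_lincomb: "\<lbrakk>u \<in> F; v \<in> F; w \<in> F\<rbrakk> \<Longrightarrow>
           E (\<lambda>x. a * u x + b * v x) w = a * E u w + b * E v w"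
    and form_nonneg: "u \<in> F \<Longrightarrow> E u u \<ge> 0"
    and closed: "\<lbrakk>\<And>n::nat. U n \<in> F;
           \<And>e. e > 0 \<Longrightarrow> \<exists>N. \<forall>m\<ge>N. \<forall>n\<ge>N.
              form_plus_L2 M E (\<lambda>x. U m x - U n x) (\<lambda>x. U m x - U n x) < e\<rbrakk> \<Longrightarrow>
           \<exists>u\<in>F. (\<lambda>n. form_plus_L2 M E (\<lambda>x. U n x - u x) (\<lambda>x. U n x - u x)) \<longlonglongrightarrow> 0"
    and markovian: "u \<in> F \<Longrightarrow>
           (\<lambda>x. min (max (u x) 0) 1) \<in> F \<and>
           E (\<lambda>x. min (max (u x) 0) 1) (\<lambda>x. min (max (u x) 0) 1) \<le> E u u"

definition regular_form ::
  "'a::topological_space measure \<Rightarrow> (('a \<Rightarrow> real) \<Rightarrow> ('a \<Rightarrow> real) \<Rightarrow> real) \<Rightarrow> ('a \<Rightarrow> real) set \<Rightarrow> bool" where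
  "regular_form M E F \<longleftrightarrow>
     (\<forall>u\<in>F. \<forall>e>0. \<exists>v\<in>F \<inter> Cc_space.
        form_plus_L2 M E (\<lambda>x. u x - v x) (\<lambda>x. u x - v x) < e) \<and>
     (\<forall>f\<in>Cc_space. \<forall>e>0. \<exists>v\<in>F \<inter> Cc_space. \<forall>x. \<bar>f x - v x\<bar> < e)"

definition strongly_local_form ::
  "'a::topological_space measure \<Rightarrow> (('a \<Rightarrow> real) \<Rightarrow> ('a \<Rightarrow> real) \<Rightarrow> real) \<Rightarrow> ('a \<Rightarrow> real) set \<Rightarrow> bool" where
  "strongly_local_form M E F \<longleftrightarrow>
     (\<forall>u\<in>F. \<forall>v\<in>F. compact (ess_support M u) \<longrightarrow> compact (ess_support M v) \<longrightarrow>
        (\<exists>U c. open U \<and> ess_support M v \<subseteq> U \<and> (AE x in M. x \<in> U \<longrightarrow> u x = c)) \<longrightarrow>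
        E u v = 0)"

text \<open>The heat semigroup of \<open>(E, F)\<close> is the strongly continuous contraction semigroup on \<open>L\<^sup>2\<close>
  whose generator is the operator \<open>L\<close> associated with the form:
  \<open>u\<close> is in the domain of \<open>L\<close> and \<open>L u = h\<close> iff \<open>u \<in> F\<close> and \<open>E u v = - \<langle>h, v\<rangle>\<close> for all \<open>v \<in> F\<close>.
  These properties determine it uniquely up to null sets.\<close>

definition form_generator ::
  "'a measure \<Rightarrow> (('a \<Rightarrow> real) \<Rightarrow> ('a \<Rightarrow> real) \<Rightarrow> real) \<Rightarrow> ('a \<Rightarrow> real) set \<Rightarrow>
   ('a \<Rightarrow> real) \<Rightarrow> ('a \<Rightarrow> real) \<Rightarrow> bool" where
  "form_generator M E F u h \<longleftrightarrow> u \<in> F \<and> (\<forall>v\<in>F. E u v = - L2_inner M h v)"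

locale heat_semigroup = dirichlet_form M E F
  for M :: "'a measure"
    and E :: "('a \<Rightarrow> real) \<Rightarrow> ('a \<Rightarrow> real) \<Rightarrow> real"
    and F :: "('a \<Rightarrow> real) set" +
  fixes P :: "real \<Rightarrow> ('a \<Rightarrow> real) \<Rightarrow> 'a \<Rightarrow> real"
  assumes semigroup_L2: "\<lbrakk>t > 0; f \<in> L2_space M\<rbrakk> \<Longrightarrow> P t f \<in> L2_space M"
    and semigroup_cong: "\<lbrakk>t > 0; f \<in> L2_space M; g \<in> L2_space M; AE x in M. f x = g x\<rbrakk> \<Longrightarrow>
           AE x in M. P t f x = P t g x"
    and semigroup_lincomb: "\<lbrakk>t > 0; f \<in> L2_space M; g \<in> L2_space M\<rbrakk> \<Longrightarrow>
           AE x in M. P t (\<lambda>y. a * f y + b * g y) x = a * P t f x + b * P t g x"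
    and semigroup_contraction: "\<lbrakk>t > 0; f \<in> L2_space M\<rbrakk> \<Longrightarrow> L2_norm M (P t f) \<le> L2_norm M f"
    and semigroup_comp: "\<lbrakk>s > 0; t > 0; f \<in> L2_space M\<rbrakk> \<Longrightarrow>
           AE x in M. P s (P t f) x = P (s + t) f x"
    and semigroup_strongly_continuous: "f \<in> L2_space M \<Longrightarrow>
           ((\<lambda>t. L2_norm M (\<lambda>x. P t f x - f x)) \<longlongrightarrow> 0) (at_right 0)"
    and semigroup_generator: "\<lbrakk>u \<in> L2_space M; h \<in> L2_space M\<rbrakk> \<Longrightarrow>
           ((\<lambda>t. L2_norm M (\<lambda>x. (P t u x - u x) / t - h x)) \<longlongrightarrow> 0) (at_right 0)
             \<longleftrightarrow> form_generator M E F u h"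

definition kernel_operator ::
  "'a measure \<Rightarrow> (real \<Rightarrow> 'a \<Rightarrow> 'a \<Rightarrow> real) \<Rightarrow> real \<Rightarrow> ('a \<Rightarrow> real) \<Rightarrow> 'a \<Rightarrow> real" where
  "kernel_operator M p t g x = (\<integral>y. p t x y * g y \<partial>M)"

definition heat_kernel ::
  "'a measure \<Rightarrow> (('a \<Rightarrow> real) \<Rightarrow> ('a \<Rightarrow> real) \<Rightarrow> real) \<Rightarrow> ('a \<Rightarrow> real) set \<Rightarrow>
   (real \<Rightarrow> 'a \<Rightarrow> 'a \<Rightarrow> real) \<Rightarrow> bool" where
  "heat_kernel M E F p \<longleftrightarrow>
     (\<exists>P. heat_semigroup M E F P \<and>
        (\<forall>t>0. \<forall>g\<in>L2_space M. AE x in M. P t g x = kernel_operator M p t g x))"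

section \<open>Sub-Gaussian Dirichlet spaces\<close>

definition sub_gaussian :: "real \<Rightarrow> real \<Rightarrow> real \<Rightarrow> real \<Rightarrow> real \<Rightarrow> real \<Rightarrow> real" where
  "sub_gaussian d_H d_W a b t \<delta> =
     a * t powr (- d_H / d_W) * exp (- b * (\<delta> powr d_W / t) powr (1 / (d_W - 1)))"

locale sub_gaussian_dirichlet_space = dirichlet_form M E F
  for M :: "'a::metric_space measure"
    and E :: "('a \<Rightarrow> real) \<Rightarrow> ('a \<Rightarrow> real) \<Rightarrow> real"
    and F :: "('a \<Rightarrow> real) set" +
  fixes p :: "real \<Rightarrow> 'a \<Rightarrow> 'a \<Rightarrow> real"
    and d_H d_W :: real
  assumes locally_compact: "locally_compact_space (euclidean :: 'a topology)"
    and radon: "radon_measure M"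
    and full_support: "measure_support M = UNIV"
    and compact_balls: "\<And>(x::'a) r. 0 < r \<Longrightarrow> compact (closure (ball x r))"
    and d_H_pos: "0 < d_H"
    and ahlfors_regular: "\<exists>c1>0. \<exists>c2>0. \<forall>x. \<forall>r\<ge>0.
           ennreal (c1 * r powr d_H) \<le> emeasure M (ball x r) \<and>
           emeasure M (ball x r) \<le> ennreal (c2 * r powr d_H)"
    and regular: "regular_form M E F"
    and strongly_local: "strongly_local_form M E F"
    and kernel: "heat_kernel M E F p"
    and kernel_continuous: "\<And>t. t > 0 \<Longrightarrow> continuous_on UNIV (\<lambda>(x, y). p t x y)"
    and d_W_gt_2: "2 < d_W"
    and kernel_bounds: "\<exists>c3>0. \<exists>c4>0. \<exists>c5>0. \<exists>c6>0.
           AE (x, y) in M \<Otimes>\<^sub>M M. \<forall>t>0.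
             sub_gaussian d_H d_W c5 c6 t (dist x y) \<le> p t x y \<and>
             p t x y \<le> sub_gaussian d_H d_W c3 c4 t (dist x y)"

text \<open>On \<open>L\<^sup>\<infinity>\<close> the semigroup acts, pointwise everywhere, through its kernel.\<close>

definition wBE ::
  "'a::metric_space measure \<Rightarrow> (real \<Rightarrow> 'a \<Rightarrow> 'a \<Rightarrow> real) \<Rightarrow> real \<Rightarrow> real \<Rightarrow> bool" where
  "wBE M p d_W \<kappa> \<longleftrightarrow> 0 < \<kappa> \<and> \<kappa> < d_W \<and>
     (\<exists>C>0. \<forall>t>0. \<forall>g\<in>Linf_space M. \<forall>x y.
        \<bar>kernel_operator M p t g x - kernel_operator M p t g y\<bar>
          \<le> C * (dist x y powr \<kappa> / t powr (\<kappa> / d_W)) * enn2real (Linf_norm M g))"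

section \<open>Korevaar-Schoen spaces, variation and heat Besov seminorms\<close>

definition Delta :: "real \<Rightarrow> ('a::metric_space \<times> 'a) set" where
  "Delta r = {(x, y). dist x y < r}"

definition KS_energy :: "'a::metric_space measure \<Rightarrow> real \<Rightarrow> ('a \<Rightarrow> real) \<Rightarrow> real \<Rightarrow> ennreal" where
  "KS_energy M \<sigma> f r =
     (\<integral>\<^sup>+x. \<integral>\<^sup>+y. ennreal (\<bar>f y - f x\<bar> / (r powr \<sigma> * measure M (ball x r)))
        * indicator (Delta r) (x, y) \<partial>M \<partial>M)"

definition KS_seminorm :: "'a::metric_space measure \<Rightarrow> real \<Rightarrow> ('a \<Rightarrow> real) \<Rightarrow> ennreal" where
  "KS_seminorm M \<sigma> f = Limsup (at_right 0) (KS_energy M \<sigma> f)"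

definition KS_space :: "'a::metric_space measure \<Rightarrow> real \<Rightarrow> ('a \<Rightarrow> real) set" where
  "KS_space M \<sigma> = {f \<in> L1_space M. KS_seminorm M \<sigma> f < \<infinity>}"

definition KS_sup_seminorm :: "'a::metric_space measure \<Rightarrow> real \<Rightarrow> ('a \<Rightarrow> real) \<Rightarrow> ennreal" where
  "KS_sup_seminorm M \<sigma> f = (SUP r\<in>{0<..}. KS_energy M \<sigma> f r)"

definition KS_sup_space :: "'a::metric_space measure \<Rightarrow> real \<Rightarrow> ('a \<Rightarrow> real) set" where
  "KS_sup_space M \<sigma> = {f \<in> L1_space M. KS_sup_seminorm M \<sigma> f < \<infinity>}"

definition lambda1_sharp :: "'a::metric_space measure \<Rightarrow> ereal" where
  "lambda1_sharp M =
     (SUP \<sigma>\<in>{\<sigma>. 0 < \<sigma> \<and> (\<exists>f\<in>KS_space M \<sigma>. \<not> (\<exists>c. AE x in M. f x = c))}. ereal \<sigma>)"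

text \<open>The next two definitions are meaningful when \<open>lambda1_sharp M\<close> is finite.\<close>

definition BV :: "'a::metric_space measure \<Rightarrow> ('a \<Rightarrow> real) set" where
  "BV M = KS_space M (real_of_ereal (lambda1_sharp M))"

definition Variation :: "'a::metric_space measure \<Rightarrow> ('a \<Rightarrow> real) \<Rightarrow> ennreal" where
  "Variation M f = Liminf (at_right 0) (KS_energy M (real_of_ereal (lambda1_sharp M)) f)"

definition averaged_difference ::
  "'a::metric_space measure \<Rightarrow> real \<Rightarrow> real \<Rightarrow> real \<Rightarrow> ('a \<Rightarrow> real) \<Rightarrow> 'a \<Rightarrow> ennreal" where
  "averaged_difference M d_W \<kappa> r f x =
     ennreal (1 / (r powr (d_W - \<kappa>) * measure M (ball x r)))
       * (\<integral>\<^sup>+y\<in>ball x r. ennreal \<bar>f x - f y\<bar> \<partial>M)"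

definition heat_besov_seminorm ::
  "'a measure \<Rightarrow> (real \<Rightarrow> 'a \<Rightarrow> 'a \<Rightarrow> real) \<Rightarrow> real \<Rightarrow> ('a \<Rightarrow> real) \<Rightarrow> ennreal" where
  "heat_besov_seminorm M p \<alpha> f =
     (SUP t\<in>{0<..}. ennreal (t powr (- \<alpha>)) *
        (\<integral>\<^sup>+y. \<integral>\<^sup>+x. ennreal (\<bar>f x - f y\<bar> * p t x y) \<partial>M \<partial>M))"

end

theory Submission
  imports Defs
begin

text \<open>
  Write \<open>KS(r)\<close> for the Korevaar-Schoen energy of \<open>f\<close> at scale \<open>r\<close> and exponent \<open>d\<^sub>W - \<kappa>\<close>,
  \<open>A = sup\<^sub>r KS(r)\<close> and \<open>B\<^sub>t = \<integral>\<integral> |f(x) - f(y)| p\<^sub>t(x,y)\<close>. The kernel bounds make \<open>A\<close> and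
  \<open>sup\<^sub>t t\<^bsup>-(1-\<kappa>/d_W)\<^esup> B\<^sub>t\<close> comparable, so the point is to bound \<open>A\<close> by the lower limit of \<open>KS\<close> at \<open>0\<close>.

  For \<open>h = 1\<^sub>U\<close>, symmetry and conservativeness give \<open>\<integral>\<integral> |h(x) - h(y)| p\<^sub>t = 2\<langle>h, h - P\<^sub>t h\<rangle>\<close>. With
  \<open>t = n\<tau>\<close> this telescopes into the terms \<open>2\<langle>P\<^sub>k\<^sub>\<tau> h, h - P\<^sub>\<tau> h\<rangle>\<close>, \<open>k < n\<close>; symmetrising each of them and
  applying the weak Bakry-Emery estimate to \<open>P\<^sub>k\<^sub>\<tau> h\<close> bounds their sum by the one for \<open>k = 0\<close> plus
  \<open>C t\<^bsup>1-\<kappa>/d_W\<^esup> \<tau>\<^bsup>-1\<^esup> \<integral>\<integral> d(x,y)\<^bsup>\<kappa>\<^esup> |h(x) - h(y)| p\<^sub>\<tau>(x,y)\<close>. Both sides are additive over superlevel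
  sets, so the coarea formula transfers the estimate to \<open>f\<close>. Taking \<open>\<tau>\<close> small compared with \<open>R\<^bsup>d_W\<^esup>\<close>,
  one gets \<open>KS(r) \<le> C KS(R) + A/2\<close> for all \<open>R\<close> much smaller than \<open>r\<close>; when \<open>A\<close> is finite the last
  term is absorbed.
\<close>

section \<open>Symmetry of the heat semigroup\<close>

text \<open>Indicators are forced by the weak Bakry-Emery estimate, which controls increments of P_s
  g only through the sup norm of g. For an indicator h this norm is at most 1 at every level, and
  (h(x) - h(y))^2 = |h(x) - h(y)| turns an identity for a quadratic form into one for L1
  differences. Cutting t into steps of length \<tau> pairs every P_{k\<tau>} h with the same
  increment h - P_\<tau> h, so only the kernel at the small time \<tau> survives. The estimate
  degenerates at k = 0, where the term is the energy at time \<tau> itself; the factors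
  (k\<tau>)^(-\<kappa>/d_W) of the others sum like an integral because \<kappa> < d_W. The form is
  linked to the semigroup only through the generator, so symmetry of P_t has to be carried from
  infinitesimal to finite times, and continuity then passes it to the kernel. With \<tau> = (\<eta>
  R)^d_W there are two error terms: the energy at \<tau>, of relative size (R/r)^(d_W - \<kappa>),
  and the pairs at distance at least R, of relative size \<eta>. Each is made at most A/4.
  Finiteness of A for f in BV comes from the upper limit at small scales and from the L1 norm at
  large ones.\<close>

lemma nonneg_quadratic_discriminant:
  fixes a b c :: real
  assumes nn: "\<And>s. 0 \<le> a + 2 * s * b + s\<^sup>2 * c" and c0: "0 \<le> c"
  shows "b\<^sup>2 \<le> a * c"
proof (cases "c = 0")
  case True
  have "b = 0"
  proof (rule ccontr)
    assume "b \<noteq> 0"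
    \<comment> \<open>With c = 0 the quadratic is affine in s, and this s gives it the value
      -1.\<close>
    then have "a + 2 * (- (a + 1) / (2 * b)) * b = - 1" by (simp add: field_simps)
    with nn[of "- (a + 1) / (2 * b)"] True show False by simp
  qed
  with True show ?thesis by simp
next
  case False
  with c0 have "0 < c" by simp
  \<comment> \<open>The minimiser of the quadratic in s.\<close>
  have "0 \<le> a + 2 * (- b / c) * b + (- b / c)\<^sup>2 * c" by (rule nn)
  also have "\<dots> = a - b\<^sup>2 / c" using False by (simp add: field_simps power2_eq_square)
  finally show ?thesis using \<open>0 < c\<close> by (simp add: field_simps)
qed

section \<open>The inner product of L2\<close>

lemma L2_mult_integrable:
  assumes "f \<in> L2_space M" "g \<in> L2_space M"
  shows "integrable M (\<lambda>x. f x * g x)"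
proof (rule Bochner_Integration.integrable_bound)
  show "integrable M (\<lambda>x. (f x)\<^sup>2 + (g x)\<^sup>2)"
    using assms by (simp add: L2_space_def)
  show "(\<lambda>x. f x * g x) \<in> borel_measurable M"
    using assms by (auto simp: L2_space_def)
  have "\<bar>f x * g x\<bar> \<le> (f x)\<^sup>2 + (g x)\<^sup>2" for x
  proof -
    have "0 \<le> (\<bar>f x\<bar> - \<bar>g x\<bar>)\<^sup>2" by simp
    then have "2 * (\<bar>f x\<bar> * \<bar>g x\<bar>) \<le> (f x)\<^sup>2 + (g x)\<^sup>2"
      by (simp add: power2_diff)
    moreover have "0 \<le> \<bar>f x\<bar> * \<bar>g x\<bar>" by simp
    ultimately show ?thesis unfolding abs_mult by linarith
  qed
  then show "AE x in M. norm (f x * g x) \<le> norm ((f x)\<^sup>2 + (g x)\<^sup>2)"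
    by (intro AE_I2) simp
qed

lemma L2_lincomb:
  assumes "f \<in> L2_space M" "g \<in> L2_space M"
  shows "(\<lambda>x. a * f x + b * g x) \<in> L2_space M"
proof -
  have *: "(a * f x + b * g x)\<^sup>2 = a\<^sup>2 * (f x)\<^sup>2 + (2 * a * b) * (f x * g x) + b\<^sup>2 * (g x)\<^sup>2" for x
    by (simp add: power2_eq_square algebra_simps)
  have "integrable M (\<lambda>x. (a * f x + b * g x)\<^sup>2)"
    unfolding * using assms L2_mult_integrable[OF assms] by (auto simp: L2_space_def)
  then show ?thesis using assms by (auto simp: L2_space_def)
qed

lemma L2_diff: "f \<in> L2_space M \<Longrightarrow> g \<in> L2_space M \<Longrightarrow> (\<lambda>x. f x - g x) \<in> L2_space M"
  using L2_lincomb[of f M g 1 "-1"] by simp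

lemma L2_scale: "f \<in> L2_space M \<Longrightarrow> (\<lambda>x. c * f x) \<in> L2_space M"
  using L2_lincomb[of f M f c 0] by simp

lemma L2_inner_commute: "L2_inner M f g = L2_inner M g f"
  by (simp add: L2_inner_def mult.commute)

lemma L2_inner_lincomb:
  assumes "f \<in> L2_space M" "g \<in> L2_space M" "h \<in> L2_space M"
  shows "L2_inner M (\<lambda>x. a * f x + b * g x) h = a * L2_inner M f h + b * L2_inner M g h"
proof -
  have *: "(a * f x + b * g x) * h x = a * (f x * h x) + b * (g x * h x)" for x
    by (simp add: algebra_simps)
  show ?thesis
    unfolding L2_inner_def * using assms by (simp add: L2_mult_integrable)
qed

lemma L2_inner_diff:
  assumes "f \<in> L2_space M" "g \<in> L2_space M" "h \<in> L2_space M"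
  shows "L2_inner M (\<lambda>x. f x - g x) h = L2_inner M f h - L2_inner M g h"
  using L2_inner_lincomb[OF assms, of 1 "-1"] by simp

lemma L2_inner_diff_right:
  assumes "f \<in> L2_space M" "g \<in> L2_space M" "h \<in> L2_space M"
  shows "L2_inner M h (\<lambda>x. f x - g x) = L2_inner M h f - L2_inner M h g"
  using L2_inner_diff[OF assms] by (simp add: L2_inner_commute)

lemma L2_inner_scale: "L2_inner M (\<lambda>x. c * f x) h = c * L2_inner M f h"
  by (simp add: L2_inner_def mult.assoc)

lemma L2_inner_scale_right: "L2_inner M h (\<lambda>x. c * f x) = c * L2_inner M h f"
  by (simp add: L2_inner_def mult.left_commute)

lemma L2_inner_cong_AE:
  assumes "f \<in> borel_measurable M" "f' \<in> borel_measurable M"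
    "g \<in> borel_measurable M" "g' \<in> borel_measurable M"
    "AE x in M. f x = f' x" "AE x in M. g x = g' x"
  shows "L2_inner M f g = L2_inner M f' g'"
  unfolding L2_inner_def using assms by (intro integral_cong_AE) auto

lemma L2_inner_self_nonneg: "0 \<le> L2_inner M f f"
  by (simp add: L2_inner_def)

lemma L2_norm_nonneg: "0 \<le> L2_norm M f"
  by (simp add: L2_norm_def L2_inner_self_nonneg)

lemma L2_norm_cong_AE:
  assumes "f \<in> borel_measurable M" "f' \<in> borel_measurable M" "AE x in M. f x = f' x"
  shows "L2_norm M f = L2_norm M f'"
  unfolding L2_norm_def using assms by (auto intro!: arg_cong[of _ _ sqrt] L2_inner_cong_AE)

lemma L2_norm_scale: "L2_norm M (\<lambda>x. c * f x) = \<bar>c\<bar> * L2_norm M f"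
  by (simp add: L2_norm_def L2_inner_scale L2_inner_scale_right real_sqrt_mult flip: mult.assoc)

lemma L2_measurable: "f \<in> L2_space M \<Longrightarrow> f \<in> borel_measurable M"
  by (simp add: L2_space_def)

lemma L2_Cauchy_Schwarz:
  assumes f: "f \<in> L2_space M" and g: "g \<in> L2_space M"
  shows "\<bar>L2_inner M f g\<bar> \<le> L2_norm M f * L2_norm M g"
proof -
  have "0 \<le> L2_inner M f f + 2 * s * L2_inner M f g + s\<^sup>2 * L2_inner M g g" for s
  proof -
    let ?w = "\<lambda>x. 1 * f x + s * g x"
    have w: "?w \<in> L2_space M" by (intro L2_lincomb f g)
    have "L2_inner M ?w ?w = L2_inner M f ?w + s * L2_inner M g ?w"
      using L2_inner_lincomb[OF f g w, of 1 s] by simp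
    also have "L2_inner M f ?w = L2_inner M f f + s * L2_inner M f g"
      using L2_inner_lincomb[OF f g f, of 1 s] by (simp add: L2_inner_commute)
    also have "L2_inner M g ?w = L2_inner M f g + s * L2_inner M g g"
      using L2_inner_lincomb[OF f g g, of 1 s] by (simp add: L2_inner_commute)
    finally show ?thesis
      using L2_inner_self_nonneg[of M ?w] by (simp add: power2_eq_square algebra_simps)
  qed
  from nonneg_quadratic_discriminant[OF this L2_inner_self_nonneg]
  have "\<bar>L2_inner M f g\<bar> \<le> sqrt (L2_inner M f f * L2_inner M g g)"
    by (metis real_sqrt_abs real_sqrt_le_mono)
  then show ?thesis by (simp add: L2_norm_def real_sqrt_mult)
qed

section \<open>The form domain as a Hilbert space, and the resolvent at 1\<close>

context dirichlet_form
begin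

lemma form_L2: "u \<in> F \<Longrightarrow> u \<in> L2_space M"
  using domain_L2 by blast

lemma form_plus_lincomb:
  assumes "u \<in> F" "v \<in> F" "w \<in> F"
  shows "form_plus_L2 M E (\<lambda>x. a * u x + b * v x) w =
     a * form_plus_L2 M E u w + b * form_plus_L2 M E v w"
  using assms by (simp add: form_plus_L2_def form_lincomb L2_inner_lincomb form_L2 algebra_simps)

lemma form_plus_sym: "u \<in> F \<Longrightarrow> v \<in> F \<Longrightarrow> form_plus_L2 M E u v = form_plus_L2 M E v u"
  by (simp add: form_plus_L2_def form_sym L2_inner_commute)

lemma form_plus_nonneg: "u \<in> F \<Longrightarrow> 0 \<le> form_plus_L2 M E u u"
  by (simp add: form_plus_L2_def form_nonneg L2_inner_self_nonneg)

lemma form_plus_expand: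
  assumes "u \<in> F" "v \<in> F"
  shows "form_plus_L2 M E (\<lambda>x. a * u x + b * v x) (\<lambda>x. a * u x + b * v x) =
     a\<^sup>2 * form_plus_L2 M E u u + 2 * a * b * form_plus_L2 M E u v + b\<^sup>2 * form_plus_L2 M E v v"
  using assms
  by (simp add: form_plus_lincomb domain_lincomb form_plus_sym[of _ "\<lambda>x. a * u x + b * v x"]
      form_plus_sym[of v u] power2_eq_square algebra_simps)

lemma form_plus_Cauchy_Schwarz:
  assumes "u \<in> F" "v \<in> F"
  shows "(form_plus_L2 M E u v)\<^sup>2 \<le> form_plus_L2 M E u u * form_plus_L2 M E v v"
proof (rule nonneg_quadratic_discriminant)
  fix s
  show "0 \<le> form_plus_L2 M E u u + 2 * s * form_plus_L2 M E u v + s\<^sup>2 * form_plus_L2 M E v v"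
    using form_plus_expand[OF assms, of 1 s]
      form_plus_nonneg[OF domain_lincomb[OF assms, of 1 s]] by simp
qed (rule form_plus_nonneg[OF assms(2)])

text \<open>The resolvent at \<open>1\<close> is onto: \<open>u - L u = f\<close> is solved by minimising
  \<open>E\<^sub>1(u,u) - 2\<langle>f,u\<rangle>\<close> over the form domain.\<close>

lemma resolvent_exists:
  assumes f: "f \<in> L2_space M"
  obtains u where "form_generator M E F u (\<lambda>x. u x - f x)"
proof -
  let ?E = "form_plus_L2 M E"
  define J where "J u = ?E u u - 2 * L2_inner M f u" for u
  \<comment> \<open>Completing the square: J u plus the squared norm of f is E u u plus the squared
    norm of u - f.\<close>
  have J_lb: "- L2_inner M f f \<le> J u" if u: "u \<in> F" for u
  proof -
    have "L2_inner M (\<lambda>x. u x - f x) (\<lambda>x. u x - f x) = L2_inner M u u - 2 * L2_inner M f u + L2_inner M f f"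
      using form_L2[OF u] f
      by (simp add: L2_inner_diff L2_inner_diff_right L2_diff L2_inner_commute[of M u f])
    then show ?thesis
      using L2_inner_self_nonneg[of M "\<lambda>x. u x - f x"] form_nonneg[OF u]
      by (simp add: J_def form_plus_L2_def)
  qed
  define m where "m = Inf (J ` F)"
  have bdd: "bdd_below (J ` F)" using J_lb by (auto intro!: bdd_belowI)
  have m_le: "m \<le> J u" if "u \<in> F" for u
    unfolding m_def using that bdd by (auto intro!: cInf_lower)
  have "\<exists>u\<in>F. J u < m + 1 / real (Suc n)" for n
  proof -
    have "Inf (J ` F) < m + 1 / real (Suc n)" by (simp add: m_def)
    then show ?thesis
      using cInf_lessD[of "J ` F"] domain_zero by blast
  qed
  then obtain U where U: "\<And>n. U n \<in> F" and JU: "\<And>n. J (U n) < m + 1 / real (Suc n)"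
    by metis
  have J_expand: "J (\<lambda>x. 1 * u x + s * v x) = J u + 2 * s * (?E u v - L2_inner M f v) + s\<^sup>2 * ?E v v"
    if u: "u \<in> F" and v: "v \<in> F" for u v s
    using form_plus_expand[OF u v, of 1 s]
      L2_inner_lincomb[OF form_L2[OF u] form_L2[OF v] f, of 1 s]
    by (simp add: J_def L2_inner_commute[of M f] algebra_simps)
  \<comment> \<open>The first variation of J at a near-minimiser is small: s \<mapsto> J (U n + s v)
    - m is a non-negative quadratic with constant term below 1/(n+1), so its discriminant bounds the
    linear coefficient.\<close>
  have near: "(?E (U n) v - L2_inner M f v)\<^sup>2 \<le> 1 / real (Suc n) * ?E v v" if v: "v \<in> F" for n v
  proof -
    have "(?E (U n) v - L2_inner M f v)\<^sup>2 \<le> (J (U n) - m) * ?E v v"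
    proof (rule nonneg_quadratic_discriminant)
      fix s
      show "0 \<le> J (U n) - m + 2 * s * (?E (U n) v - L2_inner M f v) + s\<^sup>2 * ?E v v"
        using J_expand[OF U v, of n s] m_le[OF domain_lincomb[OF U v, of 1 n s]] by simp
    qed (rule form_plus_nonneg[OF v])
    also have "\<dots> \<le> 1 / real (Suc n) * ?E v v"
      using JU[of n] form_plus_nonneg[OF v] by (intro mult_right_mono) auto
    finally show ?thesis .
  qed
  \<comment> \<open>Parallelogram identity: the linear part of J cancels between the two points and
    their midpoint, and J at the midpoint is at least m.\<close>
  have Cauchy_bound: "?E (\<lambda>x. U a x - U b x) (\<lambda>x. U a x - U b x) \<le> 2 / real (Suc a) + 2 / real (Suc b)" for a b
  proof -
    let ?d = "\<lambda>x. 1 * U a x + (-1) * U b x"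
    let ?s = "\<lambda>x. (1/2) * U a x + (1/2) * U b x"
    have "J ?s = ?E ?s ?s - 2 * L2_inner M ?s f" by (simp add: J_def L2_inner_commute)
    also have "\<dots> = (1/4) * ?E (U a) (U a) + (1/2) * ?E (U a) (U b) + (1/4) * ?E (U b) (U b)
        - L2_inner M (U a) f - L2_inner M (U b) f"
      using form_plus_expand[OF U U, of "1/2" a "1/2" b]
        L2_inner_lincomb[OF form_L2[OF U] form_L2[OF U] f, of "1/2" a "1/2" b]
      by (simp add: power2_eq_square)
    finally have "?E ?d ?d = 2 * J (U a) + 2 * J (U b) - 4 * J ?s"
      using form_plus_expand[OF U U, of 1 a "-1" b]
      by (simp add: J_def L2_inner_commute[of M f])
    moreover have "m \<le> J ?s" by (rule m_le[OF domain_lincomb[OF U U]])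
    ultimately have "?E ?d ?d \<le> 2 / real (Suc a) + 2 / real (Suc b)"
      using JU[of a] JU[of b] by simp
    then show ?thesis by simp
  qed
  have "\<exists>u\<in>F. (\<lambda>n. ?E (\<lambda>x. U n x - u x) (\<lambda>x. U n x - u x)) \<longlonglongrightarrow> 0"
  proof (rule closed[OF U])
    fix e :: real assume e: "0 < e"
    obtain N where N: "4 / e < real N" using reals_Archimedean2 by blast
    show "\<exists>N. \<forall>m\<ge>N. \<forall>n\<ge>N. ?E (\<lambda>x. U m x - U n x) (\<lambda>x. U m x - U n x) < e"
    proof (intro exI allI impI)
      fix a b assume ab: "N \<le> a" "N \<le> b"
      have 1: "2 / real (Suc k) < e / 2" if "N \<le> k" for k
      proof -
        have "4 / e < real (Suc k)" using N that by simp
        then show ?thesis using e by (simp add: field_simps)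
      qed
      show "?E (\<lambda>x. U a x - U b x) (\<lambda>x. U a x - U b x) < e"
        using Cauchy_bound[of a b] 1[OF ab(1)] 1[OF ab(2)] by linarith
    qed
  qed
  then obtain u where u: "u \<in> F" and lim: "(\<lambda>n. ?E (\<lambda>x. U n x - u x) (\<lambda>x. U n x - u x)) \<longlonglongrightarrow> 0"
    by blast
  \<comment> \<open>Two limits of \<open>?E (U n) v\<close> are compared: one from convergence of U
    n in form norm, the other from the vanishing first variation.\<close>
  have eq: "?E u v = L2_inner M f v" if v: "v \<in> F" for v
  proof -
    have "(\<lambda>n. (?E (U n) v - ?E u v)\<^sup>2) \<longlonglongrightarrow> 0"
    proof (rule tendsto_sandwich[OF _ _ tendsto_const])
      show "(\<lambda>n. ?E (\<lambda>x. U n x - u x) (\<lambda>x. U n x - u x) * ?E v v) \<longlonglongrightarrow> 0"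
        using tendsto_mult_right[OF lim, of "?E v v"] by simp
      have "(?E (U n) v - ?E u v)\<^sup>2 \<le> ?E (\<lambda>x. U n x - u x) (\<lambda>x. U n x - u x) * ?E v v" for n
        using form_plus_Cauchy_Schwarz[OF domain_lincomb[OF U[of n] u, of 1 "-1"] v]
          form_plus_lincomb[OF U[of n] u v, of 1 "-1"] by simp
      then show "eventually (\<lambda>n. (?E (U n) v - ?E u v)\<^sup>2 \<le>
          ?E (\<lambda>x. U n x - u x) (\<lambda>x. U n x - u x) * ?E v v) sequentially" by simp
    qed simp
    then have "(\<lambda>n. sqrt ((?E (U n) v - ?E u v)\<^sup>2)) \<longlonglongrightarrow> sqrt 0" by (rule tendsto_real_sqrt)
    then have l1: "(\<lambda>n. ?E (U n) v) \<longlonglongrightarrow> ?E u v"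
      by (simp add: LIM_zero_iff tendsto_rabs_zero_iff)
    have "(\<lambda>n. (?E (U n) v - L2_inner M f v)\<^sup>2) \<longlonglongrightarrow> 0"
    proof (rule tendsto_sandwich[OF _ _ tendsto_const])
      show "(\<lambda>n. 1 / real (Suc n) * ?E v v) \<longlonglongrightarrow> 0"
        using tendsto_mult_right[OF LIMSEQ_inverse_real_of_nat, of "?E v v"]
        by (simp add: inverse_eq_divide)
      show "eventually (\<lambda>n. (?E (U n) v - L2_inner M f v)\<^sup>2 \<le> 1 / real (Suc n) * ?E v v) sequentially"
        using near[OF v] by simp
    qed simp
    then have "(\<lambda>n. sqrt ((?E (U n) v - L2_inner M f v)\<^sup>2)) \<longlonglongrightarrow> sqrt 0" by (rule tendsto_real_sqrt)
    then have l2: "(\<lambda>n. ?E (U n) v) \<longlonglongrightarrow> L2_inner M f v"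
      by (simp add: LIM_zero_iff tendsto_rabs_zero_iff)
    show ?thesis by (rule LIMSEQ_unique[OF l1 l2])
  qed
  have "form_generator M E F u (\<lambda>x. u x - f x)"
    unfolding form_generator_def
  proof (intro conjI ballI u)
    fix v assume v: "v \<in> F"
    show "E u v = - L2_inner M (\<lambda>x. u x - f x) v"
      using eq[OF v] L2_inner_diff[OF form_L2[OF u] f form_L2[OF v]]
      by (simp add: form_plus_L2_def)
  qed
  then show ?thesis by (rule that)
qed

end

section \<open>From a symmetric generator to a symmetric semigroup\<close>

context heat_semigroup
begin

text \<open>\<open>P 0\<close> is unconstrained in the locale, so the semigroup is extended by the identity.\<close>

definition S where "S t f = (if t = 0 then f else P t f)"

lemma S_0 [simp]: "S 0 f = f" by (simp add: S_def)

lemma S_pos: "t > 0 \<Longrightarrow> S t f = P t f" by (simp add: S_def)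

lemma S_L2: "0 \<le> t \<Longrightarrow> f \<in> L2_space M \<Longrightarrow> S t f \<in> L2_space M"
  by (simp add: S_def semigroup_L2)

lemma S_lincomb: "0 \<le> t \<Longrightarrow> f \<in> L2_space M \<Longrightarrow> g \<in> L2_space M \<Longrightarrow>
    AE x in M. S t (\<lambda>y. a * f y + b * g y) x = a * S t f x + b * S t g x"
  by (simp add: S_def semigroup_lincomb)

lemma S_contraction: "0 \<le> t \<Longrightarrow> f \<in> L2_space M \<Longrightarrow> L2_norm M (S t f) \<le> L2_norm M f"
  by (simp add: S_def semigroup_contraction)

lemma S_comp: "0 \<le> s \<Longrightarrow> 0 \<le> t \<Longrightarrow> f \<in> L2_space M \<Longrightarrow> AE x in M. S s (S t f) x = S (s + t) f x"
  using semigroup_comp[of s t f] by (cases "s = 0"; cases "t = 0") (auto simp: S_def)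

text \<open>\<open>remainder h u k\<close> is \<open>o(h)\<close> in \<open>L\<^sup>2\<close> exactly when \<open>k = L u\<close>.\<close>

definition remainder where "remainder h u k = (\<lambda>x. S h u x - u x - h * k x)"

lemma remainder_L2: "0 \<le> h \<Longrightarrow> u \<in> L2_space M \<Longrightarrow> k \<in> L2_space M \<Longrightarrow> remainder h u k \<in> L2_space M"
  unfolding remainder_def by (intro L2_diff S_L2 L2_scale)

lemma remainder_S:
  assumes "0 \<le> h" "0 \<le> s" "u \<in> L2_space M" "k \<in> L2_space M"
  shows "AE x in M. remainder h (S s u) (S s k) x = S s (remainder h u k) x"
proof -
  have 1: "AE x in M. S h (S s u) x = S (s + h) u x"
    using S_comp[OF assms(1,2,3)] by (simp add: add.commute)
  have 2: "AE x in M. S s (S h u) x = S (s + h) u x"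
    by (rule S_comp[OF assms(2,1,3)])
  have 3: "AE x in M. S s (\<lambda>y. 1 * S h u y + (-1) * u y) x = 1 * S s (S h u) x + (-1) * S s u x"
    by (intro S_lincomb S_L2 assms)
  have 4: "AE x in M. S s (\<lambda>y. 1 * (1 * S h u y + (-1) * u y) + (-h) * k y) x
      = 1 * S s (\<lambda>y. 1 * S h u y + (-1) * u y) x + (-h) * S s k x"
    by (intro S_lincomb S_L2 assms L2_lincomb)
  show ?thesis
    using 1 2 3 4
  proof eventually_elim
    case (elim x)
    then show ?case by (simp add: remainder_def)
  qed
qed

text \<open>The gain is uniformity in s: S s commutes with forming the remainder and contracts, so a
  single o(h) rate for u serves its whole orbit.\<close>

lemma L2_norm_remainder_S:
  assumes "0 \<le> h" "0 \<le> s" "u \<in> L2_space M" "k \<in> L2_space M"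
  shows "L2_norm M (remainder h (S s u) (S s k)) \<le> L2_norm M (remainder h u k)"
proof -
  have "L2_norm M (remainder h (S s u) (S s k)) = L2_norm M (S s (remainder h u k))"
    using remainder_S[OF assms] assms
    by (intro L2_norm_cong_AE L2_measurable remainder_L2 S_L2)
  also have "\<dots> \<le> L2_norm M (remainder h u k)"
    by (intro S_contraction remainder_L2 assms)
  finally show ?thesis .
qed

lemma quotient_eq_remainder:
  assumes "0 < h"
  shows "L2_norm M (\<lambda>x. (P h u x - u x) / h - k x) = L2_norm M (remainder h u k) / h"
proof -
  have "(\<lambda>x. (P h u x - u x) / h - k x) = (\<lambda>x. (1 / h) * remainder h u k x)"
    using assms by (auto simp: remainder_def S_pos field_simps)
  then show ?thesis using assms by (simp only: L2_norm_scale) simp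
qed

lemma generator_iff_remainder:
  assumes "u \<in> L2_space M" "k \<in> L2_space M"
  shows "form_generator M E F u k \<longleftrightarrow> ((\<lambda>h. L2_norm M (remainder h u k) / h) \<longlongrightarrow> 0) (at_right 0)"
proof -
  have "eventually (\<lambda>h. L2_norm M (\<lambda>x. (P h u x - u x) / h - k x) = L2_norm M (remainder h u k) / h)
      (at_right (0::real))"
    using eventually_at_right_less[of "0::real"] by eventually_elim (rule quotient_eq_remainder)
  then show ?thesis
    using semigroup_generator[OF assms] by (simp cong: tendsto_cong)
qed

lemma generator_L2: "form_generator M E F u k \<Longrightarrow> u \<in> L2_space M"
  by (auto simp: form_generator_def form_L2)

text \<open>The orbit of u stays in the domain of the generator, since its remainder is dominated by
  that of u and is o(h) as well.\<close>

lemma generator_S: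
  assumes g: "form_generator M E F u k" and k: "k \<in> L2_space M" and s: "0 \<le> s"
  shows "form_generator M E F (S s u) (S s k)"
proof -
  have u: "u \<in> L2_space M" by (rule generator_L2[OF g])
  have "((\<lambda>h. L2_norm M (remainder h u k) / h) \<longlongrightarrow> 0) (at_right 0)"
    using g generator_iff_remainder[OF u k] by simp
  then have "((\<lambda>h. L2_norm M (remainder h (S s u) (S s k)) / h) \<longlongrightarrow> 0) (at_right 0)"
  proof (rule tendsto_sandwich[OF _ _ tendsto_const, rotated 2])
    show "eventually (\<lambda>h. 0 \<le> L2_norm M (remainder h (S s u) (S s k)) / h) (at_right 0)"
      using eventually_at_right_less[of "0::real"] by eventually_elim (simp add: L2_norm_nonneg)
    show "eventually (\<lambda>h. L2_norm M (remainder h (S s u) (S s k)) / h \<le> L2_norm M (remainder h u k) / h) (at_right 0)"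
      using eventually_at_right_less[of "0::real"]
      by eventually_elim (simp add: divide_right_mono L2_norm_remainder_S s u k)
  qed
  then show ?thesis using generator_iff_remainder S_L2 s u k by simp
qed

lemma generator_sym:
  assumes "form_generator M E F u k" "form_generator M E F v l"
  shows "L2_inner M k v = L2_inner M u l"
  using assms form_sym[of u v] by (auto simp: form_generator_def L2_inner_commute)

text \<open>One step of length h moves from the left factor to the right one at the price of
  remainders only: the first-order terms h \<langle>k, v\<rangle> and h \<langle>u, l\<rangle> agree
  because E is symmetric.\<close>

lemma generator_step:
  assumes g: "form_generator M E F u k" "form_generator M E F v l"
    and k: "k \<in> L2_space M" and l: "l \<in> L2_space M" and h: "0 \<le> h"
  shows "\<bar>L2_inner M (S h u) v - L2_inner M u (S h v)\<bar> \<le>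
     L2_norm M (remainder h u k) * L2_norm M v + L2_norm M u * L2_norm M (remainder h v l)"
proof -
  have u: "u \<in> L2_space M" and v: "v \<in> L2_space M" using generator_L2 g by auto
  have "L2_inner M (remainder h u k) v = L2_inner M (S h u) v - L2_inner M u v - h * L2_inner M k v"
    unfolding remainder_def using u v k h
    by (simp add: L2_inner_diff L2_diff S_L2 L2_scale L2_inner_scale)
  moreover have "L2_inner M u (remainder h v l) = L2_inner M u (S h v) - L2_inner M u v - h * L2_inner M u l"
    unfolding remainder_def using u v l h
    by (simp add: L2_inner_diff_right L2_diff S_L2 L2_scale L2_inner_scale_right)
  ultimately have "L2_inner M (S h u) v - L2_inner M u (S h v) =
     L2_inner M (remainder h u k) v - L2_inner M u (remainder h v l)"
    using generator_sym[OF g] by simp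
  then show ?thesis
    using L2_Cauchy_Schwarz[OF remainder_L2[OF h u k] v]
      L2_Cauchy_Schwarz[OF u remainder_L2[OF h v l]] by linarith
qed

text \<open>The time t is carried from left to right in n + 1 steps of length h = t/(n+1). Each
  costs h \<epsilon>(h), with the same \<epsilon> along both orbits, so the total error t
  \<epsilon>(h) vanishes as n grows.\<close>

lemma S_sym_generators:
  assumes g: "form_generator M E F u k" "form_generator M E F v l"
    and k: "k \<in> L2_space M" and l: "l \<in> L2_space M" and t: "0 < t"
  shows "L2_inner M (S t u) v = L2_inner M u (S t v)"
proof -
  have u: "u \<in> L2_space M" and v: "v \<in> L2_space M" using generator_L2 g by auto
  define \<epsilon> where "\<epsilon> h = L2_norm M (remainder h u k) / h * L2_norm M v +
      L2_norm M u * (L2_norm M (remainder h v l) / h)" for h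
  have bound: "\<bar>L2_inner M (S t u) v - L2_inner M u (S t v)\<bar> \<le> t * \<epsilon> (t / Suc n)" for n
  proof -
    define h where "h = t / Suc n"
    have h: "0 < h" and nh: "real (Suc n) * h = t" using t by (auto simp: h_def)
    \<comment> \<open>After j steps the right factor has evolved for time j h and the left one for
      the rest of t; \<open>a 0\<close> and \<open>a (Suc n)\<close> are the two sides to be
      compared.\<close>
    define a where "a j = L2_inner M (S (real (Suc n - j) * h) u) (S (real j * h) v)" for j
    have step: "\<bar>a j - a (Suc j)\<bar> \<le> h * \<epsilon> h" if j: "j \<le> n" for j
    proof -
      define r where "r = real (n - j) * h"
      define q where "q = real j * h"
      have r: "0 \<le> r" and q: "0 \<le> q" using h by (auto simp: r_def q_def)
      have rh: "real (Suc n - j) * h = h + r" using j by (simp add: r_def Suc_diff_le algebra_simps)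
      have qh: "real (Suc j) * h = h + q" by (simp add: q_def algebra_simps)
      have "a j = L2_inner M (S h (S r u)) (S q v)"
        unfolding a_def rh q_def[symmetric] using S_comp[of h r u] h r q u v
        by (intro L2_inner_cong_AE L2_measurable S_L2) auto
      moreover have "a (Suc j) = L2_inner M (S r u) (S h (S q v))"
        unfolding a_def qh diff_Suc_Suc r_def[symmetric] using S_comp[of h q v] h r q u v
        by (intro L2_inner_cong_AE L2_measurable S_L2) auto
      ultimately have "\<bar>a j - a (Suc j)\<bar> \<le>
          L2_norm M (remainder h (S r u) (S r k)) * L2_norm M (S q v) +
          L2_norm M (S r u) * L2_norm M (remainder h (S q v) (S q l))"
        using generator_step[OF generator_S[OF g(1) k r] generator_S[OF g(2) l q]
            S_L2[OF r k] S_L2[OF q l], of h] h by simp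
      also have "\<dots> \<le> L2_norm M (remainder h u k) * L2_norm M v + L2_norm M u * L2_norm M (remainder h v l)"
        using h r q u v k l
        by (intro add_mono mult_mono L2_norm_remainder_S S_contraction L2_norm_nonneg) auto
      also have "\<dots> = h * \<epsilon> h" using h by (simp add: \<epsilon>_def algebra_simps)
      finally show ?thesis .
    qed
    have "\<bar>a 0 - a j\<bar> \<le> real j * (h * \<epsilon> h)" if "j \<le> Suc n" for j
      using that
    proof (induction j)
      case (Suc j)
      then show ?case using step[of j] by (simp add: algebra_simps)
    qed simp
    from this[of "Suc n"] have "\<bar>a 0 - a (Suc n)\<bar> \<le> t * \<epsilon> h"
      using nh by (metis le_refl mult.assoc)
    moreover have "a 0 = L2_inner M (S t u) v" "a (Suc n) = L2_inner M u (S t v)"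
      using nh by (simp_all add: a_def)
    ultimately show ?thesis by (simp add: h_def)
  qed
  have "(\<epsilon> \<longlongrightarrow> 0 * L2_norm M v + L2_norm M u * 0) (at_right 0)"
    unfolding \<epsilon>_def
    using g generator_iff_remainder[OF u k] generator_iff_remainder[OF v l]
    by (intro tendsto_intros) auto
  moreover have "filterlim (\<lambda>n. t / Suc n) (at_right 0) sequentially"
    unfolding filterlim_at
  proof (intro conjI eventuallyI)
    show "(\<lambda>n. t / Suc n) \<longlonglongrightarrow> 0"
      using tendsto_mult_right[OF LIMSEQ_inverse_real_of_nat, of t] by (simp add: field_simps)
  qed (use t in auto)
  ultimately have "(\<lambda>n. t * \<epsilon> (t / Suc n)) \<longlonglongrightarrow> t * 0"
    by (intro tendsto_mult_left) (auto intro: filterlim_compose)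
  then have "\<bar>L2_inner M (S t u) v - L2_inner M u (S t v)\<bar> \<le> t * 0"
    by (rule LIMSEQ_le_const) (use bound in auto)
  then show ?thesis by simp
qed

text \<open>Symmetry passes from the domain of the generator to its range: k is the L2 limit of (S h
  u - u)/h, whose numerator is a difference of elements of the domain.\<close>

lemma S_sym_extend:
  assumes g: "form_generator M E F u k" and k: "k \<in> L2_space M" and w: "w \<in> L2_space M"
    and t: "0 < t"
    and sym: "\<And>u k. form_generator M E F u k \<Longrightarrow> k \<in> L2_space M \<Longrightarrow>
       L2_inner M (S t u) w = L2_inner M u (S t w)"
  shows "L2_inner M (S t k) w = L2_inner M k (S t w)"
proof -
  have u: "u \<in> L2_space M" by (rule generator_L2[OF g])
  have bound: "\<bar>L2_inner M (S t k) w - L2_inner M k (S t w)\<bar> \<le>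
      2 * (L2_norm M (remainder h u k) / h) * L2_norm M w" if h: "0 < h" for h
  proof -
    have hn: "0 \<le> h" "0 \<le> t" using h t by auto
    \<comment> \<open>S h u is again in the domain, with image S h k, so the hypothesis applies to
      it as well as to u.\<close>
    have eq: "L2_inner M (S t (S h u)) w = L2_inner M (S h u) (S t w)"
      by (rule sym[OF generator_S[OF g k hn(1)] S_L2[OF hn(1) k]])
    have 1: "L2_inner M (remainder h u k) (S t w) =
        L2_inner M (S h u) (S t w) - L2_inner M u (S t w) - h * L2_inner M k (S t w)"
      unfolding remainder_def using u k w hn
      by (simp add: L2_inner_diff L2_diff S_L2 L2_scale L2_inner_scale)
    have ae: "AE x in M. S h (S t u) x = S t (S h u) x"
      using S_comp[OF hn u] S_comp[OF hn(2,1) u] by eventually_elim (simp add: add.commute)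
    have "L2_inner M (remainder h (S t u) (S t k)) w =
        L2_inner M (S h (S t u)) w - L2_inner M (S t u) w - h * L2_inner M (S t k) w"
      unfolding remainder_def using u k w hn
      by (simp add: L2_inner_diff L2_diff S_L2 L2_scale L2_inner_scale)
    also have "L2_inner M (S h (S t u)) w = L2_inner M (S t (S h u)) w"
      by (intro L2_inner_cong_AE L2_measurable S_L2 ae hn u w) auto
    finally have "h * (L2_inner M (S t k) w - L2_inner M k (S t w)) =
        L2_inner M (remainder h u k) (S t w) - L2_inner M (remainder h (S t u) (S t k)) w"
      using 1 eq sym[OF g k] by (simp add: algebra_simps)
    moreover have "\<bar>L2_inner M (remainder h u k) (S t w)\<bar> \<le> L2_norm M (remainder h u k) * L2_norm M w"
      by (rule order_trans[OF L2_Cauchy_Schwarz[OF remainder_L2[OF hn(1) u k] S_L2[OF hn(2) w]]])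
         (intro mult_left_mono S_contraction hn w L2_norm_nonneg)
    moreover have "\<bar>L2_inner M (remainder h (S t u) (S t k)) w\<bar> \<le> L2_norm M (remainder h u k) * L2_norm M w"
      by (rule order_trans[OF L2_Cauchy_Schwarz[OF remainder_L2[OF hn(1) S_L2[OF hn(2) u] S_L2[OF hn(2) k]] w]])
         (intro mult_right_mono L2_norm_remainder_S hn u k L2_norm_nonneg)
    ultimately have "\<bar>h * (L2_inner M (S t k) w - L2_inner M k (S t w))\<bar> \<le>
        2 * (L2_norm M (remainder h u k) * L2_norm M w)" by linarith
    then have "\<bar>h\<bar> * \<bar>L2_inner M (S t k) w - L2_inner M k (S t w)\<bar> \<le>
        2 * (L2_norm M (remainder h u k) * L2_norm M w)" by (simp only: abs_mult)
    then show ?thesis using h by (simp add: field_simps)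
  qed
  have "((\<lambda>h. L2_norm M (remainder h u k) / h) \<longlongrightarrow> 0) (at_right 0)"
    using g generator_iff_remainder[OF u k] by simp
  then have "((\<lambda>h. 2 * (L2_norm M (remainder h u k) / h) * L2_norm M w) \<longlongrightarrow> 2 * 0 * L2_norm M w) (at_right 0)"
    by (intro tendsto_intros)
  then have "\<bar>L2_inner M (S t k) w - L2_inner M k (S t w)\<bar> \<le> 2 * 0 * L2_norm M w"
    by (rule tendsto_lowerbound)
       (use bound eventually_at_right_less[of "0::real"] in \<open>auto elim!: eventually_mono\<close>)
  then show ?thesis by simp
qed

text \<open>Every f is u - k with k = L u, by surjectivity of the resolvent, and the identity is
  available for both u and k. No separate density argument for the domain of L is involved.\<close>

lemma semigroup_sym_aux:
  assumes f: "f \<in> L2_space M" and w: "w \<in> L2_space M" and t: "0 < t"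
    and sym: "\<And>u k. form_generator M E F u k \<Longrightarrow> k \<in> L2_space M \<Longrightarrow>
       L2_inner M (S t u) w = L2_inner M u (S t w)"
  shows "L2_inner M (S t f) w = L2_inner M f (S t w)"
proof -
  obtain u where g: "form_generator M E F u (\<lambda>x. u x - f x)" by (rule resolvent_exists[OF f])
  have u: "u \<in> L2_space M" by (rule generator_L2[OF g])
  have k: "(\<lambda>x. u x - f x) \<in> L2_space M" by (intro L2_diff u f)
  have tn: "0 \<le> t" using t by simp
  have "AE x in M. S t (\<lambda>x. 1 * u x + (-1) * f x) x = 1 * S t u x + (-1) * S t f x"
    by (intro S_lincomb u f tn)
  then have "L2_inner M (S t (\<lambda>x. u x - f x)) w = L2_inner M (\<lambda>x. S t u x - S t f x) w"
    by (intro L2_inner_cong_AE L2_measurable S_L2 L2_diff u f tn w) auto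
  also have "\<dots> = L2_inner M (S t u) w - L2_inner M (S t f) w"
    by (intro L2_inner_diff S_L2 u f tn w)
  finally show ?thesis
    using S_sym_extend[OF g k w t sym] sym[OF g k] L2_inner_diff[OF u f S_L2[OF tn w]] by simp
qed

text \<open>The restriction to the domain of the generator is lifted one slot at a time: first the
  left factor becomes arbitrary, then the roles are exchanged.\<close>

lemma semigroup_sym:
  assumes f: "f \<in> L2_space M" and g: "g \<in> L2_space M" and t: "0 < t"
  shows "L2_inner M (P t f) g = L2_inner M f (P t g)"
proof -
  have 1: "L2_inner M (S t f) v = L2_inner M f (S t v)"
    if v: "form_generator M E F v l" "l \<in> L2_space M" and f: "f \<in> L2_space M" for f v l
    by (rule semigroup_sym_aux[OF f generator_L2[OF v(1)] t]) (rule S_sym_generators[OF _ v(1) _ v(2) t])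
  have "L2_inner M (S t g) f = L2_inner M g (S t f)"
    by (rule semigroup_sym_aux[OF g f t]) (metis 1 f L2_inner_commute)
  then show ?thesis using t by (metis S_pos L2_inner_commute)
qed

text \<open>Symmetry turns \<langle>S(kt) f, P t f\<rangle> into \<langle>f, S((k+1)t) f\<rangle>,
  so the sum collapses. The form of the summands is the point: all share the increment f - P t f
  over one short step.\<close>

lemma semigroup_telescope:
  assumes f: "f \<in> L2_space M" and t: "0 < t" and n: "0 < n"
  shows "L2_inner M f (\<lambda>x. f x - P (real n * t) f x) =
    (\<Sum>k<n. L2_inner M (S (real k * t) f) (\<lambda>x. f x - P t f x))"
proof -
  have tn: "0 \<le> real k * t" for k using t by simp
  have step: "L2_inner M (S (real k * t) f) (\<lambda>x. f x - P t f x) =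
      L2_inner M f (S (real k * t) f) - L2_inner M f (S (real (Suc k) * t) f)" for k
  proof -
    have "L2_inner M (S (real k * t) f) (\<lambda>x. f x - P t f x) =
      L2_inner M (S (real k * t) f) f - L2_inner M (S (real k * t) f) (P t f)"
      by (intro L2_inner_diff_right f S_L2 semigroup_L2 t tn)
    also have "L2_inner M (S (real k * t) f) (P t f) = L2_inner M f (S (real k * t) (P t f))"
      using semigroup_sym[OF f semigroup_L2[OF t f], of "real k * t"] t
      by (cases "k = 0") (auto simp: S_pos)
    also have "\<dots> = L2_inner M f (S (real (Suc k) * t) f)"
      using S_comp[of "real k * t" t f] t f
      by (intro L2_inner_cong_AE L2_measurable S_L2 semigroup_L2 tn) (auto simp: S_pos algebra_simps)
    finally show ?thesis by (simp add: L2_inner_commute)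
  qed
  have "(\<Sum>k<n. L2_inner M (S (real k * t) f) (\<lambda>x. f x - P t f x)) =
      L2_inner M f (S (real 0 * t) f) - L2_inner M f (S (real n * t) f)"
    unfolding step by (rule sum_lessThan_telescope')
  then show ?thesis
    using t n f by (simp add: S_pos L2_inner_diff_right semigroup_L2)
qed

end

section \<open>Ahlfors regular spaces\<close>

locale ahlfors_space =
  fixes M :: "'a::metric_space measure" and q c1 c2 :: real
  assumes sets_M: "sets M = sets borel"
    and q_pos: "0 < q" and c1_pos: "0 < c1" and c2_pos: "0 < c2"
    and ball_lower: "0 < r \<Longrightarrow> ennreal (c1 * r powr q) \<le> emeasure M (ball x r)"
    and ball_upper: "0 < r \<Longrightarrow> emeasure M (ball x r) \<le> ennreal (c2 * r powr q)"
    and compact_closed_ball: "0 < r \<Longrightarrow> compact (closure (ball (x::'a) r))"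
begin

lemma space_M [simp]: "space M = UNIV"
  using sets_eq_imp_space_eq[OF sets_M] by simp

lemma ball_sets [measurable]: "ball x r \<in> sets M"
  by (simp add: sets_M)

lemma measurable_M_iff: "borel_measurable M = borel_measurable borel"
  by (rule measurable_cong_sets[OF sets_M refl])

lemma emeasure_ball_finite: "emeasure M (ball x r) < \<infinity>"
proof (cases "0 < r")
  case True
  show ?thesis by (rule le_less_trans[OF ball_upper[OF True]]) simp
next
  case False
  then have "ball x r = {}" by simp
  show ?thesis unfolding \<open>ball x r = {}\<close> by simp
qed

lemma emeasure_ball_pos: "0 < r \<Longrightarrow> 0 < emeasure M (ball x r)"
  by (rule less_le_trans[OF _ ball_lower]) (simp_all add: c1_pos ennreal_zero_less_mult_iff)

lemma measure_ball_lower: "0 < r \<Longrightarrow> c1 * r powr q \<le> measure M (ball x r)"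
  using ball_lower[of r x] emeasure_ball_finite[of x r] c1_pos
  by (simp add: emeasure_eq_ennreal_measure top.not_eq_extremum)

lemma measure_ball_upper: "0 < r \<Longrightarrow> measure M (ball x r) \<le> c2 * r powr q"
  using ball_upper[of r x] emeasure_ball_finite[of x r] c2_pos
  by (simp add: emeasure_eq_ennreal_measure top.not_eq_extremum)

lemma UN_balls: "(\<Union>n. ball x (real n)) = UNIV"
  by (auto simp: reals_Archimedean2)

sublocale sigma_finite_measure M
proof (rule sigma_finite_measure.intro)
  show "\<exists>A. countable A \<and> A \<subseteq> sets M \<and> \<Union> A = space M \<and> (\<forall>a\<in>A. emeasure M a \<noteq> \<infinity>)"
    using emeasure_ball_finite UN_balls
    by (intro exI[of _ "range (\<lambda>n. ball undefined (real n))"]) (auto simp: less_top reals_Archimedean2)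
qed

sublocale pair: pair_sigma_finite M M ..

text \<open>The type class provides no countability; separability comes from exhausting the space by
  closures of balls, which are compact and hence totally bounded.\<close>

lemma countable_dense:
  obtains D :: "'a set" where "countable D" "\<And>x e. 0 < e \<Longrightarrow> \<exists>y\<in>D. dist x y < e"
proof -
  define C where "C n = closure (ball (undefined :: 'a) (real (Suc n)))" for n
  have "\<exists>k. finite k \<and> C n \<subseteq> (\<Union>x\<in>k. ball x (1 / real (Suc m)))" for n m
    using compact_closed_ball[of "real (Suc n)" undefined] unfolding C_def compact_eq_totally_bounded by simp
  then obtain k where k: "\<And>n m. finite (k n m)" "\<And>n m. C n \<subseteq> (\<Union>x\<in>k n m. ball x (1 / real (Suc m)))"
    by metis
  show ?thesis
  proof (rule that)
    show "countable (\<Union>n m. k n m)" using k(1) by (simp add: countable_finite)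
    fix x :: 'a and e :: real assume e: "0 < e"
    obtain n where "dist undefined x < real n" using reals_Archimedean2 by blast
    then have x: "x \<in> C n" unfolding C_def by (intro subsetD[OF closure_subset]) simp
    obtain m where m: "1 / real (Suc m) < e" using nat_approx_posE[OF e] by blast
    obtain y where "y \<in> k n m" "dist y x < 1 / real (Suc m)" using k(2)[of n m] x by auto
    then show "\<exists>y\<in>(\<Union>n m. k n m). dist x y < e"
      using m by (intro bexI[of _ y]) (auto simp: dist_commute)
  qed
qed

text \<open>Separability makes every open set of the product a countable union of boxes. This is
  what makes the continuous kernel and the distance measurable for the product
  sigma-algebra.\<close>

lemma open_sets_pair:
  fixes U :: "('a \<times> 'a) set"
  assumes U: "open U"
  shows "U \<in> sets (M \<Otimes>\<^sub>M M)"
proof -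
  obtain D :: "'a set" where D: "countable D" "\<And>x e. 0 < e \<Longrightarrow> \<exists>y\<in>D. dist x y < e"
    by (rule countable_dense) blast
  define I where "I = {(a, b, n). a \<in> D \<and> b \<in> D \<and> ball a (1 / real (Suc n)) \<times> ball b (1 / real (Suc n)) \<subseteq> U}"
  have I: "countable I"
    by (rule countable_subset[of _ "D \<times> D \<times> UNIV"]) (auto simp: I_def D)
  have "U = (\<Union>(a, b, n)\<in>I. ball a (1 / real (Suc n)) \<times> ball b (1 / real (Suc n)))"
  proof
    show "U \<subseteq> (\<Union>(a, b, n)\<in>I. ball a (1 / real (Suc n)) \<times> ball b (1 / real (Suc n)))"
    proof
      fix z assume z: "z \<in> U"
      obtain x y where xy: "z = (x, y)" by (cases z)
      obtain A B where AB': "open A" "open B" "z \<in> A \<times> B" "A \<times> B \<subseteq> U"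
        by (rule open_prod_elim[OF U z])
      then have AB: "open A" "open B" "x \<in> A" "y \<in> B" "A \<times> B \<subseteq> U"
        unfolding xy by auto
      obtain e1 e2 where e: "0 < e1" "ball x e1 \<subseteq> A" "0 < e2" "ball y e2 \<subseteq> B"
        using openE[OF AB(1,3)] openE[OF AB(2,4)] by metis
      \<comment> \<open>Half, because the small balls have their centres in D rather than at x and
        y: centre distance plus radius must stay below e1 and e2.\<close>
      then have "0 < min e1 e2 / 2" by simp
      then obtain n where n: "1 / real (Suc n) < min e1 e2 / 2" by (rule nat_approx_posE)
      obtain a b where ab: "a \<in> D" "dist x a < 1 / real (Suc n)" "b \<in> D" "dist y b < 1 / real (Suc n)"
        using D(2)[of "1 / real (Suc n)" x] D(2)[of "1 / real (Suc n)" y] by auto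
      have "ball a (1 / real (Suc n)) \<subseteq> ball x e1"
      proof
        fix w assume w: "w \<in> ball a (1 / real (Suc n))"
        have "dist x w \<le> dist x a + dist a w" by (rule dist_triangle)
        with w ab n show "w \<in> ball x e1" by simp
      qed
      moreover have "ball b (1 / real (Suc n)) \<subseteq> ball y e2"
      proof
        fix w assume w: "w \<in> ball b (1 / real (Suc n))"
        have "dist y w \<le> dist y b + dist b w" by (rule dist_triangle)
        with w ab n show "w \<in> ball y e2" by simp
      qed
      ultimately have "ball a (1 / real (Suc n)) \<times> ball b (1 / real (Suc n)) \<subseteq> A \<times> B"
        using e by (intro Sigma_mono) auto
      then have "(a, b, n) \<in> I" using ab AB(5) unfolding I_def by auto
      then show "z \<in> (\<Union>(a, b, n)\<in>I. ball a (1 / real (Suc n)) \<times> ball b (1 / real (Suc n)))"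
        using ab xy by (intro UN_I[of "(a, b, n)"]) (auto simp: dist_commute)
    qed
  qed (auto simp: I_def)
  moreover have "(\<Union>(a, b, n)\<in>I. ball a (1 / real (Suc n)) \<times> ball b (1 / real (Suc n))) \<in> sets (M \<Otimes>\<^sub>M M)"
    using I by (intro sets.countable_UN') auto
  ultimately show ?thesis by simp
qed

lemma continuous_measurable_pair:
  fixes f :: "'a \<times> 'a \<Rightarrow> real"
  assumes "continuous_on UNIV f"
  shows "f \<in> borel_measurable (M \<Otimes>\<^sub>M M)"
proof (rule borel_measurableI)
  fix S :: "real set" assume "open S"
  then have "open (f -` S)" using assms by (simp add: open_vimage)
  then show "f -` S \<inter> space (M \<Otimes>\<^sub>M M) \<in> sets (M \<Otimes>\<^sub>M M)"
    by (simp add: open_sets_pair space_pair_measure)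
qed

lemma dist_measurable [measurable]: "(\<lambda>z. dist (fst z) (snd z)) \<in> borel_measurable (M \<Otimes>\<^sub>M M)"
  by (intro continuous_measurable_pair continuous_intros)

lemma dist_section_measurable [measurable]: "(\<lambda>y. dist x y) \<in> borel_measurable M"
  unfolding measurable_M_iff by (intro borel_measurable_continuous_onI continuous_intros)

lemma Delta_sets [measurable]: "Delta r \<in> sets (M \<Otimes>\<^sub>M M)"
proof -
  have "Delta r = {z \<in> space (M \<Otimes>\<^sub>M M). dist (fst z) (snd z) < r}"
    by (auto simp: Delta_def space_pair_measure)
  also have "\<dots> \<in> sets (M \<Otimes>\<^sub>M M)" by measurable
  finally show ?thesis .
qed

lemma nn_integral_pair:
  fixes g :: "'a \<times> 'a \<Rightarrow> ennreal"
  assumes "g \<in> borel_measurable (M \<Otimes>\<^sub>M M)"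
  shows "(\<integral>\<^sup>+z. g z \<partial>(M \<Otimes>\<^sub>M M)) = (\<integral>\<^sup>+x. \<integral>\<^sup>+y. g (x, y) \<partial>M \<partial>M)"
  by (rule nn_integral_fst[OF assms, symmetric])

text \<open>The Korevaar-Schoen energy without its weight. By Ahlfors regularity the weight is
  comparable to a power of r and leaves the integral, so one symmetric quantity on the product
  serves all exponents.\<close>

definition oscillation :: "('a \<Rightarrow> real) \<Rightarrow> real \<Rightarrow> ennreal" where
  "oscillation f r = (\<integral>\<^sup>+z. ennreal \<bar>f (fst z) - f (snd z)\<bar> * indicator (Delta r) z \<partial>(M \<Otimes>\<^sub>M M))"

lemma cmult_oscillation_iterated:
  assumes [measurable]: "f \<in> borel_measurable M"
  shows "c * oscillation f r = (\<integral>\<^sup>+x. \<integral>\<^sup>+y. c * (ennreal \<bar>f x - f y\<bar> * indicator (Delta r) (x, y)) \<partial>M \<partial>M)"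
proof -
  have "c * oscillation f r = (\<integral>\<^sup>+z. c * (ennreal \<bar>f (fst z) - f (snd z)\<bar> * indicator (Delta r) z) \<partial>(M \<Otimes>\<^sub>M M))"
    unfolding oscillation_def by (simp add: nn_integral_cmult)
  also have "\<dots> = (\<integral>\<^sup>+x. \<integral>\<^sup>+y. c * (ennreal \<bar>f x - f y\<bar> * indicator (Delta r) (x, y)) \<partial>M \<partial>M)"
    by (subst nn_integral_pair) simp_all
  finally show ?thesis .
qed

lemma KS_energy_le:
  assumes f: "f \<in> borel_measurable M" and r: "0 < r"
  shows "KS_energy M \<sigma> f r \<le> ennreal (1 / (c1 * r powr (\<sigma> + q))) * oscillation f r"
  unfolding KS_energy_def cmult_oscillation_iterated[OF f] mult.assoc[symmetric]
proof (intro nn_integral_mono mult_right_mono)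
  fix x y
  have "r powr \<sigma> * (c1 * r powr q) \<le> r powr \<sigma> * measure M (ball x r)"
    by (intro mult_left_mono measure_ball_lower r) simp
  then have "c1 * r powr (\<sigma> + q) \<le> r powr \<sigma> * measure M (ball x r)"
    by (simp add: powr_add mult_ac)
  moreover have "0 < c1 * r powr (\<sigma> + q)" using c1_pos r by simp
  ultimately have "\<bar>f y - f x\<bar> / (r powr \<sigma> * measure M (ball x r)) \<le> \<bar>f y - f x\<bar> / (c1 * r powr (\<sigma> + q))"
    by (intro divide_left_mono) auto
  also have "\<dots> = 1 / (c1 * r powr (\<sigma> + q)) * \<bar>f x - f y\<bar>" by (simp add: abs_minus_commute)
  finally show "ennreal (\<bar>f y - f x\<bar> / (r powr \<sigma> * measure M (ball x r))) \<le>
      ennreal (1 / (c1 * r powr (\<sigma> + q))) * ennreal \<bar>f x - f y\<bar>"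
    using c1_pos by (subst ennreal_mult[symmetric]) (auto intro!: ennreal_leI)
qed simp

lemma KS_energy_ge:
  assumes f: "f \<in> borel_measurable M" and r: "0 < r"
  shows "ennreal (1 / (c2 * r powr (\<sigma> + q))) * oscillation f r \<le> KS_energy M \<sigma> f r"
  unfolding KS_energy_def cmult_oscillation_iterated[OF f] mult.assoc[symmetric]
proof (intro nn_integral_mono mult_right_mono)
  fix x y
  have "0 < c1 * r powr q" using c1_pos r by simp
  then have pos: "0 < measure M (ball x r)" using measure_ball_lower[OF r, of x] by linarith
  have "r powr \<sigma> * measure M (ball x r) \<le> r powr \<sigma> * (c2 * r powr q)"
    by (intro mult_left_mono measure_ball_upper r) simp
  then have "r powr \<sigma> * measure M (ball x r) \<le> c2 * r powr (\<sigma> + q)"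
    by (simp add: powr_add mult_ac)
  then have "\<bar>f y - f x\<bar> / (c2 * r powr (\<sigma> + q)) \<le> \<bar>f y - f x\<bar> / (r powr \<sigma> * measure M (ball x r))"
    using pos r c2_pos by (intro divide_left_mono) auto
  moreover have "1 / (c2 * r powr (\<sigma> + q)) * \<bar>f x - f y\<bar> = \<bar>f y - f x\<bar> / (c2 * r powr (\<sigma> + q))"
    by (simp add: abs_minus_commute)
  ultimately show "ennreal (1 / (c2 * r powr (\<sigma> + q))) * ennreal \<bar>f x - f y\<bar> \<le>
      ennreal (\<bar>f y - f x\<bar> / (r powr \<sigma> * measure M (ball x r)))"
    using c2_pos by (subst ennreal_mult[symmetric]) (auto intro!: ennreal_leI)
qed simp

lemma oscillation_le_KS_energy:
  assumes f: "f \<in> borel_measurable M" and r: "0 < r"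
  shows "oscillation f r \<le> ennreal (c2 * r powr (\<sigma> + q)) * KS_energy M \<sigma> f r"
proof -
  have pos: "0 < c2 * r powr (\<sigma> + q)" using c2_pos r by simp
  have "oscillation f r = ennreal (c2 * r powr (\<sigma> + q) * (1 / (c2 * r powr (\<sigma> + q)))) * oscillation f r"
    using c2_pos r by simp
  also have "\<dots> = ennreal (c2 * r powr (\<sigma> + q)) * (ennreal (1 / (c2 * r powr (\<sigma> + q))) * oscillation f r)"
    using pos by (subst ennreal_mult) (auto simp: mult.assoc)
  also have "\<dots> \<le> ennreal (c2 * r powr (\<sigma> + q)) * KS_energy M \<sigma> f r"
    by (intro mult_left_mono KS_energy_ge f r) simp
  finally show ?thesis .
qed

lemma averaged_difference_KS_energy:
  assumes [measurable]: "f \<in> borel_measurable M"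
  shows "(\<integral>\<^sup>+x. averaged_difference M d_W \<kappa> r f x \<partial>M) = KS_energy M (d_W - \<kappa>) f r"
  unfolding KS_energy_def averaged_difference_def
proof (rule nn_integral_cong)
  fix x
  let ?c = "1 / (r powr (d_W - \<kappa>) * measure M (ball x r))"
  have "ennreal ?c * (\<integral>\<^sup>+y\<in>ball x r. ennreal \<bar>f x - f y\<bar> \<partial>M) =
      (\<integral>\<^sup>+y. ennreal ?c * (ennreal \<bar>f x - f y\<bar> * indicator (ball x r) y) \<partial>M)"
    by (simp add: nn_integral_cmult)
  also have "\<dots> = (\<integral>\<^sup>+y. ennreal (\<bar>f y - f x\<bar> / (r powr (d_W - \<kappa>) * measure M (ball x r))) *
      indicator (Delta r) (x, y) \<partial>M)"
  proof (rule nn_integral_cong)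
    fix y
    have "ennreal ?c * ennreal \<bar>f x - f y\<bar> = ennreal (\<bar>f y - f x\<bar> / (r powr (d_W - \<kappa>) * measure M (ball x r)))"
      by (subst ennreal_mult[symmetric]) (auto simp: abs_minus_commute)
    then show "ennreal ?c * (ennreal \<bar>f x - f y\<bar> * indicator (ball x r) y) =
      ennreal (\<bar>f y - f x\<bar> / (r powr (d_W - \<kappa>) * measure M (ball x r))) * indicator (Delta r) (x, y)"
      by (auto simp: Delta_def indicator_def)
  qed
  finally show "ennreal ?c * (\<integral>\<^sup>+y\<in>ball x r. ennreal \<bar>f x - f y\<bar> \<partial>M) =
    (\<integral>\<^sup>+y. ennreal (\<bar>f y - f x\<bar> / (r powr (d_W - \<kappa>) * measure M (ball x r))) * indicator (Delta r) (x, y) \<partial>M)" .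
qed

end

section \<open>Dyadic summation and sub-Gaussian bounds\<close>

lemma dyadic_scale:
  fixes R d :: real
  assumes "0 < R" "R \<le> d"
  obtains k :: nat where "2 ^ k * R \<le> d" "d < 2 ^ Suc k * R"
proof -
  obtain n where n: "d / R < 2 ^ n" using real_arch_pow[of 2 "d / R"] by auto
  define j where "j = (LEAST j. d / R < 2 ^ j)"
  have j: "d / R < 2 ^ j" unfolding j_def by (rule LeastI[of _ n]) (rule n)
  have "j \<noteq> 0"
  proof
    assume "j = 0"
    with j assms show False by (simp add: field_simps)
  qed
  then obtain k where k: "j = Suc k" by (cases j) auto
  have "\<not> d / R < 2 ^ k" using not_less_Least[of k "\<lambda>j. d / R < 2 ^ j"] k by (simp add: j_def)
  then show ?thesis using that[of k] j assms k by (simp add: field_simps)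
qed

text \<open>The decay exponent exceeds the growth exponent by 1, so the shells 2^k R \<le> \<delta>
  < 2^(k+1) R contribute a geometric series of ratio 1/2. Its sum gives the factor 2, and measuring
  growth at the outer radius gives 2^s. Only radii at least R are used.\<close>

lemma nn_integral_dyadic_tail:
  fixes w :: "'b \<Rightarrow> ennreal" and \<delta> :: "'b \<Rightarrow> real"
  assumes [measurable]: "w \<in> borel_measurable N" "\<delta> \<in> borel_measurable N"
    and R: "0 < R" and s: "0 \<le> s"
    and growth: "\<And>r. R \<le> r \<Longrightarrow> (\<integral>\<^sup>+z. w z * indicator {z. \<delta> z < r} z \<partial>N) \<le> ennreal (r powr s) * A"
  shows "(\<integral>\<^sup>+z. w z * (ennreal (\<delta> z powr (- (s + 1))) * indicator {z. R \<le> \<delta> z} z) \<partial>N)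
      \<le> ennreal (2 * 2 powr s / R) * A"
proof -
  let ?a = "\<lambda>k::nat. (2 ^ k * R) powr (- (s + 1))"
  have ind [measurable]: "(\<lambda>z. indicator {z. \<delta> z < r} z :: ennreal) \<in> borel_measurable N" for r
  proof -
    have "(\<lambda>z. indicator {z. \<delta> z < r} z :: ennreal) = (\<lambda>z. if \<delta> z < r then 1 else 0)" by auto
    then show ?thesis by simp
  qed
  \<comment> \<open>Only the shell containing z is needed; the remaining terms of the series are
    non-negative.\<close>
  have pw: "w z * (ennreal (\<delta> z powr (- (s + 1))) * indicator {z. R \<le> \<delta> z} z) \<le>
      (\<Sum>k. ennreal (?a k) * (w z * indicator {z. \<delta> z < 2 ^ Suc k * R} z))" for z
  proof (cases "R \<le> \<delta> z")
    case True
    then obtain k where k: "2 ^ k * R \<le> \<delta> z" "\<delta> z < 2 ^ Suc k * R" using dyadic_scale[OF R] by blast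
    have "\<delta> z powr (- (s + 1)) \<le> ?a k"
      using k R s by (intro powr_mono2') auto
    then have "w z * (ennreal (\<delta> z powr (- (s + 1))) * indicator {z. R \<le> \<delta> z} z) \<le>
       ennreal (?a k) * (w z * indicator {z. \<delta> z < 2 ^ Suc k * R} z)"
      using k True by (simp add: mult.commute mult_left_mono ennreal_leI)
    also have "\<dots> = (\<Sum>k\<in>{k}. ennreal (?a k) * (w z * indicator {z. \<delta> z < 2 ^ Suc k * R} z))" by simp
    also have "\<dots> \<le> (\<Sum>k. ennreal (?a k) * (w z * indicator {z. \<delta> z < 2 ^ Suc k * R} z))"
      by (rule sum_le_suminf) auto
    finally show ?thesis .
  qed simp
  have coeff: "?a k * (2 ^ Suc k * R) powr s = 2 powr s / R * (1 / 2) ^ k" for k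
  proof -
    have "(2 ^ Suc k * R) powr s = 2 powr s * (2 ^ k * R) powr s"
      using R by (simp add: powr_mult mult.assoc)
    then have "?a k * (2 ^ Suc k * R) powr s = 2 powr s * ((2 ^ k * R) powr (- (s + 1)) * (2 ^ k * R) powr s)"
      by simp
    also have "(2 ^ k * R) powr (- (s + 1)) * (2 ^ k * R) powr s = (2 ^ k * R) powr (- 1)"
      by (simp flip: powr_add)
    also have "\<dots> = (1 / 2) ^ k / R"
      using R by (simp add: powr_minus power_divide field_simps)
    finally show ?thesis by simp
  qed
  have sums: "(\<lambda>k. 2 powr s / R * (1 / 2) ^ k) sums (2 powr s / R * (1 / (1 - 1 / 2)))"
    by (intro sums_mult geometric_sums) simp
  have "(\<integral>\<^sup>+z. w z * (ennreal (\<delta> z powr (- (s + 1))) * indicator {z. R \<le> \<delta> z} z) \<partial>N) \<le>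
      (\<integral>\<^sup>+z. (\<Sum>k. ennreal (?a k) * (w z * indicator {z. \<delta> z < 2 ^ Suc k * R} z)) \<partial>N)"
    by (intro nn_integral_mono pw)
  also have "\<dots> = (\<Sum>k. ennreal (?a k) * (\<integral>\<^sup>+z. w z * indicator {z. \<delta> z < 2 ^ Suc k * R} z \<partial>N))"
    by (subst nn_integral_suminf) (auto simp: nn_integral_cmult)
  also have "\<dots> \<le> (\<Sum>k. ennreal (?a k) * (ennreal ((2 ^ Suc k * R) powr s) * A))"
  proof (intro suminf_le mult_left_mono growth)
    fix k :: nat
    have "1 * R \<le> 2 ^ Suc k * R" using R by (intro mult_right_mono one_le_power) auto
    then show "R \<le> 2 ^ Suc k * R" by simp
  qed auto
  also have "\<dots> = (\<Sum>k. ennreal (2 powr s / R * (1 / 2) ^ k) * A)"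
    unfolding mult.assoc[symmetric] by (simp only: coeff ennreal_mult[symmetric] powr_ge_zero)
  also have "\<dots> = (\<Sum>k. ennreal (2 powr s / R * (1 / 2) ^ k)) * A"
    by (rule ennreal_suminf_multc)
  also have "(\<Sum>k. ennreal (2 powr s / R * (1 / 2) ^ k)) = ennreal (2 powr s / R * (1 / (1 - 1 / 2)))"
    using sums R by (intro suminf_ennreal_eq) auto
  finally show ?thesis by (simp add: mult.commute)
qed

text \<open>From ln y \<le> y - 1 at y = b z / m; the factor exp(-m) of the exact maximum is
  discarded.\<close>

lemma powr_times_exp_bounded:
  fixes m b z :: real
  assumes "0 < m" "0 < b" "0 \<le> z"
  shows "z powr m * exp (- b * z) \<le> (m / b) powr m"
proof (cases "z = 0")
  case False
  with assms have z: "0 < z" by simp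
  have "m * ln (b * z / m) \<le> m * (b * z / m - 1)"
    using assms z by (intro mult_left_mono ln_le_minus_one) auto
  also have "\<dots> = b * z - m" using assms by (simp add: field_simps)
  finally have "m * ln z - b * z \<le> m * ln (m / b)"
    using assms z by (simp add: ln_mult ln_div algebra_simps)
  then have "exp (m * ln z - b * z) \<le> exp (m * ln (m / b))" by simp
  then show ?thesis using assms z by (simp add: powr_def exp_diff exp_minus field_simps)
qed simp

lemma sub_gaussian_le:
  assumes "0 < a" "0 < b"
  shows "sub_gaussian d_H d_W a b t \<delta> \<le> a * t powr (- d_H / d_W)"
  using assms by (simp add: sub_gaussian_def mult_left_le)

text \<open>Trades the exponential for polynomial decay of arbitrary order N, in the form that
  dyadic summation can use.\<close>

lemma sub_gaussian_powr_le:
  assumes a: "0 < a" and b: "0 < b" and W: "2 < d_W" and N: "0 < N" and t: "0 < t" and d: "0 < \<delta>"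
  shows "sub_gaussian d_H d_W a b t \<delta> \<le>
     a * (N * (d_W - 1) / d_W / b) powr (N * (d_W - 1) / d_W) * t powr ((N - d_H) / d_W) * \<delta> powr (- N)"
proof -
  \<comment> \<open>Chosen so that z^m = \<delta>^N / t^(N/d_W).\<close>
  define m where "m = N * (d_W - 1) / d_W"
  define z where "z = (\<delta> powr d_W / t) powr (1 / (d_W - 1))"
  have m: "0 < m" using N W by (simp add: m_def)
  have z: "0 < z" using t d by (simp add: z_def)
  have "z powr m = (\<delta> powr d_W / t) powr (1 / (d_W - 1) * (N * (d_W - 1) / d_W))"
    by (simp add: z_def m_def powr_powr)
  also have "1 / (d_W - 1) * (N * (d_W - 1) / d_W) = N / d_W" using W by simp
  also have "(\<delta> powr d_W / t) powr (N / d_W) = \<delta> powr N / t powr (N / d_W)"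
    using t d W by (simp add: powr_divide powr_powr)
  finally have zm: "z powr m = \<delta> powr N / t powr (N / d_W)" .
  have tN: "t powr (- d_H / d_W) * t powr (N / d_W) = t powr ((N - d_H) / d_W)"
    by (simp flip: powr_add add: diff_divide_distrib)
  have "sub_gaussian d_H d_W a b t \<delta> = a * t powr (- d_H / d_W) * (exp (- b * z) * z powr m) / z powr m"
    using z by (simp add: sub_gaussian_def z_def)
  also have "\<dots> \<le> a * t powr (- d_H / d_W) * ((m / b) powr m) / z powr m"
    using powr_times_exp_bounded[OF m b, of z] a z
    by (intro divide_right_mono mult_left_mono) (auto simp: mult.commute)
  also have "\<dots> = a * (m / b) powr m * (t powr (- d_H / d_W) * t powr (N / d_W)) * \<delta> powr (- N)"
    using t d by (simp add: zm powr_minus field_simps)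
  finally show ?thesis unfolding tN m_def .
qed

lemma sub_gaussian_ge:
  assumes a: "0 < a" and b: "0 < b" and W: "2 < d_W" and t: "0 < t" and d: "0 \<le> \<delta>" "\<delta> powr d_W \<le> t"
  shows "a * t powr (- d_H / d_W) * exp (- b) \<le> sub_gaussian d_H d_W a b t \<delta>"
proof -
  have "(\<delta> powr d_W / t) powr (1 / (d_W - 1)) \<le> 1 powr (1 / (d_W - 1))"
    using t d W by (intro powr_mono2) auto
  then have "b * (\<delta> powr d_W / t) powr (1 / (d_W - 1)) \<le> b" using b by (simp add: mult_left_le)
  then show ?thesis unfolding sub_gaussian_def using a by (intro mult_left_mono) auto
qed

lemma sub_gaussian_pos: "0 < a \<Longrightarrow> 0 < t \<Longrightarrow> 0 < sub_gaussian d_H d_W a b t \<delta>"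
  by (simp add: sub_gaussian_def)

section \<open>Kernel estimates and conservativeness\<close>

definition tail_const :: "real \<Rightarrow> real \<Rightarrow> real \<Rightarrow> real \<Rightarrow> real" where
  "tail_const d_W a b N = a * (N * (d_W - 1) / d_W / b) powr (N * (d_W - 1) / d_W)"

lemma tail_const_nonneg: "0 \<le> a \<Longrightarrow> 0 \<le> tail_const d_W a b N"
  by (simp add: tail_const_def)

lemma ennreal_mult_assoc: "0 \<le> x \<Longrightarrow> 0 \<le> y \<Longrightarrow> ennreal x * (ennreal y * A) = ennreal (x * y) * A"
  by (simp add: ennreal_mult mult.assoc)

text \<open>Stated for an abstract measure and distance function because it is used both on a single
  slice, with weight 1, and on the product, with weight |f(x) - f(y)|. The kernel is bounded by its
  plateau in the near zone and by the decay of order s + 1 required by the dyadic tail in the far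
  zone.\<close>

lemma sub_gaussian_integral_le:
  fixes w :: "'b \<Rightarrow> ennreal" and \<delta> k :: "'b \<Rightarrow> real"
  assumes [measurable]: "w \<in> borel_measurable N" "\<delta> \<in> borel_measurable N"
    and a: "0 < a" and b: "0 < b" and W: "2 < d_W" and t: "0 < t" and s: "0 \<le> s"
    and k: "AE z in N. k z \<le> sub_gaussian d_H d_W a b t (\<delta> z)"
    and growth: "\<And>r. 0 < r \<Longrightarrow> (\<integral>\<^sup>+z. w z * indicator {z. \<delta> z < r} z \<partial>N) \<le> ennreal (r powr s) * A"
  shows "(\<integral>\<^sup>+z. w z * ennreal (k z) \<partial>N) \<le>
     ennreal ((a + tail_const d_W a b (s + 1) * (2 * 2 powr s)) * t powr ((s - d_H) / d_W)) * A"
proof -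
  \<comment> \<open>The diffusive length at time t, where the two regimes of the kernel balance;
    both contributions then carry the same power of t.\<close>
  define \<rho> where "\<rho> = t powr (1 / d_W)"
  define K where "K = tail_const d_W a b (s + 1)"
  have \<rho>: "0 < \<rho>" using t by (simp add: \<rho>_def)
  have K: "0 \<le> K" using a by (simp add: K_def tail_const_nonneg)
  have ind [measurable]: "(\<lambda>z. indicator {z. \<delta> z < r} z :: ennreal) \<in> borel_measurable N"
    "(\<lambda>z. indicator {z. r \<le> \<delta> z} z :: ennreal) \<in> borel_measurable N" for r
  proof -
    have "(\<lambda>z. indicator {z. \<delta> z < r} z :: ennreal) = (\<lambda>z. if \<delta> z < r then 1 else 0)"
      "(\<lambda>z. indicator {z. r \<le> \<delta> z} z :: ennreal) = (\<lambda>z. if r \<le> \<delta> z then 1 else 0)" by auto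
    then show "(\<lambda>z. indicator {z. \<delta> z < r} z :: ennreal) \<in> borel_measurable N"
      "(\<lambda>z. indicator {z. r \<le> \<delta> z} z :: ennreal) \<in> borel_measurable N" by simp_all
  qed
  let ?near = "\<lambda>z. ennreal (a * t powr (- d_H / d_W)) * (w z * indicator {z. \<delta> z < \<rho>} z)"
  let ?far = "\<lambda>z. ennreal (K * t powr ((s + 1 - d_H) / d_W)) *
    (w z * (ennreal (\<delta> z powr (- (s + 1))) * indicator {z. \<rho> \<le> \<delta> z} z))"
  have "(\<integral>\<^sup>+z. w z * ennreal (k z) \<partial>N) \<le> (\<integral>\<^sup>+z. ?near z + ?far z \<partial>N)"
  proof (rule nn_integral_mono_AE)
    show "AE z in N. w z * ennreal (k z) \<le> ?near z + ?far z"
      using k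
    proof eventually_elim
      case (elim z)
      show ?case
      proof (cases "\<delta> z < \<rho>")
        case True
        have "ennreal (k z) \<le> ennreal (a * t powr (- d_H / d_W))"
          using elim sub_gaussian_le[OF a b] by (meson ennreal_leI order_trans)
        then have "w z * ennreal (k z) \<le> ?near z"
          using True by (simp add: mult.commute[of "w z"] mult_right_mono)
        then show ?thesis by (simp add: add_increasing2)
      next
        case False
        then have d: "0 < \<delta> z" using \<rho> by simp
        have "k z \<le> K * t powr ((s + 1 - d_H) / d_W) * \<delta> z powr (- (s + 1))"
          using elim sub_gaussian_powr_le[OF a b W _ t d, of "s + 1" d_H] s
          by (simp add: K_def tail_const_def)
        then have "ennreal (k z) \<le> ennreal (K * t powr ((s + 1 - d_H) / d_W)) * ennreal (\<delta> z powr (- (s + 1)))"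
          using K by (subst ennreal_mult[symmetric]) (auto intro: ennreal_leI)
        then have "w z * ennreal (k z) \<le> w z * (ennreal (K * t powr ((s + 1 - d_H) / d_W)) * ennreal (\<delta> z powr (- (s + 1))))"
          by (rule mult_left_mono) simp
        also have "\<dots> = ?far z" using False by (simp add: mult_ac)
        finally show ?thesis by (simp add: add_increasing)
      qed
    qed
  qed
  also have "\<dots> = ennreal (a * t powr (- d_H / d_W)) * (\<integral>\<^sup>+z. w z * indicator {z. \<delta> z < \<rho>} z \<partial>N) +
     ennreal (K * t powr ((s + 1 - d_H) / d_W)) *
     (\<integral>\<^sup>+z. w z * (ennreal (\<delta> z powr (- (s + 1))) * indicator {z. \<rho> \<le> \<delta> z} z) \<partial>N)"
    by (subst nn_integral_add) (auto simp: nn_integral_cmult)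
  also have "\<dots> \<le> ennreal (a * t powr (- d_H / d_W)) * (ennreal (\<rho> powr s) * A) +
     ennreal (K * t powr ((s + 1 - d_H) / d_W)) * (ennreal (2 * 2 powr s / \<rho>) * A)"
    using \<rho> s by (intro add_mono mult_left_mono growth nn_integral_dyadic_tail) auto
  also have "\<dots> = (ennreal (a * t powr (- d_H / d_W) * \<rho> powr s) +
     ennreal (K * t powr ((s + 1 - d_H) / d_W) * (2 * 2 powr s / \<rho>))) * A"
    using a K \<rho> by (subst (1 2) ennreal_mult_assoc) (auto simp only: distrib_right intro!: mult_nonneg_nonneg divide_nonneg_pos powr_ge_zero)
  also have "\<dots> = ennreal (a * t powr (- d_H / d_W) * \<rho> powr s +
     K * t powr ((s + 1 - d_H) / d_W) * (2 * 2 powr s / \<rho>)) * A"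
    using a K \<rho> by (subst ennreal_plus[symmetric]) auto
  also have "a * t powr (- d_H / d_W) * \<rho> powr s + K * t powr ((s + 1 - d_H) / d_W) * (2 * 2 powr s / \<rho>) =
      (a + K * (2 * 2 powr s)) * t powr ((s - d_H) / d_W)"
  proof -
    have 1: "t powr (- d_H / d_W) * \<rho> powr s = t powr ((s - d_H) / d_W)"
      by (simp add: \<rho>_def powr_powr flip: powr_add) (simp add: diff_divide_distrib)
    have "t powr ((s + 1 - d_H) / d_W) = t powr ((s - d_H) / d_W) * \<rho>"
      by (simp add: \<rho>_def flip: powr_add) (simp add: diff_divide_distrib add_divide_distrib algebra_simps)
    then have 2: "t powr ((s + 1 - d_H) / d_W) * (2 * 2 powr s / \<rho>) = 2 * 2 powr s * t powr ((s - d_H) / d_W)"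
      using \<rho> by simp
    have "a * t powr (- d_H / d_W) * \<rho> powr s + K * t powr ((s + 1 - d_H) / d_W) * (2 * 2 powr s / \<rho>) =
        a * (t powr (- d_H / d_W) * \<rho> powr s) + K * (t powr ((s + 1 - d_H) / d_W) * (2 * 2 powr s / \<rho>))"
      by (simp only: mult.assoc)
    then show ?thesis unfolding 1 2 by (simp only: distrib_right mult.assoc)
  qed
  finally show ?thesis by (simp only: K_def)
qed

text \<open>The existential constants of the hypotheses become parameters, so that every later
  constant is an expression in them and visibly independent of f.\<close>

locale wBE_heat_space =
  ahlfors_space M d_H c1 c2 + heat_semigroup M E F P
  for M :: "'a::metric_space measure" and d_H c1 c2 E F P +
  fixes p :: "real \<Rightarrow> 'a \<Rightarrow> 'a \<Rightarrow> real" and d_W c3 c4 c5 c6 \<kappa> c7 :: real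
  assumes W: "2 < d_W"
    and const_pos: "0 < c3" "0 < c4" "0 < c5" "0 < c6" "0 < c7"
    and \<kappa>: "0 < \<kappa>" "\<kappa> < d_W"
    and p_continuous: "0 < t \<Longrightarrow> continuous_on UNIV (\<lambda>(x, y). p t x y)"
    and p_bounds: "AE (x, y) in M \<Otimes>\<^sub>M M. \<forall>t>0.
             sub_gaussian d_H d_W c5 c6 t (dist x y) \<le> p t x y \<and>
             p t x y \<le> sub_gaussian d_H d_W c3 c4 t (dist x y)"
    and P_kernel: "0 < t \<Longrightarrow> g \<in> L2_space M \<Longrightarrow> AE x in M. P t g x = kernel_operator M p t g x"
    and wBE_bound: "0 < t \<Longrightarrow> g \<in> Linf_space M \<Longrightarrow>
       \<bar>kernel_operator M p t g x - kernel_operator M p t g y\<bar>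
          \<le> c7 * (dist x y powr \<kappa> / t powr (\<kappa> / d_W)) * enn2real (Linf_norm M g)"
begin

lemma p_measurable: "0 < t \<Longrightarrow> (\<lambda>z. p t (fst z) (snd z)) \<in> borel_measurable (M \<Otimes>\<^sub>M M)"
  using continuous_measurable_pair[OF p_continuous] by (simp add: split_beta')

lemma p_section_measurable: "0 < t \<Longrightarrow> (\<lambda>y. p t x y) \<in> borel_measurable M"
  using measurable_compose[OF measurable_Pair1' p_measurable, of x] by simp

lemma kernel_operator_measurable:
  assumes t: "0 < t" and [measurable]: "g \<in> borel_measurable M"
  shows "kernel_operator M p t g \<in> borel_measurable M"
proof -
  note p_measurable[OF t, measurable]
  show ?thesis unfolding kernel_operator_def by measurable
qed

text \<open>The kernel bounds hold almost everywhere on the product; these are the points x whose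
  slice inherits them for almost every y and all times at once.\<close>

definition good :: "'a \<Rightarrow> bool" where
  "good x \<longleftrightarrow> (AE y in M. \<forall>t>0. sub_gaussian d_H d_W c5 c6 t (dist x y) \<le> p t x y \<and>
             p t x y \<le> sub_gaussian d_H d_W c3 c4 t (dist x y))"

lemma AE_good: "AE x in M. good x"
  using pair.AE_pair[OF p_bounds] by (simp add: good_def)

lemma good_p_pos: "good x \<Longrightarrow> 0 < t \<Longrightarrow> AE y in M. 0 < p t x y"
  unfolding good_def
  by (erule AE_mp, rule AE_I2) (metis less_le_trans sub_gaussian_pos const_pos(3))

lemma AE_p_pos:
  assumes t: "0 < t"
  shows "AE z in M \<Otimes>\<^sub>M M. 0 < p t (fst z) (snd z)"
  using p_bounds
proof eventually_elim
  case (elim z)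
  then have "sub_gaussian d_H d_W c5 c6 t (dist (fst z) (snd z)) \<le> p t (fst z) (snd z)"
    using t by (simp add: split_beta')
  then show ?case using sub_gaussian_pos[OF const_pos(3) t] less_le_trans by blast
qed

section \<open>Bounds for the total mass of the kernel\<close>

definition mass_upper :: real where
  "mass_upper = (c3 + tail_const d_W c3 c4 (d_H + 1) * (2 * 2 powr d_H)) * c2"

definition mass_lower :: real where
  "mass_lower = c5 * exp (- c6) * c1"

lemma mass_lower_pos: "0 < mass_lower"
  using const_pos c1_pos by (simp add: mass_lower_def)

text \<open>Independent of t because balls grow with exponent d_H, which cancels the factor
  t^(-d_H/d_W) of the kernel.\<close>

lemma good_mass_le:
  assumes x: "good x" and t: "0 < t"
  shows "(\<integral>\<^sup>+y. ennreal (p t x y) \<partial>M) \<le> ennreal mass_upper"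
proof -
  have "(\<integral>\<^sup>+y. 1 * ennreal (p t x y) \<partial>M) \<le>
    ennreal ((c3 + tail_const d_W c3 c4 (d_H + 1) * (2 * 2 powr d_H)) * t powr ((d_H - d_H) / d_W)) * ennreal c2"
  proof (rule sub_gaussian_integral_le[where \<delta> = "\<lambda>y. dist x y"])
    show "AE y in M. p t x y \<le> sub_gaussian d_H d_W c3 c4 t (dist x y)"
      using x t unfolding good_def by (auto elim!: AE_mp)
    fix r :: real assume r: "0 < r"
    have "(\<integral>\<^sup>+y. 1 * indicator {y. dist x y < r} y \<partial>M) = emeasure M (ball x r)"
      using nn_integral_indicator[OF ball_sets[of x r]] by (simp add: ball_def)
    also have "\<dots> \<le> ennreal (r powr d_H) * ennreal c2"
      using ball_upper[OF r, of x] c2_pos by (simp add: ennreal_mult mult.commute)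
    finally show "(\<integral>\<^sup>+y. 1 * indicator {y. dist x y < r} y \<partial>M) \<le> ennreal (r powr d_H) * ennreal c2" .
  qed (use t const_pos q_pos W in auto)
  then show ?thesis
    using t c2_pos const_pos by (simp add: mass_upper_def ennreal_mult' tail_const_nonneg)
qed

text \<open>On the ball of radius t^(1/d_W) the kernel is at least c5 exp(-c6) t^(-d_H/d_W), and
  that ball has measure at least c1 t^(d_H/d_W).\<close>

lemma good_mass_ge:
  assumes x: "good x" and t: "0 < t"
  shows "ennreal mass_lower \<le> (\<integral>\<^sup>+y. ennreal (p t x y) \<partial>M)"
proof -
  define \<rho> where "\<rho> = t powr (1 / d_W)"
  have \<rho>: "0 < \<rho>" "\<rho> powr d_W = t" using t W by (auto simp: \<rho>_def powr_powr)
  let ?c = "c5 * t powr (- d_H / d_W) * exp (- c6)"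
  have "mass_lower = ?c * (c1 * \<rho> powr d_H)"
    using t by (simp add: mass_lower_def \<rho>_def powr_powr powr_minus)
  then have "ennreal mass_lower = ennreal ?c * ennreal (c1 * \<rho> powr d_H)"
    using const_pos c1_pos by (simp add: ennreal_mult)
  also have "\<dots> \<le> ennreal ?c * emeasure M (ball x \<rho>)"
    by (intro mult_left_mono ball_lower \<rho>) simp
  also have "\<dots> = (\<integral>\<^sup>+y. ennreal ?c * indicator (ball x \<rho>) y \<partial>M)"
    by (simp add: nn_integral_cmult)
  also have "\<dots> \<le> (\<integral>\<^sup>+y. ennreal (p t x y) \<partial>M)"
  proof (rule nn_integral_mono_AE)
    have "AE y in M. sub_gaussian d_H d_W c5 c6 t (dist x y) \<le> p t x y"
      using x t unfolding good_def by (auto elim!: AE_mp)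
    then show "AE y in M. ennreal ?c * indicator (ball x \<rho>) y \<le> ennreal (p t x y)"
    proof eventually_elim
      case (elim y)
      show ?case
      proof (cases "dist x y < \<rho>")
        case True
        then have "dist x y powr d_W \<le> \<rho> powr d_W" using W by (intro powr_mono2) auto
        then have "?c \<le> p t x y"
          using sub_gaussian_ge[OF const_pos(3,4) W t, of "dist x y" d_H] elim \<rho> by simp
        then show ?thesis using True by (simp add: ennreal_leI)
      qed simp
    qed
  qed
  finally show ?thesis .
qed

lemma good_integrable:
  assumes x: "good x" and t: "0 < t" and [measurable]: "g \<in> borel_measurable M"
    and g: "AE y in M. \<bar>g y\<bar> \<le> B"
  shows "integrable M (\<lambda>y. p t x y * g y)"
proof -
  note p_section_measurable[OF t, measurable]
  have ip: "integrable M (\<lambda>y. p t x y)"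
  proof (rule integrableI_nonneg)
    show "AE y in M. 0 \<le> p t x y" using good_p_pos[OF x t] by eventually_elim simp
    show "(\<integral>\<^sup>+y. ennreal (p t x y) \<partial>M) < \<infinity>"
      by (rule le_less_trans[OF good_mass_le[OF x t]]) simp
  qed simp
  show ?thesis
  proof (rule Bochner_Integration.integrable_bound)
    show "integrable M (\<lambda>y. B * p t x y)" using ip by simp
    show "AE y in M. norm (p t x y * g y) \<le> norm (B * p t x y)"
      using good_p_pos[OF x t] g by eventually_elim (auto simp: abs_mult intro!: mult_mono)
  qed simp
qed

text \<open>This is P_t 1. The total measure is infinite, so 1 is not in L2 and only the kernel can
  act on it.\<close>

abbreviation mass :: "real \<Rightarrow> 'a \<Rightarrow> real" where
  "mass t \<equiv> kernel_operator M p t (\<lambda>_. 1)"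

lemma good_integrable_p: "good x \<Longrightarrow> 0 < t \<Longrightarrow> integrable M (\<lambda>y. p t x y)"
  using good_integrable[of x t "\<lambda>_. 1" 1] by simp

lemma good_mass_eq:
  assumes "good x" "0 < t"
  shows "ennreal (mass t x) = (\<integral>\<^sup>+y. ennreal (p t x y) \<partial>M)"
  using good_p_pos[OF assms] good_integrable_p[OF assms]
  by (subst nn_integral_eq_integral) (auto simp: kernel_operator_def elim!: AE_mp)

lemma mass_nonneg: "good x \<Longrightarrow> 0 < t \<Longrightarrow> 0 \<le> mass t x"
  using good_p_pos[of x t] unfolding kernel_operator_def
  by (intro integral_nonneg_AE) (auto elim!: AE_mp)

lemma mass_upper_nonneg: "0 \<le> mass_upper"
  using const_pos c2_pos by (simp add: mass_upper_def tail_const_nonneg)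

lemma mass_bounds:
  assumes "good x" "0 < t"
  shows "mass_lower \<le> mass t x" "mass t x \<le> mass_upper"
  using good_mass_ge[OF assms] good_mass_le[OF assms] mass_nonneg[OF assms] mass_upper_nonneg
  unfolding good_mass_eq[OF assms, symmetric] by simp_all

lemma kernel_operator_bound:
  assumes x: "good x" and t: "0 < t" and gm: "g \<in> borel_measurable M"
    and g: "AE y in M. \<bar>g y\<bar> \<le> B"
  shows "\<bar>kernel_operator M p t g x\<bar> \<le> B * mass t x"
proof -
  have "\<bar>kernel_operator M p t g x\<bar> \<le> (\<integral>y. \<bar>p t x y * g y\<bar> \<partial>M)"
    unfolding kernel_operator_def by (rule integral_abs_bound)
  also have "\<dots> \<le> (\<integral>y. B * (p t x y * 1) \<partial>M)"
  proof (rule integral_mono_AE)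
    show "AE y in M. \<bar>p t x y * g y\<bar> \<le> B * (p t x y * 1)"
      using good_p_pos[OF x t] g by eventually_elim (auto simp: abs_mult mult.commute)
  qed (use good_integrable[OF x t gm g] good_integrable_p[OF x t] in auto)
  also have "\<dots> = B * mass t x" by (simp add: kernel_operator_def)
  finally show ?thesis .
qed

lemma kernel_operator_cong_AE:
  assumes t: "0 < t" and [measurable]: "f \<in> borel_measurable M" "g \<in> borel_measurable M"
    and eq: "AE y in M. f y = g y"
  shows "kernel_operator M p t f x = kernel_operator M p t g x"
proof -
  note p_section_measurable[OF t, measurable]
  show ?thesis unfolding kernel_operator_def using eq by (intro integral_cong_AE) auto
qed

lemma indicator_L2:
  assumes [measurable]: "A \<in> sets M" and "emeasure M A < \<infinity>"
  shows "(indicator A :: 'a \<Rightarrow> real) \<in> L2_space M"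
proof -
  have *: "(\<lambda>x. (indicator A x)\<^sup>2) = (indicator A :: 'a \<Rightarrow> real)"
    by (auto simp: indicator_def)
  have "integrable M (indicator A :: 'a \<Rightarrow> real)" using assms by (simp add: integrable_indicator_iff)
  then show ?thesis using assms(1) * by (simp add: L2_space_def)
qed

lemma ball_indicator_L2: "(indicator (ball x r) :: 'a \<Rightarrow> real) \<in> L2_space M"
  by (intro indicator_L2 ball_sets emeasure_ball_finite)

section \<open>Pointwise symmetry of the kernel\<close>

lemma kernel_operator_L2:
  assumes t: "0 < t" and g: "g \<in> L2_space M"
  shows "kernel_operator M p t g \<in> L2_space M"
proof -
  have m: "kernel_operator M p t g \<in> borel_measurable M"
    by (intro kernel_operator_measurable t L2_measurable g)
  have P2: "P t g \<in> L2_space M" by (rule semigroup_L2[OF t g])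
  have "integrable M (\<lambda>x. (kernel_operator M p t g x)\<^sup>2)"
  proof (rule integrable_cong_AE_imp[where g = "\<lambda>x. (P t g x)\<^sup>2"])
    show "integrable M (\<lambda>x. (P t g x)\<^sup>2)" using P2 by (simp add: L2_space_def)
    show "AE x in M. (P t g x)\<^sup>2 = (kernel_operator M p t g x)\<^sup>2"
      using P_kernel[OF t g] by eventually_elim simp
  qed (use m in simp)
  then show ?thesis using m by (simp add: L2_space_def)
qed

lemma kernel_operator_sym:
  assumes t: "0 < t" and f: "f \<in> L2_space M" and g: "g \<in> L2_space M"
  shows "L2_inner M (kernel_operator M p t f) g = L2_inner M f (kernel_operator M p t g)"
proof -
  have "L2_inner M (kernel_operator M p t f) g = L2_inner M (P t f) g"
    using P_kernel[OF t f] by (intro L2_inner_cong_AE L2_measurable kernel_operator_L2 semigroup_L2 t f g) auto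
  also have "\<dots> = L2_inner M f (P t g)" by (rule semigroup_sym[OF f g t])
  also have "\<dots> = L2_inner M f (kernel_operator M p t g)"
    using P_kernel[OF t g] by (intro L2_inner_cong_AE L2_measurable kernel_operator_L2 semigroup_L2 t f g) auto
  finally show ?thesis .
qed

lemma kernel_operator_ball_le:
  assumes z: "good z" and t: "0 < t" and le: "\<And>y. y \<in> ball x r \<Longrightarrow> p t z y \<le> c"
  shows "kernel_operator M p t (indicator (ball x r)) z \<le> c * measure M (ball x r)"
proof -
  have fin: "emeasure M (ball x r) < top" using emeasure_ball_finite[of x r] by simp
  have "kernel_operator M p t (indicator (ball x r)) z \<le> (\<integral>y. c * indicator (ball x r) y \<partial>M)"
    unfolding kernel_operator_def
    using le fin by (intro integral_mono good_integrable[OF z t, where B = 1])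
      (auto simp: integrable_indicator_iff split: split_indicator)
  also have "\<dots> = c * measure M (ball x r)" using fin by simp
  finally show ?thesis .
qed

lemma kernel_operator_ball_ge:
  assumes z: "good z" and t: "0 < t" and ge: "\<And>y. y \<in> ball x r \<Longrightarrow> c \<le> p t z y"
  shows "c * measure M (ball x r) \<le> kernel_operator M p t (indicator (ball x r)) z"
proof -
  have fin: "emeasure M (ball x r) < top" using emeasure_ball_finite[of x r] by simp
  have "c * measure M (ball x r) = (\<integral>y. c * indicator (ball x r) y \<partial>M)" using fin by simp
  also have "\<dots> \<le> kernel_operator M p t (indicator (ball x r)) z"
    unfolding kernel_operator_def
    using ge fin by (intro integral_mono good_integrable[OF z t, where B = 1])
      (auto simp: integrable_indicator_iff split: split_indicator)
  finally show ?thesis .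
qed

text \<open>A strict inequality at one pair would persist on small balls A around x0 and B around
  y0. Pairing the operator with the indicators of A and B would then contradict its symmetry,
  because balls have positive measure.\<close>

lemma p_sym_le:
  assumes t: "0 < t"
  shows "p t x0 y0 \<le> p t y0 x0"
proof (rule ccontr)
  assume "\<not> p t x0 y0 \<le> p t y0 x0"
  define D where "D = p t x0 y0 - p t y0 x0"
  \<comment> \<open>Thirds of the gap D: both values may vary by D/3, and u still exceeds l by D/3.
    Here u is a lower bound for p t on A \<times> B and l an upper bound on B \<times> A.\<close>
  define u where "u = p t x0 y0 - D / 3"
  define l where "l = p t y0 x0 + D / 3"
  have D: "0 < D" using \<open>\<not> p t x0 y0 \<le> p t y0 x0\<close> by (simp add: D_def)
  have "u - l = D / 3" by (simp add: l_def u_def D_def field_simps)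
  then have lu: "l < u" using D by linarith
  have nbhd: "\<exists>r>0. \<forall>x\<in>ball a r. \<forall>y\<in>ball b r. \<bar>p t x y - p t a b\<bar> < D / 3" for a b
  proof -
    have "isCont (\<lambda>(x, y). p t x y) (a, b)"
      using p_continuous[OF t] by (simp add: continuous_on_eq_continuous_at)
    then obtain e where e: "0 < e" "\<And>z. dist z (a, b) < e \<Longrightarrow> \<bar>(\<lambda>(x, y). p t x y) z - p t a b\<bar> < D / 3"
      unfolding continuous_at_eps_delta using D
      by (metis (no_types, lifting) case_prod_conv dist_real_def zero_less_divide_iff zero_less_numeral)
    show ?thesis
    proof (intro exI[of _ "e / 2"] conjI ballI)
      fix x y assume "x \<in> ball a (e / 2)" "y \<in> ball b (e / 2)"
      then have "dist x a + dist y b < e" by (simp add: dist_commute)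
      moreover have "dist (x, y) (a, b) \<le> dist x a + dist y b"
        by (simp add: dist_Pair_Pair sqrt_sum_squares_le_sum)
      ultimately show "\<bar>p t x y - p t a b\<bar> < D / 3" using e(2)[of "(x, y)"] by simp
    qed (use e in simp)
  qed
  obtain r1 r2 where r1: "0 < r1" "\<And>x y. x \<in> ball x0 r1 \<Longrightarrow> y \<in> ball y0 r1 \<Longrightarrow> \<bar>p t x y - p t x0 y0\<bar> < D / 3"
    and r2: "0 < r2" "\<And>x y. x \<in> ball y0 r2 \<Longrightarrow> y \<in> ball x0 r2 \<Longrightarrow> \<bar>p t x y - p t y0 x0\<bar> < D / 3"
    using nbhd[of x0 y0] nbhd[of y0 x0] by blast
  define r where "r = min r1 r2"
  have r: "0 < r" using r1 r2 by (simp add: r_def)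
  define A where "A = ball x0 r"
  define B where "B = ball y0 r"
  have up: "u \<le> p t x y" if "x \<in> A" "y \<in> B" for x y
  proof -
    have "\<bar>p t x y - p t x0 y0\<bar> < D / 3" using that by (intro r1(2)) (auto simp: A_def B_def r_def)
    then show ?thesis unfolding u_def by linarith
  qed
  have lo: "p t y x \<le> l" if "x \<in> A" "y \<in> B" for x y
  proof -
    have "\<bar>p t y x - p t y0 x0\<bar> < D / 3" using that by (intro r2(2)) (auto simp: A_def B_def r_def)
    then show ?thesis unfolding l_def by linarith
  qed
  have AB [measurable]: "A \<in> sets M" "B \<in> sets M" by (simp_all add: A_def B_def)
  have fin: "emeasure M A < top" "emeasure M B < top"
    using emeasure_ball_finite by (simp_all add: A_def B_def)
  have pos: "0 < measure M A" "0 < measure M B"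
    using measure_ball_lower[OF r] c1_pos r
    by (metis A_def B_def less_le_trans mult_pos_pos powr_gt_zero less_numeral_extra(3))+
  let ?KA = "kernel_operator M p t (indicator A)" and ?KB = "kernel_operator M p t (indicator B)"
  have L2: "indicator A \<in> L2_space M" "indicator B \<in> L2_space M"
    by (simp_all add: A_def B_def ball_indicator_L2)
  have "u * measure M B * measure M A = (\<integral>x. u * measure M B * indicator A x \<partial>M)" using fin by simp
  also have "\<dots> \<le> (\<integral>x. ?KB x * indicator A x \<partial>M)"
  proof (rule integral_mono_AE)
    show "integrable M (\<lambda>x. ?KB x * indicator A x)"
      by (intro L2_mult_integrable kernel_operator_L2 L2 t)
    show "AE x in M. u * measure M B * indicator A x \<le> ?KB x * indicator A x"
      using AE_good
    proof eventually_elim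
      case (elim x)
      show ?case
        using kernel_operator_ball_ge[OF elim t, of y0 r u] up[of x]
        by (auto simp: B_def split: split_indicator)
    qed
  qed (use fin in \<open>simp add: integrable_indicator_iff\<close>)
  also have "\<dots> = (\<integral>y. indicator B y * ?KA y \<partial>M)"
    using kernel_operator_sym[OF t L2(2,1)] by (simp add: L2_inner_def)
  also have "\<dots> \<le> (\<integral>y. l * measure M A * indicator B y \<partial>M)"
  proof (rule integral_mono_AE)
    show "integrable M (\<lambda>x. indicator B x * ?KA x)"
      by (intro L2_mult_integrable kernel_operator_L2 L2 t)
    show "AE y in M. indicator B y * ?KA y \<le> l * measure M A * indicator B y"
      using AE_good
    proof eventually_elim
      case (elim y)
      show ?case
        using kernel_operator_ball_le[OF elim t, of x0 r l] lo[of _ y]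
        by (auto simp: A_def split: split_indicator)
    qed
  qed (use fin in \<open>simp add: integrable_indicator_iff\<close>)
  also have "\<dots> = l * measure M A * measure M B" using fin by simp
  finally have "u * (measure M A * measure M B) \<le> l * (measure M A * measure M B)"
    by (simp add: mult_ac)
  then show False using pos lu by simp
qed

lemma p_sym: "0 < t \<Longrightarrow> p t x y = p t y x"
  by (intro antisym p_sym_le)

text \<open>Conservativeness is not part of the hypotheses. By the weak Bakry-Emery estimate the
  oscillation of \<open>P\<^sub>t 1\<close> tends to \<open>0\<close> as \<open>t \<rightarrow> \<infinity>\<close>, and \<open>P\<^sub>t 1\<close> stays between two positive constants;
  so \<open>P\<^sub>t 1\<close> subconverges to a constant \<open>c > 0\<close>, and \<open>c P\<^sub>s 1 = lim P\<^sub>s P\<^sub>t 1 = lim P\<^sub>s\<^sub>+\<^sub>t 1\<close> is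
  constant. The constants form a bounded multiplicative semigroup, hence equal \<open>1\<close>.\<close>

lemma Linf_bounded:
  assumes [measurable]: "g \<in> borel_measurable M" and g: "AE x in M. \<bar>g x\<bar> \<le> 1"
  shows "g \<in> Linf_space M" "enn2real (Linf_norm M g) \<le> 1"
proof -
  have "Linf_norm M g \<le> 1"
    unfolding Linf_norm_def using g by (intro esssup_I) (auto elim!: AE_mp simp: ennreal_le_1)
  then show "g \<in> Linf_space M" "enn2real (Linf_norm M g) \<le> 1"
    using enn2real_mono[of "Linf_norm M g" 1] by (auto simp: Linf_space_def intro: le_less_trans)
qed

lemma kernel_operator_Holder:
  assumes t: "0 < t" and gm: "g \<in> borel_measurable M" and g: "AE x in M. \<bar>g x\<bar> \<le> 1"
  shows "\<bar>kernel_operator M p t g x - kernel_operator M p t g y\<bar> \<le>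
     c7 * t powr (- \<kappa> / d_W) * dist x y powr \<kappa>"
proof -
  have "\<bar>kernel_operator M p t g x - kernel_operator M p t g y\<bar> \<le>
      c7 * (dist x y powr \<kappa> / t powr (\<kappa> / d_W)) * enn2real (Linf_norm M g)"
    by (rule wBE_bound[OF t Linf_bounded(1)[OF gm g]])
  also have "\<dots> \<le> c7 * (dist x y powr \<kappa> / t powr (\<kappa> / d_W)) * 1"
    using const_pos by (intro mult_left_mono Linf_bounded(2)[OF gm g]) auto
  finally show ?thesis by (simp add: powr_minus field_simps)
qed

text \<open>The semigroup law is available on L2 only. It is applied to indicators of growing balls,
  and dominated convergence is used in the inner and then in the outer integral.\<close>

lemma mass_semigroup:
  assumes s: "0 < s" and t: "0 < t"
  shows "AE x in M. kernel_operator M p s (mass t) x = mass (s + t) x"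
proof -
  define f where "f n = (indicator (ball undefined (real n)) :: 'a \<Rightarrow> real)" for n :: nat
  have L2: "f n \<in> L2_space M" for n by (simp add: f_def ball_indicator_L2)
  have fm [measurable]: "f n \<in> borel_measurable M" for n by (rule L2_measurable[OF L2])
  have f1: "\<bar>f n y\<bar> \<le> 1" for n y by (simp add: f_def indicator_def)
  have flim: "(\<lambda>n. f n y) \<longlonglongrightarrow> 1" for y
  proof (rule tendsto_eventually)
    obtain N :: nat where N: "dist undefined y < real N" using reals_Archimedean2 by blast
    show "eventually (\<lambda>n. f n y = 1) sequentially"
      using eventually_ge_at_top[of N]
      by eventually_elim (use N in \<open>auto simp: f_def indicator_def\<close>)
  qed
  note p_section_measurable[OF s, measurable] p_section_measurable[OF t, measurable]
    p_section_measurable[of "s + t", measurable]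
  have lim1: "(\<lambda>n. kernel_operator M p u (f n) x) \<longlonglongrightarrow> mass u x" if u: "0 < u" and x: "good x" for u x
    unfolding kernel_operator_def
  proof (rule integral_dominated_convergence[where w = "\<lambda>y. p u x y"])
    note p_section_measurable[OF u, measurable]
    show "(\<lambda>y. p u x y * 1) \<in> borel_measurable M" "(\<lambda>y. p u x y * f n y) \<in> borel_measurable M" for n
      by measurable
    show "AE y in M. (\<lambda>n. p u x y * f n y) \<longlonglongrightarrow> p u x y * 1"
      by (intro AE_I2 tendsto_intros flim)
    show "AE y in M. norm (p u x y * f n y) \<le> p u x y" for n
      using good_p_pos[OF x u] by eventually_elim (use f1 in \<open>simp add: abs_mult mult_left_le\<close>)
  qed (rule good_integrable_p[OF x u])
  have comp: "AE x in M. \<forall>n. kernel_operator M p s (kernel_operator M p t (f n)) x = kernel_operator M p (s + t) (f n) x"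
  proof (subst AE_all_countable, rule allI)
    fix n
    have Kt: "kernel_operator M p t (f n) \<in> L2_space M" by (rule kernel_operator_L2[OF t L2])
    have "AE x in M. P s (P t (f n)) x = P (s + t) (f n) x" by (rule semigroup_comp[OF s t L2])
    moreover have "AE x in M. P s (P t (f n)) x = P s (kernel_operator M p t (f n)) x"
      by (rule semigroup_cong[OF s semigroup_L2[OF t L2] Kt P_kernel[OF t L2]])
    moreover have "AE x in M. P s (kernel_operator M p t (f n)) x = kernel_operator M p s (kernel_operator M p t (f n)) x"
      by (rule P_kernel[OF s Kt])
    moreover have "AE x in M. P (s + t) (f n) x = kernel_operator M p (s + t) (f n) x"
      using s t by (intro P_kernel L2) simp
    ultimately show "AE x in M. kernel_operator M p s (kernel_operator M p t (f n)) x = kernel_operator M p (s + t) (f n) x"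
      by eventually_elim simp
  qed
  show ?thesis
    using AE_good comp
  proof eventually_elim
    case (elim x)
    have "(\<lambda>n. kernel_operator M p s (kernel_operator M p t (f n)) x) \<longlonglongrightarrow> kernel_operator M p s (mass t) x"
      unfolding kernel_operator_def[of M p s]
    proof (rule integral_dominated_convergence[where w = "\<lambda>y. mass_upper * p s x y"])
      show "(\<lambda>y. p s x y * mass t y) \<in> borel_measurable M"
        "(\<lambda>y. p s x y * kernel_operator M p t (f n) y) \<in> borel_measurable M" for n
        using kernel_operator_measurable[OF t] by simp_all
      show "integrable M (\<lambda>y. mass_upper * p s x y)" using good_integrable_p[OF elim(1) s] by simp
      show "AE y in M. (\<lambda>n. p s x y * kernel_operator M p t (f n) y) \<longlonglongrightarrow> p s x y * mass t y"
        using AE_good by eventually_elim (intro tendsto_intros lim1 t)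
      show "AE y in M. norm (p s x y * kernel_operator M p t (f n) y) \<le> mass_upper * p s x y" for n
        using AE_good good_p_pos[OF elim(1) s]
      proof eventually_elim
        case (elim y)
        have "\<bar>kernel_operator M p t (f n) y\<bar> \<le> 1 * mass t y"
          by (rule kernel_operator_bound[OF elim(1) t fm]) (use f1 in simp)
        also have "\<dots> \<le> mass_upper" using mass_bounds(2)[OF elim(1) t] by simp
        finally show ?case using elim(2) by (simp add: abs_mult mult.commute)
      qed
    qed
    moreover have "(\<lambda>n. kernel_operator M p s (kernel_operator M p t (f n)) x) \<longlonglongrightarrow> mass (s + t) x"
      using lim1[of "s + t" x] elim s t by simp
    ultimately show ?case by (rule LIMSEQ_unique)
  qed
qed

text \<open>Balls have positive measure, so a set of full measure is non-empty. Applied to a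
  statement about constants, this removes the "almost everywhere".\<close>

lemma AE_ex: "AE x in M. Q x \<Longrightarrow> \<exists>x. Q x"
proof (rule ccontr)
  assume Q: "AE x in M. Q x" and "\<nexists>x. Q x"
  then have "AE x in M. False" by simp
  then obtain N where N: "N \<in> null_sets M" "UNIV \<subseteq> N" by (auto simp: eventually_ae_filter)
  then have "emeasure M (ball undefined 1) \<le> emeasure M N" by (intro emeasure_mono) auto
  then show False using emeasure_ball_pos[of 1 undefined] N by (auto simp: null_sets_def)
qed

lemma mass_AE_const:
  assumes s: "0 < s"
  shows "\<exists>a. AE x in M. mass s x = a"
proof -
  obtain x0 where x0: "good x0" using AE_ex[OF AE_good] by blast
  \<comment> \<open>The subsequence is extracted at the single point x0; the decay of the
    oscillation then carries the limit to every point.\<close>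
  have "\<exists>l\<in>{mass_lower..mass_upper}. \<exists>r. strict_mono r \<and> ((\<lambda>n. mass (real (Suc n)) x0) \<circ> r) \<longlonglongrightarrow> l"
    using compact_Icc[unfolded compact_def] mass_bounds[OF x0] by auto
  then obtain c r where c: "mass_lower \<le> c" and r: "strict_mono r"
    and lim0: "(\<lambda>n. mass (real (Suc (r n))) x0) \<longlonglongrightarrow> c"
    by (auto simp: o_def)
  have osc: "(\<lambda>n. mass (u + real (Suc (r n))) x - mass (u + real (Suc (r n))) y) \<longlonglongrightarrow> 0"
    if u: "0 \<le> u" for x y u
  proof (rule tendsto_rabs_zero_cancel, rule tendsto_sandwich[OF _ _ tendsto_const])
    have "filterlim (\<lambda>n. u + real (Suc (r n))) at_top sequentially"
      by (intro filterlim_tendsto_add_at_top[OF tendsto_const]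
          filterlim_compose[OF filterlim_real_sequentially] filterlim_compose[OF filterlim_Suc]
          filterlim_subseq r)
    then have "(\<lambda>n. (u + real (Suc (r n))) powr (- \<kappa> / d_W)) \<longlonglongrightarrow> 0"
      using \<kappa> by (intro tendsto_neg_powr) auto
    then show "(\<lambda>n. c7 * (u + real (Suc (r n))) powr (- \<kappa> / d_W) * dist x y powr \<kappa>) \<longlonglongrightarrow> 0"
      by (intro tendsto_mult_left_zero tendsto_mult_right_zero)
    show "eventually (\<lambda>n. \<bar>mass (u + real (Suc (r n))) x - mass (u + real (Suc (r n))) y\<bar> \<le>
        c7 * (u + real (Suc (r n))) powr (- \<kappa> / d_W) * dist x y powr \<kappa>) sequentially"
      using u by (intro always_eventually allI kernel_operator_Holder) auto
  qed simp
  have lim: "(\<lambda>n. mass (real (Suc (r n))) z) \<longlonglongrightarrow> c" for z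
    using tendsto_add[OF osc[of 0 z x0] lim0] by simp
  have "AE x in M. \<forall>n. kernel_operator M p s (mass (real (Suc (r n)))) x = mass (s + real (Suc (r n))) x"
    by (subst AE_all_countable, intro allI mass_semigroup s) simp
  then have "AE x in M. good x \<and> (\<lambda>n. mass (s + real (Suc (r n))) x) \<longlonglongrightarrow> c * mass s x"
    using AE_good
  proof eventually_elim
    case (elim x)
    note p_section_measurable[OF s, measurable]
    have "(\<lambda>n. kernel_operator M p s (mass (real (Suc (r n)))) x) \<longlonglongrightarrow> (\<integral>y. p s x y * c \<partial>M)"
      unfolding kernel_operator_def[of M p s]
    proof (rule integral_dominated_convergence[where w = "\<lambda>y. mass_upper * p s x y"])
      show "(\<lambda>y. p s x y * mass (real (Suc (r n))) y) \<in> borel_measurable M" for n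
        using kernel_operator_measurable[of "real (Suc (r n))" "\<lambda>_. 1"] by simp
      show "integrable M (\<lambda>y. mass_upper * p s x y)" using good_integrable_p[OF elim(2) s] by simp
      show "AE y in M. (\<lambda>n. p s x y * mass (real (Suc (r n))) y) \<longlonglongrightarrow> p s x y * c"
        by (intro AE_I2 tendsto_intros lim)
      show "AE y in M. norm (p s x y * mass (real (Suc (r n))) y) \<le> mass_upper * p s x y" for n
        using AE_good good_p_pos[OF elim(2) s]
      proof eventually_elim
        case (elim y)
        have "\<bar>mass (real (Suc (r n))) y\<bar> \<le> mass_upper"
          using mass_bounds(2)[OF elim(1)] mass_nonneg[OF elim(1)] by simp
        then show ?case using elim(2) by (simp add: abs_mult mult.commute)
      qed
    qed simp
    then show ?case using elim by (simp add: kernel_operator_def mult.commute)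
  qed
  then have ae: "AE x in M. good x \<and> (\<lambda>n. mass (s + real (Suc (r n))) x) \<longlonglongrightarrow> c * mass s x" .
  obtain x1 where x1: "(\<lambda>n. mass (s + real (Suc (r n))) x1) \<longlonglongrightarrow> c * mass s x1"
    using AE_ex[OF ae] by blast
  from ae have "AE x in M. mass s x = mass s x1"
  proof eventually_elim
    case (elim x)
    have "(\<lambda>n. mass (s + real (Suc (r n))) x - mass (s + real (Suc (r n))) x1) \<longlonglongrightarrow> c * mass s x - c * mass s x1"
      using elim x1 by (intro tendsto_diff) auto
    \<comment> \<open>Both limits come from the same sequence of times, whose oscillation vanishes;
      c > 0 then permits cancellation.\<close>
    with osc[of s x x1] s have "c * mass s x - c * mass s x1 = 0"
      using LIMSEQ_unique by fastforce
    then show ?case using c mass_lower_pos by simp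
  qed
  then show ?thesis by blast
qed

lemma conservative:
  assumes t: "0 < t"
  shows "AE x in M. mass t x = 1"
proof -
  obtain a where a: "\<And>s. 0 < s \<Longrightarrow> AE x in M. mass s x = a s"
    using mass_AE_const by metis
  have bounds: "mass_lower \<le> a s" "a s \<le> mass_upper" if s: "0 < s" for s
  proof -
    have "AE x in M. mass_lower \<le> a s \<and> a s \<le> mass_upper"
      using a[OF s] AE_good
    proof eventually_elim
      case (elim x)
      then show ?case using mass_bounds[OF elim(2) s] by simp
    qed
    from AE_ex[OF this] show "mass_lower \<le> a s" "a s \<le> mass_upper" by auto
  qed
  have mult: "a (s + u) = a s * a u" if s: "0 < s" and u: "0 < u" for s u
  proof -
    have "kernel_operator M p s (mass u) x = kernel_operator M p s (\<lambda>_. a u) x" for x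
      by (intro kernel_operator_cong_AE s kernel_operator_measurable u a) auto
    then have 1: "kernel_operator M p s (mass u) x = a u * mass s x" for x
      by (simp add: kernel_operator_def mult.commute)
    have "AE x in M. a (s + u) = a s * a u"
      using mass_semigroup[OF s u] a[OF s] a[of "s + u", OF add_pos_pos[OF s u]]
      by eventually_elim (simp add: 1 mult.commute)
    then show ?thesis using AE_ex by blast
  qed
  have pow: "a (real (Suc n) * t) = a t ^ Suc n" for n
  proof (induction n)
    case (Suc n)
    have "real (Suc (Suc n)) * t = real (Suc n) * t + t" by (simp add: algebra_simps)
    then show ?case using mult[of "real (Suc n) * t" t] t Suc by simp
  qed simp
  have pb: "mass_lower \<le> a t ^ Suc n" "a t ^ Suc n \<le> mass_upper" for n
    using bounds[of "real (Suc n) * t"] pow[of n] t by simp_all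
  have pos: "0 < a t" using bounds(1)[OF t] mass_lower_pos by simp
  have "\<not> 1 < a t"
  proof
    assume 1: "1 < a t"
    obtain n where "mass_upper < a t ^ n" using real_arch_pow[OF 1] by blast
    also have "\<dots> \<le> a t ^ Suc n" using 1 by (intro power_increasing) auto
    finally show False using pb(2)[of n] by simp
  qed
  moreover have "\<not> a t < 1"
  proof
    assume 1: "a t < 1"
    obtain n where n: "a t ^ n < mass_lower" using real_arch_pow_inv[OF mass_lower_pos 1] by blast
    have "a t ^ Suc n \<le> a t ^ n" using 1 pos by (intro power_decreasing) auto
    then show False using pb(1)[of n] n by simp
  qed
  ultimately have "a t = 1" by simp
  then show ?thesis using a[OF t] by simp
qed

end

section \<open>Heat energies at different times\<close>

text \<open>The sum against the integral of x^(-b) over [0, m]. The induction step is the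
  tangent-line inequality for the concave function x^(1-b), obtained from Young's
  inequality.\<close>

lemma sum_powr_le:
  fixes b :: real
  assumes b: "0 < b" "b < 1"
  shows "(\<Sum>k<m. real (Suc k) powr (- b)) \<le> real m powr (1 - b) / (1 - b)"
proof (induction m)
  case (Suc m)
  have "(1 - b) * real (Suc m) powr (- b) + real m powr (1 - b) \<le> real (Suc m) powr (1 - b)"
  proof (cases "m = 0")
    case False
    define n where "n = real (Suc m)"
    have n: "0 < n" and m: "real m = n - 1" "0 < real m" using False by (auto simp: n_def)
    have split: "n powr (1 - b) = n * n powr (- b)" using n by (simp add: powr_diff powr_minus field_simps)
    \<comment> \<open>Weighted arithmetic-geometric mean of m/n and 1 with weights 1 - b and
      b.\<close>
    have "(real m / n) powr (1 - b) * 1 powr b \<le> (1 - b) * (real m / n) + b * 1"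
      using b m n by (intro Youngs_inequality_0) auto
    also have "\<dots> = (n - (1 - b)) / n" unfolding m(1) using n by (simp add: field_simps)
    finally have "real m powr (1 - b) / n powr (1 - b) \<le> (n - (1 - b)) / n"
      using m n by (simp add: powr_divide)
    then have "real m powr (1 - b) \<le> (n - (1 - b)) / n * n powr (1 - b)"
      using n by (simp add: pos_divide_le_eq)
    also have "\<dots> = (n - (1 - b)) * n powr (- b)" unfolding split using n by simp
    finally have "real m powr (1 - b) \<le> n powr (1 - b) - (1 - b) * n powr (- b)"
      unfolding split by (simp add: algebra_simps)
    then show ?thesis by (simp add: n_def)
  qed (use b in simp)
  then have "((1 - b) * real (Suc m) powr (- b) + real m powr (1 - b)) / (1 - b) \<le> real (Suc m) powr (1 - b) / (1 - b)"
    using b by (intro divide_right_mono) auto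
  then have "real (Suc m) powr (- b) + real m powr (1 - b) / (1 - b) \<le> real (Suc m) powr (1 - b) / (1 - b)"
    using b by (simp add: add_divide_distrib del: of_nat_Suc)
  with Suc show ?case by simp
qed simp

context wBE_heat_space
begin

definition heat_energy :: "('a \<Rightarrow> real) \<Rightarrow> real \<Rightarrow> ennreal" where
  "heat_energy f t = (\<integral>\<^sup>+z. ennreal \<bar>f (fst z) - f (snd z)\<bar> * ennreal (p t (fst z) (snd z)) \<partial>(M \<Otimes>\<^sub>M M))"

text \<open>The energy with the weight d(x,y)^\<kappa> that the weak Bakry-Emery estimate produces
  from the increments of P_s h.\<close>

definition heat_moment :: "('a \<Rightarrow> real) \<Rightarrow> real \<Rightarrow> ennreal" where
  "heat_moment f t = (\<integral>\<^sup>+z. ennreal \<bar>f (fst z) - f (snd z)\<bar> *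
     (ennreal (p t (fst z) (snd z)) * ennreal (dist (fst z) (snd z) powr \<kappa>)) \<partial>(M \<Otimes>\<^sub>M M))"

text \<open>Integrating out the second variable gives h - P_t h for the indicator h of A;
  antisymmetry under exchange of the variables allows symmetrisation.\<close>

definition jump :: "'a set \<Rightarrow> real \<Rightarrow> 'a \<times> 'a \<Rightarrow> real" where
  "jump A t z = (indicator A (fst z) - indicator A (snd z)) * p t (fst z) (snd z)"

lemma jump_measurable:
  assumes t: "0 < t" and [measurable]: "A \<in> sets M"
  shows "jump A t \<in> borel_measurable (M \<Otimes>\<^sub>M M)"
proof -
  note p_measurable[OF t, measurable]
  show ?thesis unfolding jump_def by measurable
qed

lemma jump_integrable:
  assumes t: "0 < t" and A [measurable]: "A \<in> sets M" and fin: "emeasure M A < \<infinity>"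
  shows "integrable (M \<Otimes>\<^sub>M M) (jump A t)"
proof -
  note p_measurable[OF t, measurable]
  have 1: "integrable (M \<Otimes>\<^sub>M M) (\<lambda>z. indicator A (fst z) * p t (fst z) (snd z))"
  proof (rule integrableI_nonneg)
    show "AE z in M \<Otimes>\<^sub>M M. 0 \<le> indicator A (fst z) * p t (fst z) (snd z)"
      using AE_p_pos[OF t] by eventually_elim (simp add: indicator_def)
    have "(\<integral>\<^sup>+z. ennreal (indicator A (fst z) * p t (fst z) (snd z)) \<partial>(M \<Otimes>\<^sub>M M)) =
        (\<integral>\<^sup>+x. \<integral>\<^sup>+y. ennreal (indicator A x * p t x y) \<partial>M \<partial>M)"
      by (subst nn_integral_pair) simp_all
    also have "\<dots> \<le> (\<integral>\<^sup>+x. ennreal mass_upper * indicator A x \<partial>M)"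
    proof (rule nn_integral_mono_AE)
      show "AE x in M. (\<integral>\<^sup>+y. ennreal (indicator A x * p t x y) \<partial>M) \<le> ennreal mass_upper * indicator A x"
        using AE_good
      proof eventually_elim
        case (elim x)
        then show ?case using good_mass_le[OF elim t] by (simp split: split_indicator)
      qed
    qed
    also have "\<dots> = ennreal mass_upper * emeasure M A" by (simp add: nn_integral_cmult)
    also have "\<dots> < \<infinity>" using fin by (simp add: ennreal_mult_less_top)
    finally show "(\<integral>\<^sup>+z. ennreal (indicator A (fst z) * p t (fst z) (snd z)) \<partial>(M \<Otimes>\<^sub>M M)) < \<infinity>" .
  qed measurable
  have 2: "integrable (M \<Otimes>\<^sub>M M) (\<lambda>z. indicator A (snd z) * p t (fst z) (snd z))"
    using pair.integrable_product_swap[OF 1] p_sym[OF t] by (simp add: split_beta')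
  have "integrable (M \<Otimes>\<^sub>M M) (\<lambda>z. indicator A (fst z) * p t (fst z) (snd z) - indicator A (snd z) * p t (fst z) (snd z))"
    by (rule Bochner_Integration.integrable_diff[OF 1 2])
  then show ?thesis by (simp add: jump_def[abs_def] left_diff_distrib)
qed

text \<open>The Dirichlet form of the kernel \<open>p\<^sub>t\<close>, by symmetrisation; conservativeness gives
  \<open>h - P\<^sub>t h = \<integral> p\<^sub>t(\<cdot>, y) (h - h(y)) d\<mu>(y)\<close>.\<close>

lemma L2_inner_jump:
  assumes t: "0 < t" and A [measurable]: "A \<in> sets M" and fin: "emeasure M A < \<infinity>"
    and G [measurable]: "G \<in> borel_measurable M" and B: "AE x in M. \<bar>G x\<bar> \<le> B"
  shows "integrable (M \<Otimes>\<^sub>M M) (\<lambda>z. (G (fst z) - G (snd z)) * jump A t z)"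
    and "2 * L2_inner M G (\<lambda>x. indicator A x - kernel_operator M p t (indicator A) x) =
      (\<integral>z. (G (fst z) - G (snd z)) * jump A t z \<partial>(M \<Otimes>\<^sub>M M))"
proof -
  note jump_measurable[OF t A, measurable] p_section_measurable[OF t, measurable]
    kernel_operator_measurable[OF t, measurable]
  have Bz: "AE z in M \<Otimes>\<^sub>M M. \<bar>G (fst z)\<bar> \<le> B"
  proof (rule pair.AE_pair_measure)
    show "{z \<in> space (M \<Otimes>\<^sub>M M). \<bar>G (fst z)\<bar> \<le> B} \<in> sets (M \<Otimes>\<^sub>M M)" by measurable
    show "AE x in M. AE y in M. \<bar>G (fst (x, y))\<bar> \<le> B" using B by eventually_elim simp
  qed
  have 1: "integrable (M \<Otimes>\<^sub>M M) (\<lambda>z. G (fst z) * jump A t z)"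
  proof (rule Bochner_Integration.integrable_bound)
    show "integrable (M \<Otimes>\<^sub>M M) (\<lambda>z. B * jump A t z)" using jump_integrable[OF t A fin] by simp
    show "AE z in M \<Otimes>\<^sub>M M. norm (G (fst z) * jump A t z) \<le> norm (B * jump A t z)"
      using Bz by eventually_elim (auto simp: abs_mult intro!: mult_right_mono)
  qed measurable
  \<comment> \<open>Antisymmetry makes the G(fst) and G(snd) integrals opposite, which is the source
    of the factor 2.\<close>
  have anti: "jump A t (snd z, fst z) = - jump A t z" for z
    using p_sym[OF t, of "fst z" "snd z"] by (simp add: jump_def algebra_simps)
  have 2: "integrable (M \<Otimes>\<^sub>M M) (\<lambda>z. G (snd z) * jump A t z)"
    using pair.integrable_product_swap[OF 1] anti by (simp add: split_beta')
  have 3: "(\<integral>z. G (fst z) * jump A t z \<partial>(M \<Otimes>\<^sub>M M)) = - (\<integral>z. G (snd z) * jump A t z \<partial>(M \<Otimes>\<^sub>M M))"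
    using pair.integral_product_swap[of "\<lambda>z. G (fst z) * jump A t z"] anti by (simp add: split_beta')
  show "integrable (M \<Otimes>\<^sub>M M) (\<lambda>z. (G (fst z) - G (snd z)) * jump A t z)"
    using Bochner_Integration.integrable_diff[OF 1 2] by (simp add: left_diff_distrib)
  have "(\<integral>z. G (fst z) * jump A t z \<partial>(M \<Otimes>\<^sub>M M)) = (\<integral>x. \<integral>y. G x * jump A t (x, y) \<partial>M \<partial>M)"
    using pair.integral_fst'[OF 1] by simp
  also have "\<dots> = L2_inner M G (\<lambda>x. indicator A x - kernel_operator M p t (indicator A) x)"
    unfolding L2_inner_def
  proof (rule integral_cong_AE)
    show "AE x in M. (\<integral>y. G x * jump A t (x, y) \<partial>M) = G x * (indicator A x - kernel_operator M p t (indicator A) x)"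
      using AE_good conservative[OF t]
    proof eventually_elim
      case (elim x)
      have "(\<integral>y. jump A t (x, y) \<partial>M) = (\<integral>y. indicator A x * (p t x y * 1) - p t x y * indicator A y \<partial>M)"
        by (simp add: jump_def algebra_simps)
      also have "\<dots> = indicator A x * mass t x - kernel_operator M p t (indicator A) x"
        using good_integrable[OF elim(1) t, of "indicator A" 1] good_integrable_p[OF elim(1) t]
        by (simp add: kernel_operator_def)
      finally show ?case using elim by simp
    qed
  qed measurable
  finally have "L2_inner M G (\<lambda>x. indicator A x - kernel_operator M p t (indicator A) x) =
     (\<integral>z. G (fst z) * jump A t z \<partial>(M \<Otimes>\<^sub>M M))" by simp
  then show "2 * L2_inner M G (\<lambda>x. indicator A x - kernel_operator M p t (indicator A) x) =
      (\<integral>z. (G (fst z) - G (snd z)) * jump A t z \<partial>(M \<Otimes>\<^sub>M M))"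
    using 1 2 3 by (simp add: left_diff_distrib)
qed

text \<open>The case G = h of the symmetrised identity. For an indicator, (h(x) - h(y))^2 is |h(x) -
  h(y)|, so the quadratic form of the kernel is an L1 energy.\<close>

lemma heat_energy_indicator:
  assumes t: "0 < t" and A [measurable]: "A \<in> sets M" and fin: "emeasure M A < \<infinity>"
  shows "heat_energy (indicator A) t =
     ennreal (2 * L2_inner M (indicator A) (\<lambda>x. indicator A x - kernel_operator M p t (indicator A) x))"
proof -
  let ?J = "\<lambda>z. (indicator A (fst z) - indicator A (snd z)) * jump A t z :: real"
  have B: "AE x in M. \<bar>indicator A x :: real\<bar> \<le> 1" by simp
  have eq: "?J z = \<bar>indicator A (fst z) - indicator A (snd z)\<bar> * p t (fst z) (snd z)" for z
    by (simp add: jump_def split: split_indicator)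
  have "heat_energy (indicator A) t = (\<integral>\<^sup>+z. ennreal (?J z) \<partial>(M \<Otimes>\<^sub>M M))"
    unfolding heat_energy_def eq by (simp add: ennreal_mult')
  also have "\<dots> = ennreal (\<integral>z. ?J z \<partial>(M \<Otimes>\<^sub>M M))"
  proof (rule nn_integral_eq_integral)
    show "AE z in M \<Otimes>\<^sub>M M. 0 \<le> ?J z"
      unfolding eq using AE_p_pos[OF t] by eventually_elim simp
  qed (rule L2_inner_jump(1)[OF t A fin _ B], measurable)
  also have "(\<integral>z. ?J z \<partial>(M \<Otimes>\<^sub>M M)) =
      2 * L2_inner M (indicator A) (\<lambda>x. indicator A x - kernel_operator M p t (indicator A) x)"
    by (rule L2_inner_jump(2)[OF t A fin _ B, symmetric]) measurable
  finally show ?thesis .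
qed

text \<open>The case G = P_s h: the increments of G are at most c7 s^(-\<kappa>/d_W)
  d(x,y)^\<kappa>, because |h| \<le> 1.\<close>

lemma L2_inner_kernel_le:
  assumes t: "0 < t" and s: "0 < s" and A [measurable]: "A \<in> sets M" and fin: "emeasure M A < \<infinity>"
  shows "ennreal \<bar>2 * L2_inner M (kernel_operator M p s (indicator A))
      (\<lambda>x. indicator A x - kernel_operator M p t (indicator A) x)\<bar> \<le>
    ennreal (c7 * s powr (- \<kappa> / d_W)) * heat_moment (indicator A) t"
proof -
  note p_measurable[OF t, measurable]
  let ?G = "kernel_operator M p s (indicator A)"
  have B1: "AE x in M. \<bar>indicator A x :: real\<bar> \<le> 1" by simp
  have Gm: "?G \<in> borel_measurable M" by (intro kernel_operator_measurable s) measurable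
  have B: "AE x in M. \<bar>?G x\<bar> \<le> mass_upper"
    using AE_good
  proof eventually_elim
    case (elim x)
    have "\<bar>?G x\<bar> \<le> 1 * mass s x" by (rule kernel_operator_bound[OF elim s _ B1]) measurable
    then show ?case using mass_bounds(2)[OF elim s] by simp
  qed
  let ?J = "\<lambda>z. (?G (fst z) - ?G (snd z)) * jump A t z"
  have "ennreal \<bar>2 * L2_inner M ?G (\<lambda>x. indicator A x - kernel_operator M p t (indicator A) x)\<bar> =
      ennreal (norm (\<integral>z. ?J z \<partial>(M \<Otimes>\<^sub>M M)))"
    unfolding L2_inner_jump(2)[OF t A fin Gm B] by simp
  also have "\<dots> \<le> (\<integral>\<^sup>+z. ennreal (norm (?J z)) \<partial>(M \<Otimes>\<^sub>M M))"
    by (rule integral_norm_bound_ennreal[OF L2_inner_jump(1)[OF t A fin Gm B]])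
  also have "\<dots> \<le> (\<integral>\<^sup>+z. ennreal (c7 * s powr (- \<kappa> / d_W)) *
     (ennreal \<bar>indicator A (fst z) - indicator A (snd z)\<bar> *
       (ennreal (p t (fst z) (snd z)) * ennreal (dist (fst z) (snd z) powr \<kappa>))) \<partial>(M \<Otimes>\<^sub>M M))"
  proof (rule nn_integral_mono_AE)
    show "AE z in M \<Otimes>\<^sub>M M. ennreal (norm (?J z)) \<le> ennreal (c7 * s powr (- \<kappa> / d_W)) *
     (ennreal \<bar>indicator A (fst z) - indicator A (snd z)\<bar> *
       (ennreal (p t (fst z) (snd z)) * ennreal (dist (fst z) (snd z) powr \<kappa>)))"
      using AE_p_pos[OF t]
    proof eventually_elim
      case (elim z)
      have "\<bar>?G (fst z) - ?G (snd z)\<bar> \<le> c7 * s powr (- \<kappa> / d_W) * dist (fst z) (snd z) powr \<kappa>"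
        by (rule kernel_operator_Holder[OF s _ B1]) measurable
      then have "norm (?J z) \<le> (c7 * s powr (- \<kappa> / d_W) * dist (fst z) (snd z) powr \<kappa>) * \<bar>jump A t z\<bar>"
        by (simp add: abs_mult mult_right_mono)
      also have "\<dots> = c7 * s powr (- \<kappa> / d_W) *
         (\<bar>indicator A (fst z) - indicator A (snd z)\<bar> * (p t (fst z) (snd z) * dist (fst z) (snd z) powr \<kappa>))"
        using elim by (simp add: jump_def abs_mult mult_ac)
      finally have "ennreal (norm (?J z)) \<le> ennreal (c7 * s powr (- \<kappa> / d_W) *
         (\<bar>indicator A (fst z) - indicator A (snd z)\<bar> * (p t (fst z) (snd z) * dist (fst z) (snd z) powr \<kappa>)))"
        by (rule ennreal_leI)
      then show ?case using elim const_pos by (simp add: ennreal_mult)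
    qed
  qed
  also have "\<dots> = ennreal (c7 * s powr (- \<kappa> / d_W)) * heat_moment (indicator A) t"
    unfolding heat_moment_def by (rule nn_integral_cmult) measurable
  finally show ?thesis .
qed

text \<open>The constant of the weak Bakry-Emery estimate times that of \<open>sum_powr_le\<close>
  for the exponent \<kappa>/d_W.\<close>

definition step_const :: real where
  "step_const = c7 / (1 - \<kappa> / d_W)"

lemma step_const_pos: "0 < step_const"
  using const_pos \<kappa> by (simp add: step_const_def)

text \<open>The term k = 0 of the telescope reproduces the energy at time t; the smoothing bound
  would blow up there. The others have weights (kt)^(-\<kappa>/d_W), whose sum is of order
  (mt)^(1-\<kappa>/d_W)/t.\<close>

lemma heat_energy_indicator_step:
  assumes t: "0 < t" and A [measurable]: "A \<in> sets M" and fin: "emeasure M A < \<infinity>"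
  shows "heat_energy (indicator A) (real (Suc m) * t) \<le> heat_energy (indicator A) t +
    ennreal (step_const * ((real (Suc m) * t) powr (1 - \<kappa> / d_W) / t)) * heat_moment (indicator A) t"
proof -
  let ?h = "indicator A :: 'a \<Rightarrow> real"
  let ?D = "\<lambda>x. ?h x - kernel_operator M p t ?h x"
  let ?b = "\<kappa> / d_W"
  have h: "?h \<in> L2_space M" by (rule indicator_L2[OF A fin])
  have b: "0 < ?b" "?b < 1" using \<kappa> by auto
  have nt: "0 < real (Suc m) * t" using t by simp
  have Kn: "kernel_operator M p (real (Suc m) * t) ?h \<in> L2_space M" by (rule kernel_operator_L2[OF nt h])
  have Kt: "kernel_operator M p t ?h \<in> L2_space M" by (rule kernel_operator_L2[OF t h])
  have Sk: "L2_inner M (S (real (Suc k) * t) ?h) (\<lambda>x. ?h x - P t ?h x) =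
      L2_inner M (kernel_operator M p (real (Suc k) * t) ?h) ?D" for k
  proof (rule L2_inner_cong_AE)
    have k: "0 < real (Suc k) * t" using t by simp
    show "AE x in M. S (real (Suc k) * t) ?h x = kernel_operator M p (real (Suc k) * t) ?h x"
      using P_kernel[OF k h] by (simp only: S_pos[OF k])
    show "AE x in M. ?h x - P t ?h x = ?D x" using P_kernel[OF t h] by eventually_elim simp
  qed (use t in \<open>intro L2_measurable S_L2 L2_diff kernel_operator_L2 semigroup_L2 h; simp\<close>)+
  have S0: "L2_inner M (S (real 0 * t) ?h) (\<lambda>x. ?h x - P t ?h x) = L2_inner M ?h ?D"
    using P_kernel[OF t h] h Kt
    by (simp, intro L2_inner_cong_AE L2_measurable L2_diff semigroup_L2 t) auto
  have "L2_inner M ?h (\<lambda>x. ?h x - kernel_operator M p (real (Suc m) * t) ?h x) =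
     L2_inner M ?h (\<lambda>x. ?h x - P (real (Suc m) * t) ?h x)"
    using P_kernel[OF nt h] h Kn
    by (intro L2_inner_cong_AE L2_measurable L2_diff semigroup_L2 nt) auto
  also have "\<dots> = (\<Sum>k<Suc m. L2_inner M (S (real k * t) ?h) (\<lambda>x. ?h x - P t ?h x))"
    by (rule semigroup_telescope[OF h t]) simp
  also have "\<dots> = L2_inner M ?h ?D + (\<Sum>k<m. L2_inner M (kernel_operator M p (real (Suc k) * t) ?h) ?D)"
    unfolding sum.lessThan_Suc_shift S0 Sk ..
  finally have "heat_energy ?h (real (Suc m) * t) =
      ennreal (2 * L2_inner M ?h ?D + (\<Sum>k<m. 2 * L2_inner M (kernel_operator M p (real (Suc k) * t) ?h) ?D))"
    unfolding heat_energy_indicator[OF nt A fin] by (simp add: sum_distrib_left distrib_left)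
  also have "\<dots> \<le> ennreal (2 * L2_inner M ?h ?D) +
      ennreal (\<Sum>k<m. \<bar>2 * L2_inner M (kernel_operator M p (real (Suc k) * t) ?h) ?D\<bar>)"
  proof -
    \<comment> \<open>\<open>ennreal\<close> sends negative reals to 0 and is not additive across
      signs; replacing x by max x 0 covers every sign of x and y.\<close>
    have aux: "ennreal (x + y) \<le> ennreal x + ennreal z" if "y \<le> z" "0 \<le> z" for x y z :: real
    proof -
      have "ennreal (x + y) \<le> ennreal (max x 0 + z)" using that by (intro ennreal_leI) auto
      also have "\<dots> = ennreal (max x 0) + ennreal z" using that by (intro ennreal_plus) auto
      also have "ennreal (max x 0) = ennreal x" by (simp add: max_def ennreal_neg)
      finally show ?thesis .
    qed
    show ?thesis by (rule aux) (auto intro!: sum_mono sum_nonneg)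
  qed
  also have "ennreal (2 * L2_inner M ?h ?D) = heat_energy ?h t"
    by (rule heat_energy_indicator[OF t A fin, symmetric])
  also have "ennreal (\<Sum>k<m. \<bar>2 * L2_inner M (kernel_operator M p (real (Suc k) * t) ?h) ?D\<bar>) =
      (\<Sum>k<m. ennreal \<bar>2 * L2_inner M (kernel_operator M p (real (Suc k) * t) ?h) ?D\<bar>)"
    by (rule sum_ennreal[symmetric]) simp
  also have "\<dots> \<le> (\<Sum>k<m. ennreal (c7 * (real (Suc k) * t) powr (- \<kappa> / d_W)) * heat_moment ?h t)"
    by (intro sum_mono L2_inner_kernel_le t A fin) (use t in simp)
  also have "\<dots> = ennreal (\<Sum>k<m. c7 * (real (Suc k) * t) powr (- \<kappa> / d_W)) * heat_moment ?h t"
    unfolding sum_distrib_right[symmetric] using const_pos by (subst sum_ennreal) auto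
  also have "\<dots> \<le> ennreal (step_const * ((real (Suc m) * t) powr (1 - ?b) / t)) * heat_moment ?h t"
  proof (intro mult_right_mono ennreal_leI)
    have "(\<Sum>k<m. c7 * (real (Suc k) * t) powr (- \<kappa> / d_W)) = c7 * t powr (- ?b) * (\<Sum>k<m. real (Suc k) powr (- ?b))"
      using t by (simp add: powr_mult sum_distrib_left mult_ac del: of_nat_Suc)
    also have "\<dots> \<le> c7 * t powr (- ?b) * (real m powr (1 - ?b) / (1 - ?b))"
      using const_pos by (intro mult_left_mono sum_powr_le b) auto
    also have "\<dots> \<le> c7 * t powr (- ?b) * (real (Suc m) powr (1 - ?b) / (1 - ?b))"
      using const_pos b by (intro mult_left_mono divide_right_mono powr_mono2) auto
    also have "\<dots> = step_const * ((real (Suc m) * t) powr (1 - ?b) / t)"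
    proof -
      have "t powr (1 - ?b) / t = t powr (- ?b)" using t by (simp add: powr_diff powr_minus field_simps)
      then have "real (Suc m) powr (1 - ?b) * (t powr (1 - ?b) / t) = real (Suc m) powr (1 - ?b) * t powr (- ?b)"
        by simp
      moreover have "(real (Suc m) * t) powr (1 - ?b) = real (Suc m) powr (1 - ?b) * t powr (1 - ?b)"
        by (rule powr_mult)
      ultimately have "(real (Suc m) * t) powr (1 - ?b) / t = real (Suc m) powr (1 - ?b) * t powr (- ?b)"
        by simp
      then show ?thesis by (simp only: step_const_def times_divide_eq_left times_divide_eq_right mult_ac)
    qed
    finally show "(\<Sum>k<m. c7 * (real (Suc k) * t) powr (- \<kappa> / d_W)) \<le> step_const * ((real (Suc m) * t) powr (1 - ?b) / t)" .
  qed simp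
  finally show ?thesis by (simp add: add_left_mono)
qed

section \<open>Coarea formula, and passage from sets to functions\<close>

definition level :: "('a \<Rightarrow> real) \<Rightarrow> real \<Rightarrow> 'a set" where
  "level f s = {x. s < f x}"

lemma level_sets: "f \<in> borel_measurable M \<Longrightarrow> level f s \<in> sets M"
  using borel_measurable_less[of "\<lambda>_. s" M f] by (simp add: level_def pred_def)

text \<open>The two indicators differ exactly for s in the half-open interval from min (f x) (f y)
  to max (f x) (f y).\<close>

lemma layer_cake_difference:
  "(\<integral>\<^sup>+s. ennreal \<bar>indicator (level f s) x - indicator (level f s) y\<bar> \<partial>lborel) = ennreal \<bar>f x - f y\<bar>"
proof -
  have "ennreal \<bar>indicator (level f s) x - indicator (level f s) y\<bar> =
      indicator {min (f x) (f y)..<max (f x) (f y)} s" for s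
    by (auto simp: level_def indicator_def)
  then show ?thesis by (simp add: min_def max_def)
qed

text \<open>Kept general in the weight k so that it serves both the energy and the moment.
  Measurability in s is recorded separately because the set estimate is integrated over levels
  afterwards.\<close>

lemma coarea:
  assumes [measurable]: "f \<in> borel_measurable M" "k \<in> borel_measurable (M \<Otimes>\<^sub>M M)"
  shows "(\<lambda>s. \<integral>\<^sup>+z. ennreal \<bar>indicator (level f s) (fst z) - indicator (level f s) (snd z)\<bar> * k z \<partial>(M \<Otimes>\<^sub>M M))
      \<in> borel_measurable lborel"
    and "(\<integral>\<^sup>+z. ennreal \<bar>f (fst z) - f (snd z)\<bar> * k z \<partial>(M \<Otimes>\<^sub>M M)) =
      (\<integral>\<^sup>+s. \<integral>\<^sup>+z. ennreal \<bar>indicator (level f s) (fst z) - indicator (level f s) (snd z)\<bar> * k z \<partial>(M \<Otimes>\<^sub>M M) \<partial>lborel)"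
proof -
  interpret L: pair_sigma_finite lborel "M \<Otimes>\<^sub>M M"
    by (intro pair_sigma_finite.intro lborel.sigma_finite_measure_axioms pair.sigma_finite_measure_axioms)
  \<comment> \<open>Written with conditionals in place of indicators of levels, so that joint
    measurability in (s, x, y) is visible.\<close>
  let ?\<phi> = "\<lambda>w. ennreal \<bar>(if fst w < f (fst (snd w)) then 1 else 0) - (if fst w < f (snd (snd w)) then 1 else 0)\<bar> * k (snd w)"
  have \<phi>: "?\<phi> \<in> borel_measurable (lborel \<Otimes>\<^sub>M (M \<Otimes>\<^sub>M M))" by measurable
  have eq: "ennreal \<bar>indicator (level f s) (fst z) - indicator (level f s) (snd z)\<bar> * k z = ?\<phi> (s, z)" for s z
    by (auto simp: level_def indicator_def)
  show "(\<lambda>s. \<integral>\<^sup>+z. ennreal \<bar>indicator (level f s) (fst z) - indicator (level f s) (snd z)\<bar> * k z \<partial>(M \<Otimes>\<^sub>M M))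
      \<in> borel_measurable lborel"
    unfolding eq using pair.borel_measurable_nn_integral_fst[OF \<phi>] by simp
  have "(\<integral>\<^sup>+z. ennreal \<bar>f (fst z) - f (snd z)\<bar> * k z \<partial>(M \<Otimes>\<^sub>M M)) = (\<integral>\<^sup>+z. \<integral>\<^sup>+s. ?\<phi> (s, z) \<partial>lborel \<partial>(M \<Otimes>\<^sub>M M))"
  proof (rule nn_integral_cong)
    fix z
    have "ennreal \<bar>f (fst z) - f (snd z)\<bar> * k z =
       (\<integral>\<^sup>+s. ennreal \<bar>indicator (level f s) (fst z) - indicator (level f s) (snd z)\<bar> \<partial>lborel) * k z"
      by (simp only: layer_cake_difference)
    also have "\<dots> = (\<integral>\<^sup>+s. ennreal \<bar>indicator (level f s) (fst z) - indicator (level f s) (snd z)\<bar> * k z \<partial>lborel)"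
    proof (rule nn_integral_multc[symmetric])
      have "(\<lambda>s. ennreal \<bar>indicator (level f s) (fst z) - indicator (level f s) (snd z)\<bar>) =
         (\<lambda>s. ennreal \<bar>(if s < f (fst z) then 1 else 0) - (if s < f (snd z) then 1 else 0)\<bar>)"
        by (auto simp: level_def indicator_def)
      then show "(\<lambda>s. ennreal \<bar>indicator (level f s) (fst z) - indicator (level f s) (snd z)\<bar>) \<in> borel_measurable lborel"
        by simp
    qed
    finally show "ennreal \<bar>f (fst z) - f (snd z)\<bar> * k z = (\<integral>\<^sup>+s. ?\<phi> (s, z) \<partial>lborel)" unfolding eq .
  qed
  also have "\<dots> = (\<integral>\<^sup>+s. \<integral>\<^sup>+z. ?\<phi> (s, z) \<partial>(M \<Otimes>\<^sub>M M) \<partial>lborel)" by (rule L.Fubini[OF \<phi>])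
  finally show "(\<integral>\<^sup>+z. ennreal \<bar>f (fst z) - f (snd z)\<bar> * k z \<partial>(M \<Otimes>\<^sub>M M)) =
      (\<integral>\<^sup>+s. \<integral>\<^sup>+z. ennreal \<bar>indicator (level f s) (fst z) - indicator (level f s) (snd z)\<bar> * k z \<partial>(M \<Otimes>\<^sub>M M) \<partial>lborel)"
    unfolding eq .
qed

lemma heat_coarea:
  assumes t: "0 < t" and f: "f \<in> borel_measurable M"
  shows "heat_energy f t = (\<integral>\<^sup>+s. heat_energy (indicator (level f s)) t \<partial>lborel)"
    "(\<lambda>s. heat_energy (indicator (level f s)) t) \<in> borel_measurable lborel"
    "heat_moment f t = (\<integral>\<^sup>+s. heat_moment (indicator (level f s)) t \<partial>lborel)"
    "(\<lambda>s. heat_moment (indicator (level f s)) t) \<in> borel_measurable lborel"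
proof -
  note p_measurable[OF t, measurable]
  have k: "(\<lambda>z. ennreal (p t (fst z) (snd z))) \<in> borel_measurable (M \<Otimes>\<^sub>M M)"
    "(\<lambda>z. ennreal (p t (fst z) (snd z)) * ennreal (dist (fst z) (snd z) powr \<kappa>)) \<in> borel_measurable (M \<Otimes>\<^sub>M M)"
    by measurable
  show "heat_energy f t = (\<integral>\<^sup>+s. heat_energy (indicator (level f s)) t \<partial>lborel)"
    "(\<lambda>s. heat_energy (indicator (level f s)) t) \<in> borel_measurable lborel"
    unfolding heat_energy_def using coarea[OF f k(1)] by auto
  show "heat_moment f t = (\<integral>\<^sup>+s. heat_moment (indicator (level f s)) t \<partial>lborel)"
    "(\<lambda>s. heat_moment (indicator (level f s)) t) \<in> borel_measurable lborel"
    unfolding heat_moment_def using coarea[OF f k(2)] by auto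
qed

text \<open>Markov's inequality; it supplies the finite measure required by the estimate for
  sets.\<close>

lemma emeasure_level_finite:
  assumes f: "integrable M f" and nn: "\<And>x. 0 \<le> f x" and s: "0 < s"
  shows "emeasure M (level f s) < \<infinity>"
proof -
  have [measurable]: "f \<in> borel_measurable M" "level f s \<in> sets M" using f level_sets by auto
  have "emeasure M (level f s) = (\<integral>\<^sup>+x. indicator (level f s) x \<partial>M)" by simp
  also have "\<dots> \<le> (\<integral>\<^sup>+x. ennreal (f x / s) \<partial>M)"
    using s by (intro nn_integral_mono) (auto simp: level_def indicator_def ennreal_1[symmetric] simp del: ennreal_1 intro!: ennreal_leI)
  also have "\<dots> < \<infinity>"
    using f nn s by (subst nn_integral_eq_integral) auto
  finally show ?thesis .
qed

text \<open>For non-negative f each level is harmless: at s > 0 the set has finite measure, at s < 0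
  it is the whole space and has no energy, and s = 0 is a null set of heights.\<close>

lemma heat_energy_nonneg_step:
  assumes t: "0 < t" and f: "integrable M f" and nn: "\<And>x. 0 \<le> f x"
  shows "heat_energy f (real (Suc m) * t) \<le> heat_energy f t +
    ennreal (step_const * ((real (Suc m) * t) powr (1 - \<kappa> / d_W) / t)) * heat_moment f t"
proof -
  let ?c = "ennreal (step_const * ((real (Suc m) * t) powr (1 - \<kappa> / d_W) / t))"
  have fm: "f \<in> borel_measurable M" using f by simp
  have nt: "0 < real (Suc m) * t" using t by simp
  note [measurable] = heat_coarea(2,4)[OF t fm]
  have "heat_energy f (real (Suc m) * t) = (\<integral>\<^sup>+s. heat_energy (indicator (level f s)) (real (Suc m) * t) \<partial>lborel)"
    by (rule heat_coarea(1)[OF nt fm])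
  also have "\<dots> \<le> (\<integral>\<^sup>+s. heat_energy (indicator (level f s)) t + ?c * heat_moment (indicator (level f s)) t \<partial>lborel)"
  proof (rule nn_integral_mono_AE)
    show "AE s in lborel. heat_energy (indicator (level f s)) (real (Suc m) * t) \<le>
        heat_energy (indicator (level f s)) t + ?c * heat_moment (indicator (level f s)) t"
      using AE_lborel_singleton[of 0]
    proof eventually_elim
      case (elim s)
      show ?case
      proof (cases "0 < s")
        case True
        show ?thesis by (intro heat_energy_indicator_step t level_sets fm emeasure_level_finite f nn True)
      next
        case False
        with elim have "s < 0" by simp
        then have "level f s = UNIV" by (auto simp: level_def intro: less_le_trans[OF _ nn])
        then show ?thesis by (simp add: heat_energy_def)
      qed
    qed
  qed
  also have "\<dots> = (\<integral>\<^sup>+s. heat_energy (indicator (level f s)) t \<partial>lborel) +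
      ?c * (\<integral>\<^sup>+s. heat_moment (indicator (level f s)) t \<partial>lborel)"
    by (subst nn_integral_add) (auto simp: nn_integral_cmult)
  finally show ?thesis using heat_coarea(1,3)[OF t fm] by simp
qed

lemma heat_energy_mono:
  assumes "\<And>x y. \<bar>f x - f y\<bar> \<le> \<bar>g x - g y\<bar>"
  shows "heat_energy f t \<le> heat_energy g t" "heat_moment f t \<le> heat_moment g t"
  unfolding heat_energy_def heat_moment_def using assms
  by (intro nn_integral_mono mult_right_mono ennreal_leI; simp)+

lemma heat_energy_triangle:
  assumes t: "0 < t" and [measurable]: "f \<in> borel_measurable M" "g \<in> borel_measurable M"
  shows "heat_energy (\<lambda>x. f x - g x) t \<le> heat_energy f t + heat_energy g t"
proof -
  note p_measurable[OF t, measurable]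
  have "heat_energy (\<lambda>x. f x - g x) t \<le> (\<integral>\<^sup>+z. ennreal \<bar>f (fst z) - f (snd z)\<bar> * ennreal (p t (fst z) (snd z)) +
     ennreal \<bar>g (fst z) - g (snd z)\<bar> * ennreal (p t (fst z) (snd z)) \<partial>(M \<Otimes>\<^sub>M M))"
    unfolding heat_energy_def distrib_right[symmetric]
    by (intro nn_integral_mono mult_right_mono) (auto simp flip: ennreal_plus intro!: ennreal_leI)
  also have "\<dots> = heat_energy f t + heat_energy g t"
    unfolding heat_energy_def by (rule nn_integral_add) measurable
  finally show ?thesis .
qed

text \<open>Levels of a signed f at negative heights can have infinite measure, so f is split into
  positive and negative parts. Both are contractions of f, hence the factor 2.\<close>

lemma heat_energy_step:
  assumes t: "0 < t" and f: "integrable M f"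
  shows "heat_energy f (real (Suc m) * t) \<le> 2 * (heat_energy f t +
    ennreal (step_const * ((real (Suc m) * t) powr (1 - \<kappa> / d_W) / t)) * heat_moment f t)"
proof -
  let ?c = "ennreal (step_const * ((real (Suc m) * t) powr (1 - \<kappa> / d_W) / t))"
  define g where "g x = max (f x) 0" for x
  define h where "h x = max (- f x) 0" for x
  have f_eq: "f = (\<lambda>x. g x - h x)" by (auto simp: g_def h_def)
  have g: "integrable M g" and h: "integrable M h"
    unfolding g_def[abs_def] h_def[abs_def] using f by (auto intro!: integrable_max)
  have lip: "\<bar>g x - g y\<bar> \<le> \<bar>f x - f y\<bar>" "\<bar>h x - h y\<bar> \<le> \<bar>f x - f y\<bar>" for x y
    by (auto simp: g_def h_def)
  have nt: "0 < real (Suc m) * t" using t by simp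
  have "heat_energy f (real (Suc m) * t) = heat_energy (\<lambda>x. g x - h x) (real (Suc m) * t)"
    using f_eq by simp
  also have "\<dots> \<le> heat_energy g (real (Suc m) * t) + heat_energy h (real (Suc m) * t)"
    using g h by (intro heat_energy_triangle nt) auto
  also have "\<dots> \<le> (heat_energy g t + ?c * heat_moment g t) + (heat_energy h t + ?c * heat_moment h t)"
    by (intro add_mono heat_energy_nonneg_step t g h) (auto simp: g_def h_def)
  also have "\<dots> \<le> (heat_energy f t + ?c * heat_moment f t) + (heat_energy f t + ?c * heat_moment f t)"
    by (intro add_mono mult_left_mono heat_energy_mono lip) auto
  finally show ?thesis by (simp only: mult_2)
qed

end

section \<open>Comparison of the seminorms\<close>

context wBE_heat_space
begin

text \<open>Provides the growth hypothesis of the dyadic estimates, with growth exponent \<sigma> +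
  d_H.\<close>

lemma oscillation_le_KS_sup:
  assumes f: "f \<in> borel_measurable M" and r: "0 < r"
  shows "oscillation f r \<le> ennreal (r powr (\<sigma> + d_H)) * (ennreal c2 * KS_sup_seminorm M \<sigma> f)"
proof -
  have "KS_energy M \<sigma> f r \<le> KS_sup_seminorm M \<sigma> f"
    unfolding KS_sup_seminorm_def using r by (intro SUP_upper) auto
  then have "ennreal (c2 * r powr (\<sigma> + d_H)) * KS_energy M \<sigma> f r \<le>
      ennreal (c2 * r powr (\<sigma> + d_H)) * KS_sup_seminorm M \<sigma> f"
    by (rule mult_left_mono) simp
  then show ?thesis
    using oscillation_le_KS_energy[OF f r, of \<sigma>] c2_pos
    by (simp add: ennreal_mult mult_ac)
qed

lemma oscillation_alt:
  "oscillation f r = (\<integral>\<^sup>+z. ennreal \<bar>f (fst z) - f (snd z)\<bar> * indicator {z. dist (fst z) (snd z) < r} z \<partial>(M \<Otimes>\<^sub>M M))"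
  unfolding oscillation_def by (intro nn_integral_cong) (auto simp: Delta_def indicator_def)

lemma AE_p_upper:
  assumes t: "0 < t"
  shows "AE z in M \<Otimes>\<^sub>M M. p t (fst z) (snd z) \<le> sub_gaussian d_H d_W c3 c4 t (dist (fst z) (snd z))"
  using p_bounds by eventually_elim (use t in \<open>auto simp: split_beta'\<close>)

lemma AE_p_lower:
  assumes t: "0 < t"
  shows "AE z in M \<Otimes>\<^sub>M M. sub_gaussian d_H d_W c5 c6 t (dist (fst z) (snd z)) \<le> p t (fst z) (snd z)"
  using p_bounds by eventually_elim (use t in \<open>auto simp: split_beta'\<close>)

text \<open>The exponent \<open>\<lambda>\<^sub>1\<^sup>#\<close> of the theorem, whose hypothesis on \<open>\<kappa>\<close> fixes it.\<close>

definition \<Lambda> :: real where "\<Lambda> = d_W - \<kappa>"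

lemma \<Lambda>_pos: "0 < \<Lambda>" using \<kappa> by (simp add: \<Lambda>_def)

lemma \<Lambda>_exponent: "1 - \<kappa> / d_W = \<Lambda> / d_W"
  using W by (simp add: \<Lambda>_def field_simps)

definition energy_const :: real where
  "energy_const = (c3 + tail_const d_W c3 c4 (\<Lambda> + d_H + 1) * (2 * 2 powr (\<Lambda> + d_H))) * c2"

lemma energy_const_pos: "0 < energy_const"
  unfolding energy_const_def using const_pos c2_pos
  by (intro mult_pos_pos add_pos_nonneg) (auto simp: tail_const_nonneg)

lemma heat_energy_le_KS_sup:
  assumes t: "0 < t" and f [measurable]: "f \<in> borel_measurable M"
  shows "heat_energy f t \<le> ennreal (energy_const * t powr (\<Lambda> / d_W)) * KS_sup_seminorm M \<Lambda> f"
proof -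
  let ?s = "\<Lambda> + d_H"
  let ?K = "c3 + tail_const d_W c3 c4 (?s + 1) * (2 * 2 powr ?s)"
  have K: "0 \<le> ?K" using const_pos by (auto intro!: add_nonneg_nonneg mult_nonneg_nonneg tail_const_nonneg)
  have "heat_energy f t \<le> ennreal (?K * t powr ((?s - d_H) / d_W)) * (ennreal c2 * KS_sup_seminorm M \<Lambda> f)"
    unfolding heat_energy_def
  proof (rule sub_gaussian_integral_le[where \<delta> = "\<lambda>z. dist (fst z) (snd z)"])
    show "AE z in M \<Otimes>\<^sub>M M. p t (fst z) (snd z) \<le> sub_gaussian d_H d_W c3 c4 t (dist (fst z) (snd z))"
      by (rule AE_p_upper[OF t])
    show "(\<integral>\<^sup>+z. ennreal \<bar>f (fst z) - f (snd z)\<bar> * indicator {z. dist (fst z) (snd z) < r} z \<partial>(M \<Otimes>\<^sub>M M))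
        \<le> ennreal (r powr ?s) * (ennreal c2 * KS_sup_seminorm M \<Lambda> f)" if "0 < r" for r
      unfolding oscillation_alt[symmetric] by (rule oscillation_le_KS_sup[OF f that])
  qed (use t const_pos q_pos W \<Lambda>_pos in auto)
  also have "\<dots> = ennreal (?K * t powr ((?s - d_H) / d_W) * c2) * KS_sup_seminorm M \<Lambda> f"
    using K c2_pos by (intro ennreal_mult_assoc) auto
  finally show ?thesis by (simp add: energy_const_def mult_ac)
qed

text \<open>The kernel decay of order d_W + d_H + 1 is \<kappa> more than the \<Lambda> + d_H + 1 of
  the dyadic tail, which compensates for the weight d(x,y)^\<kappa> in the moment.\<close>

definition far_const :: real where
  "far_const = tail_const d_W c3 c4 (d_W + d_H + 1) * (2 * 2 powr (\<Lambda> + d_H)) * c2"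

lemma far_const_nonneg: "0 \<le> far_const"
  unfolding far_const_def using const_pos c2_pos by (simp add: tail_const_nonneg)

text \<open>At time \<open>(\<eta> R)\<^bsup>d_W\<^esup>\<close> with small \<open>\<eta>\<close>, scales above \<open>R\<close> are exponentially rare; this
  is what allows a lower limit over \<open>R\<close> in place of the supremum, up to an absorbable term.\<close>

lemma heat_moment_le:
  assumes R: "0 < R" and \<eta>: "0 < \<eta>" and f [measurable]: "f \<in> borel_measurable M"
    and t_def: "t = (\<eta> * R) powr d_W"
  shows "heat_moment f t \<le> ennreal (t * (c2 * c3 * \<eta> powr (- d_H - d_W))) * KS_energy M \<Lambda> f R +
     ennreal (t * (far_const * \<eta>)) * KS_sup_seminorm M \<Lambda> f"
proof -
  let ?s = "\<Lambda> + d_H"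
  let ?N = "d_W + d_H + 1"
  let ?T = "tail_const d_W c3 c4 ?N"
  have t: "0 < t" using R \<eta> by (simp add: t_def)
  have T: "0 \<le> ?T" using const_pos by (simp add: tail_const_nonneg)
  note p_measurable[OF t, measurable]
  have tp: "t powr (a / d_W) = (\<eta> * R) powr a" for a
    using W by (simp add: t_def powr_powr)
  let ?w = "\<lambda>z. ennreal \<bar>f (fst z) - f (snd z)\<bar>"
  let ?d = "\<lambda>z :: 'a \<times> 'a. dist (fst z) (snd z)"
  let ?near = "\<lambda>z. ennreal (c3 * t powr (- d_H / d_W) * R powr \<kappa>) * (?w z * indicator {z. ?d z < R} z)"
  let ?far = "\<lambda>z. ennreal (?T * t powr ((?N - d_H) / d_W)) *
     (?w z * (ennreal (?d z powr (- (?s + 1))) * indicator {z. R \<le> ?d z} z))"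
  have ind [measurable]: "(\<lambda>z. indicator {z. ?d z < R} z :: ennreal) \<in> borel_measurable (M \<Otimes>\<^sub>M M)"
    "(\<lambda>z. indicator {z. R \<le> ?d z} z :: ennreal) \<in> borel_measurable (M \<Otimes>\<^sub>M M)"
  proof -
    have "(\<lambda>z. indicator {z. ?d z < R} z :: ennreal) = (\<lambda>z. if ?d z < R then 1 else 0)"
      "(\<lambda>z. indicator {z. R \<le> ?d z} z :: ennreal) = (\<lambda>z. if R \<le> ?d z then 1 else 0)" by auto
    then show "(\<lambda>z. indicator {z. ?d z < R} z :: ennreal) \<in> borel_measurable (M \<Otimes>\<^sub>M M)"
      "(\<lambda>z. indicator {z. R \<le> ?d z} z :: ennreal) \<in> borel_measurable (M \<Otimes>\<^sub>M M)" by simp_all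
  qed
  have "heat_moment f t \<le> (\<integral>\<^sup>+z. ?near z + ?far z \<partial>(M \<Otimes>\<^sub>M M))"
    unfolding heat_moment_def
  proof (rule nn_integral_mono_AE)
    show "AE z in M \<Otimes>\<^sub>M M. ?w z * (ennreal (p t (fst z) (snd z)) * ennreal (?d z powr \<kappa>)) \<le> ?near z + ?far z"
      using AE_p_upper[OF t] AE_p_pos[OF t]
    proof eventually_elim
      case (elim z)
      show ?case
      proof (cases "?d z < R")
        case True
        have "p t (fst z) (snd z) * ?d z powr \<kappa> \<le> (c3 * t powr (- d_H / d_W)) * R powr \<kappa>"
          using elim sub_gaussian_le[OF const_pos(1,2), of d_H d_W t "?d z"] True \<kappa> const_pos
          by (intro mult_mono powr_mono2) auto
        then have "ennreal (p t (fst z) (snd z)) * ennreal (?d z powr \<kappa>) \<le> ennreal (c3 * t powr (- d_H / d_W) * R powr \<kappa>)"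
          using elim by (subst ennreal_mult[symmetric]) (auto intro: ennreal_leI)
        then have "?w z * (ennreal (p t (fst z) (snd z)) * ennreal (?d z powr \<kappa>)) \<le> ?near z"
          using True by (simp add: mult.commute[of "?w z"] mult_right_mono)
        then show ?thesis by (simp add: add_increasing2)
      next
        case False
        then have d: "0 < ?d z" using R by linarith
        have "p t (fst z) (snd z) * ?d z powr \<kappa> \<le> (?T * t powr ((?N - d_H) / d_W) * ?d z powr (- ?N)) * ?d z powr \<kappa>"
          using elim sub_gaussian_powr_le[OF const_pos(1,2) W _ t d, of ?N d_H] W q_pos
          by (intro mult_right_mono) (auto simp: tail_const_def)
        also have "\<dots> = ?T * t powr ((?N - d_H) / d_W) * ?d z powr (- (?s + 1))"
        proof -
          have "- ?N + \<kappa> = - (?s + 1)" by (simp add: \<Lambda>_def)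
          then show ?thesis by (simp only: mult.assoc powr_add[symmetric])
        qed
        finally have "ennreal (p t (fst z) (snd z)) * ennreal (?d z powr \<kappa>) \<le>
            ennreal (?T * t powr ((?N - d_H) / d_W)) * ennreal (?d z powr (- (?s + 1)))"
          using elim T by (subst (1 2) ennreal_mult[symmetric]) (auto intro: ennreal_leI)
        then have "?w z * (ennreal (p t (fst z) (snd z)) * ennreal (?d z powr \<kappa>)) \<le>
            ?w z * (ennreal (?T * t powr ((?N - d_H) / d_W)) * ennreal (?d z powr (- (?s + 1))))"
          by (rule mult_left_mono) simp
        also have "\<dots> = ?far z" using False by (simp add: mult_ac)
        finally show ?thesis by (simp add: add_increasing)
      qed
    qed
  qed
  also have "\<dots> = ennreal (c3 * t powr (- d_H / d_W) * R powr \<kappa>) * oscillation f R +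
     ennreal (?T * t powr ((?N - d_H) / d_W)) *
     (\<integral>\<^sup>+z. ?w z * (ennreal (?d z powr (- (?s + 1))) * indicator {z. R \<le> ?d z} z) \<partial>(M \<Otimes>\<^sub>M M))"
    unfolding oscillation_alt by (subst nn_integral_add) (auto simp: nn_integral_cmult)
  also have "\<dots> \<le> ennreal (c3 * t powr (- d_H / d_W) * R powr \<kappa>) * (ennreal (c2 * R powr (\<Lambda> + d_H)) * KS_energy M \<Lambda> f R) +
     ennreal (?T * t powr ((?N - d_H) / d_W)) * (ennreal (2 * 2 powr ?s / R) * (ennreal c2 * KS_sup_seminorm M \<Lambda> f))"
  proof (intro add_mono mult_left_mono oscillation_le_KS_energy f R nn_integral_dyadic_tail)
    show "(\<integral>\<^sup>+z. ?w z * indicator {z. ?d z < r} z \<partial>(M \<Otimes>\<^sub>M M)) \<le> ennreal (r powr ?s) * (ennreal c2 * KS_sup_seminorm M \<Lambda> f)"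
      if "R \<le> r" for r
      unfolding oscillation_alt[symmetric] using R that by (intro oscillation_le_KS_sup[OF f]) simp
  qed (use \<Lambda>_pos q_pos in auto)
  also have "\<dots> = ennreal (c3 * t powr (- d_H / d_W) * R powr \<kappa> * (c2 * R powr (\<Lambda> + d_H))) * KS_energy M \<Lambda> f R +
     ennreal (?T * t powr ((?N - d_H) / d_W) * (2 * 2 powr ?s / R * c2)) * KS_sup_seminorm M \<Lambda> f"
    using c2_pos const_pos R T by (simp only: ennreal_mult_assoc mult_nonneg_nonneg powr_ge_zero less_imp_le
        divide_nonneg_pos zero_le_numeral)
  also have "c3 * t powr (- d_H / d_W) * R powr \<kappa> * (c2 * R powr (\<Lambda> + d_H)) = t * (c2 * c3 * \<eta> powr (- d_H - d_W))"
  proof -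
    have "t powr (- d_H / d_W) * (R powr \<kappa> * R powr (\<Lambda> + d_H)) = \<eta> powr (- d_H) * (R powr (- d_H) * (R powr \<kappa> * R powr (\<Lambda> + d_H)))"
      unfolding tp by (simp add: powr_mult)
    also have "R powr (- d_H) * (R powr \<kappa> * R powr (\<Lambda> + d_H)) = R powr d_W"
      by (simp add: \<Lambda>_def flip: powr_add)
    also have "\<eta> powr (- d_H) * R powr d_W = t * \<eta> powr (- d_H - d_W)"
      using \<eta> by (simp add: t_def powr_mult powr_diff)
    finally show ?thesis by (simp add: mult_ac)
  qed
  \<comment> \<open>The power of t equals (\<eta> R)^(d_W + 1) = t \<eta> R, and R cancels against
    the dyadic factor 1/R. The surplus order 1 in \<open>?N\<close> is thus what yields the small
    factor \<eta>.\<close>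
  also have "?T * t powr ((?N - d_H) / d_W) * (2 * 2 powr ?s / R * c2) = t * (far_const * \<eta>)"
  proof -
    have "t powr ((?N - d_H) / d_W) / R = t * \<eta>"
      unfolding tp using \<eta> R by (simp add: t_def powr_add)
    then have "t powr ((?N - d_H) / d_W) = t * \<eta> * R" using R by (simp add: field_simps)
    then show ?thesis using R by (simp add: far_const_def mult_ac)
  qed
  finally show ?thesis .
qed

text \<open>exp c6 / c5 comes from the near-diagonal kernel bound, 1/c1 from the measure of balls,
  and the power of 2 from allowing t up to 2 r^d_W.\<close>

definition lower_const :: real where
  "lower_const = 2 powr ((\<Lambda> + d_H) / d_W) * exp c6 / (c1 * c5)"

lemma lower_const_pos: "0 < lower_const"
  using const_pos c1_pos by (simp add: lower_const_def)

lemma KS_energy_le_heat_energy: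
  assumes r: "0 < r" and t: "r powr d_W \<le> t" "t \<le> 2 * r powr d_W" and f [measurable]: "f \<in> borel_measurable M"
  shows "KS_energy M \<Lambda> f r \<le> ennreal (lower_const * t powr (- (\<Lambda> / d_W))) * heat_energy f t"
proof -
  let ?s = "\<Lambda> + d_H"
  have "0 < r powr d_W" using r by simp
  then have t0: "0 < t" using t by linarith
  note p_measurable[OF t0, measurable]
  let ?c = "exp c6 / c5 * t powr (d_H / d_W)"
  have c: "0 \<le> ?c" using const_pos by simp
  have "oscillation f r \<le> (\<integral>\<^sup>+z. ennreal ?c * (ennreal \<bar>f (fst z) - f (snd z)\<bar> * ennreal (p t (fst z) (snd z))) \<partial>(M \<Otimes>\<^sub>M M))"
    unfolding oscillation_alt
  proof (rule nn_integral_mono_AE)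
    show "AE z in M \<Otimes>\<^sub>M M. ennreal \<bar>f (fst z) - f (snd z)\<bar> * indicator {z. dist (fst z) (snd z) < r} z \<le>
        ennreal ?c * (ennreal \<bar>f (fst z) - f (snd z)\<bar> * ennreal (p t (fst z) (snd z)))"
      using AE_p_lower[OF t0]
    proof eventually_elim
      case (elim z)
      show ?case
      proof (cases "dist (fst z) (snd z) < r")
        case True
        then have "dist (fst z) (snd z) powr d_W \<le> r powr d_W" using W by (intro powr_mono2) auto
        then have "c5 * t powr (- d_H / d_W) * exp (- c6) \<le> p t (fst z) (snd z)"
          using sub_gaussian_ge[OF const_pos(3,4) W t0, of "dist (fst z) (snd z)" d_H] t elim by simp
        then have "?c * (c5 * t powr (- d_H / d_W) * exp (- c6)) \<le> ?c * p t (fst z) (snd z)"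
          by (intro mult_left_mono c)
        moreover have "?c * (c5 * t powr (- d_H / d_W) * exp (- c6)) = 1"
          using const_pos t0 by (simp add: exp_minus powr_minus field_simps)
        ultimately have "1 \<le> ennreal ?c * ennreal (p t (fst z) (snd z))"
          using c by (simp add: ennreal_mult'[symmetric])
        then have "ennreal \<bar>f (fst z) - f (snd z)\<bar> * 1 \<le> ennreal \<bar>f (fst z) - f (snd z)\<bar> * (ennreal ?c * ennreal (p t (fst z) (snd z)))"
          by (rule mult_left_mono) simp
        then show ?thesis using True by (simp add: mult_ac)
      qed simp
    qed
  qed
  also have "\<dots> = ennreal ?c * heat_energy f t"
    unfolding heat_energy_def by (rule nn_integral_cmult) measurable
  finally have osc: "oscillation f r \<le> ennreal ?c * heat_energy f t" .
  have "KS_energy M \<Lambda> f r \<le> ennreal (1 / (c1 * r powr ?s)) * oscillation f r" by (rule KS_energy_le[OF f r])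
  also have "\<dots> \<le> ennreal (1 / (c1 * r powr ?s)) * (ennreal ?c * heat_energy f t)"
    by (intro mult_left_mono osc) simp
  also have "\<dots> = ennreal (1 / (c1 * r powr ?s) * ?c) * heat_energy f t"
    using c c1_pos by (intro ennreal_mult_assoc) auto
  also have "\<dots> \<le> ennreal (lower_const * t powr (- (\<Lambda> / d_W))) * heat_energy f t"
  proof (intro mult_right_mono ennreal_leI)
    have "t powr (?s / d_W) \<le> (2 * r powr d_W) powr (?s / d_W)"
      using t t0 W \<Lambda>_pos q_pos by (intro powr_mono2) auto
    also have "\<dots> = 2 powr (?s / d_W) * r powr ?s"
      using W by (simp add: powr_mult powr_powr)
    finally have le: "t powr (?s / d_W) \<le> 2 powr (?s / d_W) * r powr ?s" .
    have "1 / r powr ?s \<le> 2 powr (?s / d_W) / t powr (?s / d_W)"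
      using le r t0 by (simp add: field_simps)
    also have "\<dots> = 2 powr (?s / d_W) * (t powr (- (\<Lambda> / d_W)) * t powr (- (d_H / d_W)))"
      by (simp add: add_divide_distrib powr_add powr_minus field_simps)
    finally have "1 / r powr ?s * (?c / c1) \<le> 2 powr (?s / d_W) * (t powr (- (\<Lambda> / d_W)) * t powr (- (d_H / d_W))) * (?c / c1)"
      by (rule mult_right_mono) (rule divide_nonneg_pos[OF c c1_pos])
    also have "\<dots> = lower_const * t powr (- (\<Lambda> / d_W))"
      using t0 by (simp add: lower_const_def powr_minus field_simps)
    finally show "1 / (c1 * r powr ?s) * ?c \<le> lower_const * t powr (- (\<Lambda> / d_W))"
      by (simp add: field_simps)
  qed simp
  finally show ?thesis .
qed

text \<open>The first multiple of \<tau> above a overshoots by at most \<tau> \<le> a.\<close>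

lemma multiple_between:
  fixes \<tau> a :: real
  assumes "0 < \<tau>" "\<tau> \<le> a"
  obtains m where "a \<le> real (Suc m) * \<tau>" "real (Suc m) * \<tau> \<le> 2 * a"
proof -
  define m where "m = nat \<lfloor>a / \<tau>\<rfloor>"
  have nn: "0 \<le> \<lfloor>a / \<tau>\<rfloor>" using assms by simp
  have "real m = of_int \<lfloor>a / \<tau>\<rfloor>" using nn by (simp add: m_def)
  then have "real m \<le> a / \<tau>" "a / \<tau> < real m + 1" by linarith+
  then have "real m * \<tau> \<le> a" "a < (real m + 1) * \<tau>"
    using assms by (simp_all add: pos_le_divide_eq pos_divide_less_eq)
  then show ?thesis using that[of m] assms by (simp add: algebra_simps)
qed

text \<open>Scale r is read off at a time t near r^d_W, and t is reduced to \<tau> = (\<eta> R)^d_W,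
  of which it is a multiple. The moment at \<tau> yields the energy at scale R plus an error \<eta>
  A, while the energy at \<tau> is bounded crudely by \<tau>^(\<Lambda>/d_W) A.\<close>

lemma KS_energy_two_scales:
  assumes f: "integrable M f" and r: "0 < r" and R: "0 < R" "R \<le> r" and \<eta>: "0 < \<eta>" "\<eta> \<le> 1"
  shows "KS_energy M \<Lambda> f r \<le>
     ennreal (2 * lower_const * step_const * (c2 * c3 * \<eta> powr (- d_H - d_W))) * KS_energy M \<Lambda> f R +
     ennreal (2 * lower_const * energy_const * (R / r) powr \<Lambda> + 2 * lower_const * step_const * far_const * \<eta>) *
       KS_sup_seminorm M \<Lambda> f"
proof -
  have fm: "f \<in> borel_measurable M" using f by simp
  define \<tau> where "\<tau> = (\<eta> * R) powr d_W"
  let ?A = "KS_sup_seminorm M \<Lambda> f"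
  let ?\<alpha> = "\<Lambda> / d_W"
  have \<tau>: "0 < \<tau>" using \<eta> R by (simp add: \<tau>_def)
  have \<eta>R: "\<eta> * R \<le> R" using \<eta> R by (simp add: mult_le_cancel_right1)
  have \<tau>r: "\<tau> \<le> r powr d_W" unfolding \<tau>_def using order_trans[OF \<eta>R R(2)] \<eta> R W by (intro powr_mono2) auto
  obtain m where m: "r powr d_W \<le> real (Suc m) * \<tau>" "real (Suc m) * \<tau> \<le> 2 * r powr d_W"
    by (rule multiple_between[OF \<tau> \<tau>r])
  define t where "t = real (Suc m) * \<tau>"
  have t: "0 < t" using \<tau> by (simp add: t_def)
  let ?c = "c2 * c3 * \<eta> powr (- d_H - d_W)"
  have c: "0 \<le> ?c" using c2_pos const_pos by simp
  have l: "0 < lower_const" "0 < step_const" "0 < energy_const" "0 \<le> far_const"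
    by (rule lower_const_pos step_const_pos energy_const_pos far_const_nonneg)+
  let ?L = "lower_const * t powr (- ?\<alpha>)"
  have L: "0 \<le> ?L" using l by simp
  have "KS_energy M \<Lambda> f r \<le> ennreal ?L * heat_energy f t"
    unfolding t_def by (rule KS_energy_le_heat_energy[OF r m fm])
  also have "\<dots> \<le> ennreal ?L * (2 * (heat_energy f \<tau> + ennreal (step_const * (t powr ?\<alpha> / \<tau>)) * heat_moment f \<tau>))"
    using heat_energy_step[OF \<tau> f, of m] by (intro mult_left_mono) (auto simp: t_def \<Lambda>_exponent)
  also have "\<dots> \<le> ennreal ?L * (2 * (ennreal (energy_const * \<tau> powr ?\<alpha>) * ?A +
      ennreal (step_const * (t powr ?\<alpha> / \<tau>)) *
      (ennreal (\<tau> * ?c) * KS_energy M \<Lambda> f R + ennreal (\<tau> * (far_const * \<eta>)) * ?A)))"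
    by (intro mult_left_mono add_mono heat_energy_le_KS_sup heat_moment_le \<tau> fm R \<eta> \<tau>_def) auto
  also have "\<dots> = ennreal (?L * (2 * (step_const * (t powr ?\<alpha> / \<tau>) * (\<tau> * ?c)))) * KS_energy M \<Lambda> f R +
      (ennreal (?L * (2 * (energy_const * \<tau> powr ?\<alpha>))) * ?A +
       ennreal (?L * (2 * (step_const * (t powr ?\<alpha> / \<tau>) * (\<tau> * (far_const * \<eta>))))) * ?A)"
  proof -
    have 2: "(2::ennreal) = ennreal 2" by simp
    show ?thesis
      unfolding 2 distrib_left using L l c t \<tau> \<eta>
      by (simp only: ennreal_mult_assoc mult_nonneg_nonneg powr_ge_zero less_imp_le divide_nonneg_pos zero_le_numeral)
         (simp only: add_ac)
  qed
  also have "\<dots> = ennreal (?L * (2 * (step_const * (t powr ?\<alpha> / \<tau>) * (\<tau> * ?c)))) * KS_energy M \<Lambda> f R +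
      ennreal (?L * (2 * (energy_const * \<tau> powr ?\<alpha>)) +
       ?L * (2 * (step_const * (t powr ?\<alpha> / \<tau>) * (\<tau> * (far_const * \<eta>))))) * ?A"
    unfolding distrib_right[symmetric] using L l c t \<tau> \<eta> by (subst ennreal_plus) auto
  \<comment> \<open>The normalisation t^(-\<Lambda>/d_W) cancels the growth of the step estimate and
    \<tau> cancels its 1/\<tau>: no trace of t or \<tau> is left.\<close>
  also have "?L * (2 * (step_const * (t powr ?\<alpha> / \<tau>) * (\<tau> * ?c))) = 2 * lower_const * step_const * ?c"
    using t \<tau> by (simp add: powr_minus field_simps)
  also have "?L * (2 * (step_const * (t powr ?\<alpha> / \<tau>) * (\<tau> * (far_const * \<eta>)))) = 2 * lower_const * step_const * far_const * \<eta>"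
    using t \<tau> by (simp add: powr_minus field_simps)
  also have "ennreal (2 * lower_const * step_const * ?c) * KS_energy M \<Lambda> f R +
      ennreal (?L * (2 * (energy_const * \<tau> powr ?\<alpha>)) + 2 * lower_const * step_const * far_const * \<eta>) * ?A \<le>
      ennreal (2 * lower_const * step_const * ?c) * KS_energy M \<Lambda> f R +
      ennreal (2 * lower_const * energy_const * (R / r) powr \<Lambda> + 2 * lower_const * step_const * far_const * \<eta>) * ?A"
  proof (intro add_left_mono mult_right_mono ennreal_leI add_right_mono)
    \<comment> \<open>The remaining ratio (\<tau>/t)^(\<Lambda>/d_W) is at most (R/r)^\<Lambda>,
      from \<tau> \<le> R^d_W and t \<ge> r^d_W.\<close>
    have "\<tau> powr ?\<alpha> = (\<eta> * R) powr \<Lambda>" using W by (simp add: \<tau>_def powr_powr)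
    also have "\<dots> \<le> R powr \<Lambda>" using \<eta>R \<eta> R \<Lambda>_pos by (intro powr_mono2) auto
    finally have 1: "\<tau> powr ?\<alpha> \<le> R powr \<Lambda>" .
    have "r powr \<Lambda> = (r powr d_W) powr ?\<alpha>" using W by (simp add: powr_powr)
    also have "\<dots> \<le> t powr ?\<alpha>" using m W \<Lambda>_pos unfolding t_def by (intro powr_mono2) auto
    finally have 2: "r powr \<Lambda> \<le> t powr ?\<alpha>" .
    have "t powr (- ?\<alpha>) * \<tau> powr ?\<alpha> = \<tau> powr ?\<alpha> / t powr ?\<alpha>" using t by (simp add: powr_minus field_simps)
    also have "\<dots> \<le> R powr \<Lambda> / r powr \<Lambda>" using 1 2 r by (intro frac_le) auto
    also have "\<dots> = (R / r) powr \<Lambda>" using R r by (simp add: powr_divide)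
    finally have "2 * lower_const * energy_const * (t powr (- ?\<alpha>) * \<tau> powr ?\<alpha>) \<le> 2 * lower_const * energy_const * (R / r) powr \<Lambda>"
      using l by (intro mult_left_mono) auto
    then show "?L * (2 * (energy_const * \<tau> powr ?\<alpha>)) \<le> 2 * lower_const * energy_const * (R / r) powr \<Lambda>"
      by (simp add: mult_ac)
  qed simp
  finally show ?thesis .
qed

text \<open>First \<eta> is fixed to make the far pairs contribute at most A/4, then the ratio
  \<theta> does the same for the crude energy term. K depends on \<eta> but not on r, R or
  f.\<close>

lemma KS_energy_absorbing:
  obtains K \<theta> where "0 < K" "0 < \<theta>"
    "\<And>f r R. integrable M f \<Longrightarrow> 0 < r \<Longrightarrow> 0 < R \<Longrightarrow> R \<le> \<theta> * r \<Longrightarrow>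
      KS_energy M \<Lambda> f r \<le> ennreal K * KS_energy M \<Lambda> f R + ennreal (1 / 2) * KS_sup_seminorm M \<Lambda> f"
proof -
  define a where "a = 2 * lower_const * energy_const"
  define b where "b = 2 * lower_const * step_const * far_const"
  \<comment> \<open>The summand 1 covers b = 0 and keeps \<eta> \<le> 1.\<close>
  define \<eta> where "\<eta> = 1 / (4 * b + 1)"
  define \<theta> where "\<theta> = (1 / (4 * a + 1)) powr (1 / \<Lambda>)"
  define K where "K = 2 * lower_const * step_const * (c2 * c3 * \<eta> powr (- d_H - d_W))"
  have a: "0 < a" using lower_const_pos energy_const_pos by (simp add: a_def)
  have b: "0 \<le> b" using lower_const_pos step_const_pos far_const_nonneg by (simp add: b_def)
  have \<eta>: "0 < \<eta>" "\<eta> \<le> 1" using b by (auto simp: \<eta>_def)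
  have \<theta>: "0 < \<theta>" "\<theta> \<le> 1" using a \<Lambda>_pos by (auto simp: \<theta>_def intro!: powr_le1)
  have \<theta>p: "\<theta> powr \<Lambda> = 1 / (4 * a + 1)" using a \<Lambda>_pos by (simp add: \<theta>_def powr_powr)
  show ?thesis
  proof (rule that[of K \<theta>])
    show "0 < K" unfolding K_def using lower_const_pos step_const_pos c2_pos const_pos \<eta> by simp
    fix f :: "'a \<Rightarrow> real" and r R assume f: "integrable M f" and r: "0 < (r::real)" and R: "0 < R" "R \<le> \<theta> * r"
    have "\<theta> * r \<le> r" using \<theta> r by (simp add: mult_le_cancel_right1)
    then have Rr: "R \<le> r" using R by linarith
    have "(R / r) powr \<Lambda> \<le> \<theta> powr \<Lambda>" using R r \<Lambda>_pos by (intro powr_mono2) (auto simp: field_simps)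
    then have "a * (R / r) powr \<Lambda> \<le> a * (1 / (4 * a + 1))" using a unfolding \<theta>p by (intro mult_left_mono) auto
    also have "\<dots> \<le> 1 / 4" using a by (simp add: field_simps)
    finally have 1: "a * (R / r) powr \<Lambda> \<le> 1 / 4" .
    have 2: "b * \<eta> \<le> 1 / 4" using b by (simp add: \<eta>_def field_simps)
    have "KS_energy M \<Lambda> f r \<le> ennreal K * KS_energy M \<Lambda> f R + ennreal (a * (R / r) powr \<Lambda> + b * \<eta>) * KS_sup_seminorm M \<Lambda> f"
      using KS_energy_two_scales[OF f r R(1) Rr \<eta>] by (simp add: K_def a_def b_def)
    also have "\<dots> \<le> ennreal K * KS_energy M \<Lambda> f R + ennreal (1 / 2) * KS_sup_seminorm M \<Lambda> f"
      using 1 2 by (intro add_left_mono mult_right_mono ennreal_leI) auto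
    finally show "KS_energy M \<Lambda> f r \<le> ennreal K * KS_energy M \<Lambda> f R + ennreal (1 / 2) * KS_sup_seminorm M \<Lambda> f" .
  qed (rule \<theta>)
qed

text \<open>The inequality holds for every R \<le> \<theta> r, not only along a sequence, so the
  lower limit in R may be taken with r fixed. The supremum over r then leaves A \<le> K L + A/2,
  which finiteness of A allows to be solved.\<close>

lemma KS_sup_le_Liminf:
  obtains K where "0 < K"
    "\<And>f. integrable M f \<Longrightarrow> KS_sup_seminorm M \<Lambda> f < \<infinity> \<Longrightarrow>
      KS_sup_seminorm M \<Lambda> f \<le> ennreal K * Liminf (at_right 0) (KS_energy M \<Lambda> f)"
proof -
  obtain K \<theta> where K: "0 < K" and \<theta>: "0 < \<theta>"
    and abs: "\<And>f r R. integrable M f \<Longrightarrow> 0 < r \<Longrightarrow> 0 < R \<Longrightarrow> R \<le> \<theta> * r \<Longrightarrow>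
      KS_energy M \<Lambda> f r \<le> ennreal K * KS_energy M \<Lambda> f R + ennreal (1 / 2) * KS_sup_seminorm M \<Lambda> f"
    by (rule KS_energy_absorbing) blast
  show ?thesis
  proof (rule that[of "2 * K"])
    fix f :: "'a \<Rightarrow> real" assume f: "integrable M f" and fin: "KS_sup_seminorm M \<Lambda> f < \<infinity>"
    define A where "A = KS_sup_seminorm M \<Lambda> f"
    define L where "L = Liminf (at_right 0) (KS_energy M \<Lambda> f)"
    obtain a where a: "0 \<le> a" "A = ennreal a"
      using fin unfolding A_def[symmetric] by (cases A) auto
    show "KS_sup_seminorm M \<Lambda> f \<le> ennreal (2 * K) * Liminf (at_right 0) (KS_energy M \<Lambda> f)"
      unfolding A_def[symmetric] L_def[symmetric]
    proof (cases L)
      case top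
      then show "A \<le> ennreal (2 * K) * L" using K by (simp add: ennreal_mult_top)
    next
      case (real l)
      have le: "KS_energy M \<Lambda> f r \<le> ennreal (K * l + a / 2)" if r: "0 < r" for r
      proof -
        have "KS_energy M \<Lambda> f r \<le> A" unfolding A_def KS_sup_seminorm_def using r by (intro SUP_upper) auto
        then obtain x where x: "0 \<le> x" "KS_energy M \<Lambda> f r = ennreal x"
          using a by (cases "KS_energy M \<Lambda> f r") (auto simp: top_unique)
        \<comment> \<open>Solved for the energy at scale R, giving a lower bound independent of R.
          If x < a/2 it is 0 by truncation and nothing is lost.\<close>
        have "ennreal ((x - a / 2) / K) \<le> L"
          unfolding L_def
        proof (rule Liminf_bounded)
          have "eventually (\<lambda>R. R \<in> {0<..<\<theta> * r}) (at_right 0)"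
            using \<theta> r by (intro eventually_at_right_real) simp
          then show "eventually (\<lambda>R. ennreal ((x - a / 2) / K) \<le> KS_energy M \<Lambda> f R) (at_right 0)"
          proof eventually_elim
            case (elim R)
            show ?case
            proof (cases "KS_energy M \<Lambda> f R")
              case (real y)
              have "ennreal x \<le> ennreal K * ennreal y + ennreal (1 / 2) * ennreal a"
                using abs[OF f r, of R] elim unfolding x real a(2)[symmetric] A_def by simp
              also have "\<dots> = ennreal (K * y + a / 2)"
              proof -
                have "ennreal K * ennreal y = ennreal (K * y)" "ennreal (1 / 2) * ennreal a = ennreal (1 / 2 * a)"
                  using K real a by (intro ennreal_mult[symmetric]; simp)+
                moreover have "ennreal (K * y) + ennreal (1 / 2 * a) = ennreal (K * y + 1 / 2 * a)"
                  using K real a by (intro ennreal_plus[symmetric]) auto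
                ultimately show ?thesis by (simp only: mult_1 times_divide_eq_left)
              qed
              finally have "x \<le> K * y + a / 2" using K real a by (simp add: ennreal_le_iff del: ennreal_plus)
              then show ?thesis unfolding real using K real by (intro ennreal_leI) (simp add: field_simps)
            qed simp
          qed
        qed
        then have "(x - a / 2) / K \<le> l" using real by (simp add: ennreal_le_iff)
        then show ?thesis unfolding x using K by (intro ennreal_leI) (simp add: field_simps)
      qed
      have "A \<le> ennreal (K * l + a / 2)"
        unfolding A_def KS_sup_seminorm_def by (rule SUP_least) (use le in auto)
      \<comment> \<open>Now between finite reals, so a/2 can be subtracted; this doubles K.\<close>
      then have "a \<le> K * l + a / 2" using a real K by (simp add: ennreal_le_iff del: ennreal_plus)
      then show "A \<le> ennreal (2 * K) * L"
        using K real a by (simp add: ennreal_mult[symmetric] ennreal_leI)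
    qed
  qed (use K in simp)
qed

section \<open>Finiteness of the supremum, and the final comparisons\<close>

lemma oscillation_le_L1:
  assumes f: "integrable M f" and r: "0 < r"
  shows "oscillation f r \<le> 2 * (ennreal (c2 * r powr d_H) * (\<integral>\<^sup>+x. ennreal \<bar>f x\<bar> \<partial>M))"
proof -
  have [measurable]: "f \<in> borel_measurable M" using f by simp
  let ?i = "\<lambda>z. indicator (Delta r) z :: ennreal"
  have inner: "(\<integral>\<^sup>+y. ennreal \<bar>f x\<bar> * ?i (x, y) \<partial>M) \<le> ennreal (c2 * r powr d_H) * ennreal \<bar>f x\<bar>" for x
  proof -
    have "(\<integral>\<^sup>+y. ennreal \<bar>f x\<bar> * ?i (x, y) \<partial>M) = (\<integral>\<^sup>+y. ennreal \<bar>f x\<bar> * indicator (ball x r) y \<partial>M)"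
      by (intro nn_integral_cong) (auto simp: Delta_def indicator_def)
    also have "\<dots> = ennreal \<bar>f x\<bar> * emeasure M (ball x r)" by (simp add: nn_integral_cmult)
    also have "\<dots> \<le> ennreal \<bar>f x\<bar> * ennreal (c2 * r powr d_H)" by (intro mult_left_mono ball_upper r) simp
    finally show ?thesis by (simp add: mult.commute)
  qed
  have half: "(\<integral>\<^sup>+x. \<integral>\<^sup>+y. ennreal \<bar>f x\<bar> * ?i (x, y) \<partial>M \<partial>M) \<le> ennreal (c2 * r powr d_H) * (\<integral>\<^sup>+x. ennreal \<bar>f x\<bar> \<partial>M)"
    unfolding nn_integral_cmult[symmetric, OF measurable_compose[OF borel_measurable_abs[OF \<open>f \<in> borel_measurable M\<close>] measurable_ennreal]]
    by (rule nn_integral_mono) (rule inner)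
  have sym: "?i (x, y) = ?i (y, x)" for x y by (auto simp: Delta_def indicator_def dist_commute)
  have "oscillation f r \<le> (\<integral>\<^sup>+z. ennreal \<bar>f (fst z)\<bar> * ?i z + ennreal \<bar>f (snd z)\<bar> * ?i z \<partial>(M \<Otimes>\<^sub>M M))"
    unfolding oscillation_def distrib_right[symmetric]
    by (intro nn_integral_mono mult_right_mono) (auto simp flip: ennreal_plus intro!: ennreal_leI)
  also have "\<dots> = (\<integral>\<^sup>+z. ennreal \<bar>f (fst z)\<bar> * ?i z \<partial>(M \<Otimes>\<^sub>M M)) + (\<integral>\<^sup>+z. ennreal \<bar>f (snd z)\<bar> * ?i z \<partial>(M \<Otimes>\<^sub>M M))"
    by (rule nn_integral_add) measurable
  also have "(\<integral>\<^sup>+z. ennreal \<bar>f (fst z)\<bar> * ?i z \<partial>(M \<Otimes>\<^sub>M M)) = (\<integral>\<^sup>+x. \<integral>\<^sup>+y. ennreal \<bar>f x\<bar> * ?i (x, y) \<partial>M \<partial>M)"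
    by (subst nn_integral_pair) simp_all
  also have "(\<integral>\<^sup>+z. ennreal \<bar>f (snd z)\<bar> * ?i z \<partial>(M \<Otimes>\<^sub>M M)) = (\<integral>\<^sup>+y. \<integral>\<^sup>+x. ennreal \<bar>f y\<bar> * ?i (x, y) \<partial>M \<partial>M)"
    using pair.nn_integral_snd[of "\<lambda>z. ennreal \<bar>f (snd z)\<bar> * ?i z"] by simp
  also have "\<dots> = (\<integral>\<^sup>+x. \<integral>\<^sup>+y. ennreal \<bar>f x\<bar> * ?i (x, y) \<partial>M \<partial>M)"
    by (subst sym) simp
  finally show ?thesis using half unfolding mult_2 by (meson add_mono order_trans)
qed

text \<open>The upper limit controls radii below some b. Beyond b the triangle inequality bounds the
  energy by the L1 norm times r^(-\<Lambda>), which decreases in r.\<close>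

lemma KS_sup_finite:
  assumes f: "integrable M f" and fin: "KS_seminorm M \<Lambda> f < \<infinity>"
  shows "KS_sup_seminorm M \<Lambda> f < \<infinity>"
proof -
  have fm: "f \<in> borel_measurable M" using f by simp
  obtain C where C: "KS_seminorm M \<Lambda> f < C" "C < \<infinity>" using fin dense by blast
  have "eventually (\<lambda>r. KS_energy M \<Lambda> f r < C) (at_right 0)"
    using C(1) unfolding KS_seminorm_def by (rule Limsup_lessD)
  then obtain b where b: "0 < b" "\<And>r. 0 < r \<Longrightarrow> r < b \<Longrightarrow> KS_energy M \<Lambda> f r < C"
    unfolding eventually_at_right_field by auto
  let ?I = "\<integral>\<^sup>+x. ennreal \<bar>f x\<bar> \<partial>M"
  have I: "?I < \<infinity>" using f by (simp add: integrable_iff_bounded)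
  let ?B = "ennreal (2 * c2 / (c1 * b powr \<Lambda>)) * ?I"
  have "KS_energy M \<Lambda> f r \<le> ?B" if r: "b \<le> r" for r
  proof -
    have r0: "0 < r" using b r by simp
    have "KS_energy M \<Lambda> f r \<le> ennreal (1 / (c1 * r powr (\<Lambda> + d_H))) * oscillation f r" by (rule KS_energy_le[OF fm r0])
    also have "\<dots> \<le> ennreal (1 / (c1 * r powr (\<Lambda> + d_H))) * (ennreal 2 * (ennreal (c2 * r powr d_H) * ?I))"
      using oscillation_le_L1[OF f r0] by (intro mult_left_mono) auto
    also have "\<dots> = ennreal (1 / (c1 * r powr (\<Lambda> + d_H)) * (2 * (c2 * r powr d_H))) * ?I"
      using c1_pos c2_pos by (simp only: ennreal_mult_assoc mult_nonneg_nonneg powr_ge_zero less_imp_le zero_le_numeral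
        zero_le_divide_1_iff)
    also have "1 / (c1 * r powr (\<Lambda> + d_H)) * (2 * (c2 * r powr d_H)) = 2 * c2 / (c1 * r powr \<Lambda>)"
      using r0 by (simp add: powr_add)
    also have "ennreal (2 * c2 / (c1 * r powr \<Lambda>)) * ?I \<le> ?B"
      using b r c1_pos c2_pos \<Lambda>_pos r0
      by (intro mult_right_mono ennreal_leI divide_left_mono mult_left_mono powr_mono2) auto
    finally show ?thesis .
  qed
  then have "KS_energy M \<Lambda> f r \<le> max C ?B" if "0 < r" for r
    using b(2)[of r] that by (cases "r < b") (auto simp: le_max_iff_disj less_imp_le)
  then have "KS_sup_seminorm M \<Lambda> f \<le> max C ?B"
    unfolding KS_sup_seminorm_def by (intro SUP_least) auto
  also have "\<dots> < \<infinity>" using C(2) I by (simp add: ennreal_mult_less_top)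
  finally show ?thesis .
qed

lemma heat_besov_seminorm_eq:
  assumes [measurable]: "f \<in> borel_measurable M"
  shows "heat_besov_seminorm M p (1 - \<kappa> / d_W) f = (SUP t\<in>{0<..}. ennreal (t powr (- (\<Lambda> / d_W))) * heat_energy f t)"
  unfolding heat_besov_seminorm_def \<Lambda>_exponent
proof (rule SUP_cong)
  fix t :: real assume "t \<in> {0<..}"
  then have t: "0 < t" by simp
  note p_measurable[OF t, measurable]
  have "heat_energy f t = (\<integral>\<^sup>+x. \<integral>\<^sup>+y. ennreal \<bar>f x - f y\<bar> * ennreal (p t x y) \<partial>M \<partial>M)"
    unfolding heat_energy_def by (subst nn_integral_pair) simp_all
  \<comment> \<open>The defining integral has the variables in the other order; after renaming,
    pointwise symmetry of p replaces an interchange of integrals.\<close>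
  also have "\<dots> = (\<integral>\<^sup>+y. \<integral>\<^sup>+x. ennreal (\<bar>f x - f y\<bar> * p t x y) \<partial>M \<partial>M)"
    by (intro nn_integral_cong) (simp add: ennreal_mult' abs_minus_commute p_sym[OF t])
  finally show "ennreal (t powr - (\<Lambda> / d_W)) * (\<integral>\<^sup>+y. \<integral>\<^sup>+x. ennreal (\<bar>f x - f y\<bar> * p t x y) \<partial>M \<partial>M) =
      ennreal (t powr - (\<Lambda> / d_W)) * heat_energy f t" by simp
qed simp

lemma heat_besov_le_KS_sup:
  assumes f: "f \<in> borel_measurable M"
  shows "heat_besov_seminorm M p (1 - \<kappa> / d_W) f \<le> ennreal energy_const * KS_sup_seminorm M \<Lambda> f"
  unfolding heat_besov_seminorm_eq[OF f]
proof (rule SUP_least)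
  fix t :: real assume "t \<in> {0<..}"
  then have t: "0 < t" by simp
  have "ennreal (t powr (- (\<Lambda> / d_W))) * heat_energy f t \<le>
      ennreal (t powr (- (\<Lambda> / d_W))) * (ennreal (energy_const * t powr (\<Lambda> / d_W)) * KS_sup_seminorm M \<Lambda> f)"
    by (intro mult_left_mono heat_energy_le_KS_sup t f) simp
  also have "\<dots> = ennreal (t powr (- (\<Lambda> / d_W)) * (energy_const * t powr (\<Lambda> / d_W))) * KS_sup_seminorm M \<Lambda> f"
    using energy_const_pos by (intro ennreal_mult_assoc) auto
  also have "t powr (- (\<Lambda> / d_W)) * (energy_const * t powr (\<Lambda> / d_W)) = energy_const"
    using t by (simp add: powr_minus)
  finally show "ennreal (t powr (- (\<Lambda> / d_W))) * heat_energy f t \<le> ennreal energy_const * KS_sup_seminorm M \<Lambda> f" .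
qed

lemma KS_sup_le_heat_besov:
  assumes f: "f \<in> borel_measurable M"
  shows "KS_sup_seminorm M \<Lambda> f \<le> ennreal lower_const * heat_besov_seminorm M p (1 - \<kappa> / d_W) f"
  unfolding KS_sup_seminorm_def
proof (rule SUP_least)
  fix r :: real assume "r \<in> {0<..}"
  then have r: "0 < r" by simp
  let ?t = "r powr d_W"
  have "KS_energy M \<Lambda> f r \<le> ennreal (lower_const * ?t powr (- (\<Lambda> / d_W))) * heat_energy f ?t"
    by (rule KS_energy_le_heat_energy[OF r _ _ f]) auto
  also have "\<dots> = ennreal lower_const * (ennreal (?t powr (- (\<Lambda> / d_W))) * heat_energy f ?t)"
    using lower_const_pos by (intro ennreal_mult_assoc[symmetric]) auto
  also have "\<dots> \<le> ennreal lower_const * heat_besov_seminorm M p (1 - \<kappa> / d_W) f"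
    unfolding heat_besov_seminorm_eq[OF f] using r by (intro mult_left_mono SUP_upper) auto
  finally show "KS_energy M \<Lambda> f r \<le> ennreal lower_const * heat_besov_seminorm M p (1 - \<kappa> / d_W) f" .
qed

lemma Limsup_le_KS_sup: "Limsup (at_right 0) (KS_energy M \<sigma> f) \<le> KS_sup_seminorm M \<sigma> f"
  unfolding KS_sup_seminorm_def
  using eventually_at_right_less[of "0::real"]
  by (intro Limsup_bounded) (auto elim!: eventually_mono intro: SUP_upper)

lemma Liminf_le_KS_seminorm: "Liminf (at_right 0) (KS_energy M \<sigma> f) \<le> KS_seminorm M \<sigma> f"
  unfolding KS_seminorm_def by (rule Liminf_le_Limsup) simp

lemma KS_space_eq: "KS_space M \<Lambda> = KS_sup_space M \<Lambda>"
  using KS_sup_finite Limsup_le_KS_sup[of \<Lambda>]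
  by (auto simp: KS_space_def KS_sup_space_def L1_space_def KS_seminorm_def intro: le_less_trans)

text \<open>The supremum seminorm is the pivot: it is comparable to the heat seminorm by the kernel
  bounds for all f, and to the lower limit by absorption on the space where it is finite.\<close>

lemma seminorm_comparisons:
  shows "\<exists>c>0. \<exists>C>0. \<forall>f\<in>KS_space M \<Lambda>.
       ennreal c * Liminf (at_right 0) (KS_energy M \<Lambda> f) \<le> heat_besov_seminorm M p (1 - \<kappa> / d_W) f \<and>
       heat_besov_seminorm M p (1 - \<kappa> / d_W) f \<le> ennreal C * Liminf (at_right 0) (KS_energy M \<Lambda> f)"
    and "\<exists>C>0. \<forall>f\<in>KS_space M \<Lambda>. KS_sup_seminorm M \<Lambda> f \<le> ennreal C * Liminf (at_right 0) (KS_energy M \<Lambda> f)"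
proof -
  obtain K where K: "0 < K" and sup_le: "\<And>f. integrable M f \<Longrightarrow> KS_sup_seminorm M \<Lambda> f < \<infinity> \<Longrightarrow>
      KS_sup_seminorm M \<Lambda> f \<le> ennreal K * Liminf (at_right 0) (KS_energy M \<Lambda> f)"
    by (rule KS_sup_le_Liminf) blast
  have sup: "KS_sup_seminorm M \<Lambda> f \<le> ennreal K * Liminf (at_right 0) (KS_energy M \<Lambda> f)"
    if f: "f \<in> KS_space M \<Lambda>" for f
    using f KS_sup_finite[of f] by (intro sup_le) (auto simp: KS_space_def L1_space_def)
  then show "\<exists>C>0. \<forall>f\<in>KS_space M \<Lambda>. KS_sup_seminorm M \<Lambda> f \<le> ennreal C * Liminf (at_right 0) (KS_energy M \<Lambda> f)"
    using K by blast
  have "ennreal (1 / lower_const) * Liminf (at_right 0) (KS_energy M \<Lambda> f) \<le> heat_besov_seminorm M p (1 - \<kappa> / d_W) f \<and>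
      heat_besov_seminorm M p (1 - \<kappa> / d_W) f \<le> ennreal (energy_const * K) * Liminf (at_right 0) (KS_energy M \<Lambda> f)"
    if f: "f \<in> KS_space M \<Lambda>" for f
  proof
    let ?V = "Liminf (at_right 0) (KS_energy M \<Lambda> f)"
    have fm: "f \<in> borel_measurable M" using f by (auto simp: KS_space_def L1_space_def)
    have "?V \<le> KS_sup_seminorm M \<Lambda> f"
      using Liminf_le_KS_seminorm[of \<Lambda> f] Limsup_le_KS_sup[of \<Lambda> f] by (simp add: KS_seminorm_def)
    also have "\<dots> \<le> ennreal lower_const * heat_besov_seminorm M p (1 - \<kappa> / d_W) f"
      by (rule KS_sup_le_heat_besov[OF fm])
    finally have "ennreal (1 / lower_const) * ?V \<le>
        ennreal (1 / lower_const) * (ennreal lower_const * heat_besov_seminorm M p (1 - \<kappa> / d_W) f)"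
      by (rule mult_left_mono) simp
    also have "\<dots> = heat_besov_seminorm M p (1 - \<kappa> / d_W) f"
      using lower_const_pos by (subst ennreal_mult_assoc) auto
    finally show "ennreal (1 / lower_const) * ?V \<le> heat_besov_seminorm M p (1 - \<kappa> / d_W) f" .
    have "heat_besov_seminorm M p (1 - \<kappa> / d_W) f \<le> ennreal energy_const * KS_sup_seminorm M \<Lambda> f"
      by (rule heat_besov_le_KS_sup[OF fm])
    also have "\<dots> \<le> ennreal energy_const * (ennreal K * ?V)" by (intro mult_left_mono sup f) simp
    also have "\<dots> = ennreal (energy_const * K) * ?V"
      using energy_const_pos K by (intro ennreal_mult_assoc) auto
    finally show "heat_besov_seminorm M p (1 - \<kappa> / d_W) f \<le> ennreal (energy_const * K) * ?V" .
  qed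
  then show "\<exists>c>0. \<exists>C>0. \<forall>f\<in>KS_space M \<Lambda>.
       ennreal c * Liminf (at_right 0) (KS_energy M \<Lambda> f) \<le> heat_besov_seminorm M p (1 - \<kappa> / d_W) f \<and>
       heat_besov_seminorm M p (1 - \<kappa> / d_W) f \<le> ennreal C * Liminf (at_right 0) (KS_energy M \<Lambda> f)"
    using K lower_const_pos energy_const_pos
    by (intro exI[of _ "1 / lower_const"] exI[of _ "energy_const * K"] conjI ballI) auto
qed

end

section \<open>Extracting the constants, and the theorem\<close>

lemma sub_gaussian_wBE_heat_space:
  assumes sg: "sub_gaussian_dirichlet_space M E F p d_H d_W" and be: "wBE M p d_W \<kappa>"
  obtains c1 c2 P c3 c4 c5 c6 c7 where "wBE_heat_space M d_H c1 c2 E F P p d_W c3 c4 c5 c6 \<kappa> c7"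
proof -
  interpret sub_gaussian_dirichlet_space M E F p d_H d_W by (rule sg)
  obtain c1 c2 where c: "0 < c1" "0 < c2"
    "\<And>x r. 0 \<le> r \<Longrightarrow> ennreal (c1 * r powr d_H) \<le> emeasure M (ball x r) \<and> emeasure M (ball x r) \<le> ennreal (c2 * r powr d_H)"
    using ahlfors_regular by blast
  obtain c3 c4 c5 c6 where b: "0 < c3" "0 < c4" "0 < c5" "0 < c6"
    "AE (x, y) in M \<Otimes>\<^sub>M M. \<forall>t>0. sub_gaussian d_H d_W c5 c6 t (dist x y) \<le> p t x y \<and>
             p t x y \<le> sub_gaussian d_H d_W c3 c4 t (dist x y)"
    using kernel_bounds by blast
  obtain P where P: "heat_semigroup M E F P"
    "\<And>t g. 0 < t \<Longrightarrow> g \<in> L2_space M \<Longrightarrow> AE x in M. P t g x = kernel_operator M p t g x"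
    using kernel unfolding heat_kernel_def by blast
  obtain c7 where \<kappa>: "0 < \<kappa>" "\<kappa> < d_W" and c7: "0 < c7"
    "\<And>t g x y. 0 < t \<Longrightarrow> g \<in> Linf_space M \<Longrightarrow> \<bar>kernel_operator M p t g x - kernel_operator M p t g y\<bar>
          \<le> c7 * (dist x y powr \<kappa> / t powr (\<kappa> / d_W)) * enn2real (Linf_norm M g)"
    using be unfolding wBE_def by blast
  have "ahlfors_space M d_H c1 c2"
    by (rule ahlfors_space.intro) (use radon c d_H_pos compact_balls in \<open>auto simp: radon_measure_def\<close>)
  then have "wBE_heat_space M d_H c1 c2 E F P p d_W c3 c4 c5 c6 \<kappa> c7"
    by (rule wBE_heat_space.intro[OF _ P(1)])
       (rule wBE_heat_space_axioms.intro; (rule d_W_gt_2 b \<kappa> c7 kernel_continuous P(2))?; assumption?)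
  then show ?thesis by (rule that)
qed

theorem theorem4p9:
  fixes M :: "'a::metric_space measure"
    and E :: "('a \<Rightarrow> real) \<Rightarrow> ('a \<Rightarrow> real) \<Rightarrow> real"
    and F :: "('a \<Rightarrow> real) set"
    and p :: "real \<Rightarrow> 'a \<Rightarrow> 'a \<Rightarrow> real"
    and d_H d_W \<kappa> :: real
  assumes "sub_gaussian_dirichlet_space M E F p d_H d_W"
    and "wBE M p d_W \<kappa>"
    and "ereal \<kappa> = ereal d_W - lambda1_sharp M"
  shows "(\<exists>c>0. \<exists>C>0. \<forall>f\<in>BV M.
            ennreal c * Variation M f \<le> heat_besov_seminorm M p (1 - \<kappa> / d_W) f \<and>
            heat_besov_seminorm M p (1 - \<kappa> / d_W) f \<le> ennreal C * Variation M f)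
       \<and> (\<exists>C>0. \<forall>f\<in>BV M.
            (SUP r\<in>{0<..}. \<integral>\<^sup>+y. averaged_difference M d_W \<kappa> r f y \<partial>M)
              \<le> ennreal C * Liminf (at_right 0) (\<lambda>r. \<integral>\<^sup>+y. averaged_difference M d_W \<kappa> r f y \<partial>M))
       \<and> KS_space M (d_W - \<kappa>) = KS_sup_space M (d_W - \<kappa>)
       \<and> (\<exists>c>0. \<exists>C>0. \<forall>f\<in>KS_space M (d_W - \<kappa>).
            ennreal c * KS_seminorm M (d_W - \<kappa>) f \<le> KS_sup_seminorm M (d_W - \<kappa>) f \<and>
            KS_sup_seminorm M (d_W - \<kappa>) f \<le> ennreal C * KS_seminorm M (d_W - \<kappa>) f)"
proof -
  obtain c1 c2 P c3 c4 c5 c6 c7 where "wBE_heat_space M d_H c1 c2 E F P p d_W c3 c4 c5 c6 \<kappa> c7"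
    by (rule sub_gaussian_wBE_heat_space[OF assms(1,2)])
  then interpret wBE_heat_space M d_H c1 c2 E F P p d_W c3 c4 c5 c6 \<kappa> c7 .
  \<comment> \<open>The equation between extended reals excludes both infinite values of
    \<open>lambda1_sharp M\<close>.\<close>
  have sharp: "real_of_ereal (lambda1_sharp M) = \<Lambda>"
    using assms(3) unfolding \<Lambda>_def by (cases "lambda1_sharp M") auto
  have avg: "(\<integral>\<^sup>+y. averaged_difference M d_W \<kappa> r f y \<partial>M) = KS_energy M \<Lambda> f r"
    if "f \<in> KS_space M \<Lambda>" for f r
    unfolding \<Lambda>_def using that by (intro averaged_difference_KS_energy) (auto simp: KS_space_def L1_space_def)
  obtain C where C: "0 < C" and sup: "\<And>f. f \<in> KS_space M \<Lambda> \<Longrightarrow>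
      KS_sup_seminorm M \<Lambda> f \<le> ennreal C * Liminf (at_right 0) (KS_energy M \<Lambda> f)"
    using seminorm_comparisons(2) by blast
  have KS: "ennreal 1 * KS_seminorm M \<Lambda> f \<le> KS_sup_seminorm M \<Lambda> f \<and>
            KS_sup_seminorm M \<Lambda> f \<le> ennreal C * KS_seminorm M \<Lambda> f" if f: "f \<in> KS_space M \<Lambda>" for f
  proof
    show "ennreal 1 * KS_seminorm M \<Lambda> f \<le> KS_sup_seminorm M \<Lambda> f"
      using Limsup_le_KS_sup by (simp add: KS_seminorm_def)
    show "KS_sup_seminorm M \<Lambda> f \<le> ennreal C * KS_seminorm M \<Lambda> f"
      \<comment> \<open>The lower limit is at most the upper one, so the same C serves.\<close>
      by (rule order_trans[OF sup[OF f]]) (intro mult_left_mono Liminf_le_KS_seminorm, simp)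
  qed
  show ?thesis
    unfolding BV_def Variation_def sharp \<Lambda>_def[symmetric]
  proof (intro conjI)
    show "\<exists>C>0. \<forall>f\<in>KS_space M \<Lambda>. (SUP r\<in>{0<..}. \<integral>\<^sup>+y. averaged_difference M d_W \<kappa> r f y \<partial>M)
              \<le> ennreal C * Liminf (at_right 0) (\<lambda>r. \<integral>\<^sup>+y. averaged_difference M d_W \<kappa> r f y \<partial>M)"
      using C sup by (intro exI[of _ C]) (auto simp: avg KS_sup_seminorm_def)
    show "\<exists>c>0. \<exists>C>0. \<forall>f\<in>KS_space M \<Lambda>. ennreal c * KS_seminorm M \<Lambda> f \<le> KS_sup_seminorm M \<Lambda> f \<and>
            KS_sup_seminorm M \<Lambda> f \<le> ennreal C * KS_seminorm M \<Lambda> f"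
      using C KS by (intro exI[of _ 1] exI[of _ C]) auto
  qed (rule seminorm_comparisons(1) KS_space_eq)+
qed

end
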